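(* Let $n>1$ and let $G$ be a locally nilpotent group with an $n$-cyclotomic automorphism. Let $p$ be the largest prime divisor of $n$. Then every $k$-generated subgroup $N$ of $G$ is nilpotent of class $\operatorname{c}(N)\le\max\{(p-1)^{2^{(p-1)}},\ \operatorname{C}((2p-3)\cdot k,\,p)\}$.
   Context: For $n>1$, an automorphism $\alpha$ of $G$ is $n$-cyclotomic if, writing $\Phi_n(t)=b_0+\cdots+b_et^e$ (the $n$-th cyclotomic polynomial), $x^{b_0}\alpha(x^{b_1})\cdots\alpha^e(x^{b_e})=1_G$ for all $x\in G$. $\operatorname{C}(d,p)$ denotes a natural number (depending only on $d$ and the prime $p$; its existence is a theorem of Khukhro) such that every finite $p$-group on $d$ generators admitting a $p$-cyclotomic automorphism is nilpotent of class at most $\operatorname{C}(d,p)$. *)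

theory Defs
  imports "HOL-Algebra.Generated_Groups" "HOL-Computational_Algebra.Polynomial"
begin

definition cyclotomic_poly :: "nat \<Rightarrow> int poly" where
  "cyclotomic_poly n = (THE q. map_poly of_int q =
      (\<Prod>k\<in>{k. 1 \<le> k \<and> k \<le> n \<and> coprime k n}.
          [: - cis (2 * pi * real k / real n), (1::complex) :]))"

fun ordered_prod :: "('a, 'b) monoid_scheme \<Rightarrow> (nat \<Rightarrow> 'a) \<Rightarrow> nat \<Rightarrow> 'a" where
  "ordered_prod G f 0 = f 0"
| "ordered_prod G f (Suc i) = ordered_prod G f i \<otimes>\<^bsub>G\<^esub> f (Suc i)"

definition cyclotomic_aut :: "('a, 'b) monoid_scheme \<Rightarrow> nat \<Rightarrow> ('a \<Rightarrow> 'a) \<Rightarrow> bool" where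
  "cyclotomic_aut G n \<alpha> \<longleftrightarrow> \<alpha> \<in> iso G G \<and>
     (\<forall>x \<in> carrier G.
        ordered_prod G (\<lambda>i. (\<alpha> ^^ i) (x [^]\<^bsub>G\<^esub> (Polynomial.coeff (cyclotomic_poly n) i)))
          (Polynomial.degree (cyclotomic_poly n)) = \<one>\<^bsub>G\<^esub>)"

definition comm_set :: "('a, 'b) monoid_scheme \<Rightarrow> 'a set \<Rightarrow> 'a set \<Rightarrow> 'a set" where
  "comm_set G A B = {a \<otimes>\<^bsub>G\<^esub> b \<otimes>\<^bsub>G\<^esub> inv\<^bsub>G\<^esub> a \<otimes>\<^bsub>G\<^esub> inv\<^bsub>G\<^esub> b | a b. a \<in> A \<and> b \<in> B}"

text \<open>Lower central series: lcs G 0 = G = gamma_1, lcs G (Suc i) = [lcs G i, G].\<close>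
fun lcs :: "('a, 'b) monoid_scheme \<Rightarrow> nat \<Rightarrow> 'a set" where
  "lcs G 0 = carrier G"
| "lcs G (Suc i) = generate G (comm_set G (lcs G i) (carrier G))"

definition nilpotent_class_le :: "('a, 'b) monoid_scheme \<Rightarrow> nat \<Rightarrow> bool" where
  "nilpotent_class_le G c \<longleftrightarrow> lcs G c = {\<one>\<^bsub>G\<^esub>}"

definition locally_nilpotent :: "('a, 'b) monoid_scheme \<Rightarrow> bool" where
  "locally_nilpotent G \<longleftrightarrow> (\<forall>S. finite S \<and> S \<subseteq> carrier G \<longrightarrow>
      (\<exists>c. nilpotent_class_le (G\<lparr>carrier := generate G S\<rparr>) c))"

definition k_generated :: "('a, 'b) monoid_scheme \<Rightarrow> nat \<Rightarrow> 'a set \<Rightarrow> bool" where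
  "k_generated G k N \<longleftrightarrow> (\<exists>S. finite S \<and> card S \<le> k \<and> S \<subseteq> carrier G \<and> N = generate G S)"

text \<open>Khukhro's bound: C d p bounds the class of every finite p-group on d generators
admitting a p-cyclotomic automorphism. Groups are taken with carrier in nat, which
loses no generality (every finite group is isomorphic to such a group).\<close>
definition khukhro_bound :: "(nat \<Rightarrow> nat \<Rightarrow> nat) \<Rightarrow> bool" where
  "khukhro_bound C \<longleftrightarrow> (\<forall>d p (H :: nat monoid) \<alpha>. prime p \<and> group H \<and> finite (carrier H) \<and>
      (\<exists>m. card (carrier H) = p ^ m) \<and> k_generated H d (carrier H) \<and> cyclotomic_aut H p \<alpha>
      \<longrightarrow> nilpotent_class_le H (C d p))"

end

theory Submission
  imports Defs "HOL-Algebra.Sylow" "HOL-Algebra.Multiplicative_Group"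
    "HOL-Computational_Algebra.Primes" "HOL-Number_Theory.Cong"
begin

text \<open>Let \<open>r\<close> be a prime divisor of \<open>n\<close>. The polynomial \<open>\<Sum>i<r. X^(i * (n div r))\<close> is a multiple of
\<open>\<Phi>\<^sub>n\<close>, so \<open>\<beta> = \<alpha>^(n div r)\<close> satisfies \<open>1 + \<beta> + \<dots> + \<beta>^(r - 1) = 0\<close> on every factor of the lower
central series. Passing to formal eigenvectors of \<open>\<beta>\<close>, the factors form a Lie ring graded modulo
\<open>r\<close> whose component of degree zero is trivial. By Kreknin such a ring is soluble of derived length
at most \<open>2^(r - 1) - 1\<close>, and by Higman, Kreknin and Kostrikin it is then nilpotent of class at most
the sum of the powers \<open>(r - 1)^i\<close> with \<open>i < 2^(r - 1) - 1\<close>. Hence in a nilpotent \<open>\<alpha>\<close>-invariant subgroup the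
lower central series term at this position has exponent a power of \<open>r\<close>. If \<open>n\<close> has two prime
divisors, this term is trivial. If \<open>n\<close> is a power of \<open>p\<close>, then \<open>\<beta>\<close> is a genuine \<open>p\<close>-cyclotomic
automorphism; a nontrivial \<open>p\<close>-element of the finitely generated subgroup survives in some
\<open>\<beta>\<close>-invariant finite \<open>p\<close>-quotient, and Khukhro's bound applies there.\<close>

section \<open>Commutator trees and the Kreknin--Higman theorem\<close>

text \<open>Eigenvectors of \<beta> call for a root of unity and for division by r, and the factors
  of the lower central series offer neither. The Lie argument therefore runs on formal commutator
  trees, which are evaluated in groups only afterwards, coefficient by coefficient in a formal u
  with u^r = 1. Powers of r are lost in two places: a commutator of degree zero is fixed by \<beta>,
  so the vanishing of 1 + \<beta> + ... + \<beta>^(r - 1) only kills r times its value; and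
  recovering an element from its eigenvectors multiplies it by a further power of r. Hence the
  outcome is an exponent and not triviality, and the number of primes dividing n matters. The bound
  (r - 1)^(2^(r - 1)) dominates the sum of powers and grows with r, so the largest prime divisor
  controls all of them. As \<Phi>_p has degree p - 1, a subgroup with k generators lies in a
  \<beta>-invariant one with (p - 1) k \<le> (2 p - 3) k generators, whence the argument of C. All
  work is done in such an invariant subgroup, and the class bound is inherited by N.\<close>

datatype 'a lie_tree = Leaf 'a | Node "'a lie_tree" "'a lie_tree"

fun leaves :: "'a lie_tree \<Rightarrow> 'a multiset" where
  "leaves (Leaf x) = {#x#}"
| "leaves (Node a b) = leaves a + leaves b"

text \<open>The left-normed commutator [t, c1, ..., cn], read as a context whose hole is the
  innermost entry.\<close>

definition plug :: "'a lie_tree \<Rightarrow> 'a lie_tree list \<Rightarrow> 'a lie_tree" where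
  "plug t cs = foldl Node t cs"

lemma plug_simps [simp]: "plug t [] = t" "plug t (c # cs) = plug (Node t c) cs"
  by (simp_all add: plug_def)

lemma plug_append: "plug t (cs @ ds) = plug (plug t cs) ds"
  by (simp add: plug_def)

lemma plug_snoc: "plug t (cs @ [c]) = Node (plug t cs) c"
  by (simp add: plug_def)

lemma leaves_plug: "leaves (plug t cs) = leaves t + sum_list (map leaves cs)"
  by (induction cs arbitrary: t) (auto simp: ac_simps)

locale graded_trees =
  fixes p :: nat and d :: "'a \<Rightarrow> nat"
  assumes p_prime: "prime p"
begin

lemma p_pos: "p > 0" "p > 1"
  using p_prime prime_gt_0_nat prime_gt_1_nat by auto

text \<open>Degrees are stored as the representatives 0, ..., p - 1 of residues, because Kreknin's
  argument compares them by size.\<close>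

definition deg :: "'a lie_tree \<Rightarrow> nat" where
  "deg t = (\<Sum>x\<in>#leaves t. d x) mod p"

lemma deg_less: "deg t < p"
  using p_pos by (simp add: deg_def)

lemma deg_Node: "deg (Node a b) = (deg a + deg b) mod p"
  by (simp add: deg_def mod_add_eq)

lemma deg_plug_cong: "deg a = deg b \<Longrightarrow> deg (plug a cs) = deg (plug b cs)"
proof (induction cs arbitrary: a b)
  case (Cons c cs)
  then show ?case using deg_Node by (metis plug_simps(2))
qed simp

text \<open>\<open>cl B\<close> consists of trees whose value, in every Lie ring graded modulo \<open>p\<close> with trivial
component of degree zero, is a linear combination of the values of trees in \<open>B\<close>. By symmetry
it suffices to apply the Jacobi identity in the contexts \<^const>\<open>plug\<close>.\<close>

inductive_set cl :: "'a lie_tree set \<Rightarrow> 'a lie_tree set" for B where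
  base: "t \<in> B \<Longrightarrow> t \<in> cl B"
| zero: "deg a = 0 \<Longrightarrow> plug a cs \<in> cl B"
| sym: "plug (Node b a) cs \<in> cl B \<Longrightarrow> plug (Node a b) cs \<in> cl B"
| jac: "plug (Node (Node a c) b) cs \<in> cl B \<Longrightarrow> plug (Node a (Node b c)) cs \<in> cl B
         \<Longrightarrow> plug (Node (Node a b) c) cs \<in> cl B"

lemma cl_zero: "deg t = 0 \<Longrightarrow> t \<in> cl B"
  using zero[of t "[]"] by simp

lemma cl_sym: "Node b a \<in> cl B \<Longrightarrow> Node a b \<in> cl B"
  using sym[of b a "[]"] by simp

lemma cl_jac: "Node (Node a c) b \<in> cl B \<Longrightarrow> Node a (Node b c) \<in> cl B \<Longrightarrow> Node (Node a b) c \<in> cl B"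
  using jac[of a c b "[]"] by simp

text \<open>Antisymmetry turns \<open>cl_jac\<close>, which rearranges a bracket on the left, into a
  rule that splits a bracket in the right entry.\<close>

lemma cl_jac': "Node (Node c a) b \<in> cl B \<Longrightarrow> Node (Node c b) a \<in> cl B \<Longrightarrow> Node c (Node a b) \<in> cl B"
proof -
  assume *: "Node (Node c a) b \<in> cl B" "Node (Node c b) a \<in> cl B"
  have 1: "Node (Node a c) b \<in> cl B" using sym[of c a "[b]"] * by simp
  have "Node (Node b c) a \<in> cl B" using sym[of c b "[a]"] * by simp
  then have "Node a (Node b c) \<in> cl B" by (rule cl_sym)
  then have "Node (Node a b) c \<in> cl B" using 1 cl_jac by blast
  then show ?thesis by (rule cl_sym)
qed

lemma cl_trans: "t \<in> cl A \<Longrightarrow> A \<subseteq> cl B \<Longrightarrow> t \<in> cl B"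
  by (induction rule: cl.induct) (auto intro: cl.intros)

lemma cl_plug: "t \<in> cl A \<Longrightarrow> plug t ds \<in> cl ((\<lambda>t. plug t ds) ` A)"
proof (induction rule: cl.induct)
  case (zero a cs)
  then show ?case using cl.zero[of a "cs @ ds"] by (simp add: plug_append)
next
  case (sym b a cs)
  then show ?case using cl.sym[of b a "cs @ ds"] by (simp add: plug_append)
next
  case (jac a c b cs)
  then show ?case using cl.jac[of a c b "cs @ ds"] by (simp add: plug_append)
qed (auto intro: base)

lemma cl_Node1: "t \<in> cl A \<Longrightarrow> (\<And>a. a \<in> A \<Longrightarrow> Node a b \<in> cl B) \<Longrightarrow> Node t b \<in> cl B"
  using cl_trans[OF cl_plug[of t A "[b]"], of B] by auto

lemma cl_Node2: "t \<in> cl A \<Longrightarrow> (\<And>a. a \<in> A \<Longrightarrow> Node b a \<in> cl B) \<Longrightarrow> Node b t \<in> cl B"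
  by (rule cl_sym, rule cl_Node1, assumption, rule cl_sym)

text \<open>Antisymmetry and Jacobi preserve the degree, so a derivation can only start from base
  trees of the degree of \<open>t\<close> and from instances of \<open>zero\<close>.\<close>

lemma cl_deg: "t \<in> cl B \<Longrightarrow> t \<in> cl {b \<in> B. deg b = deg t}"
proof (induction rule: cl.induct)
  case (base t)
  then show ?case by (auto intro: cl.base)
next
  case (zero a cs)
  then show ?case by (auto intro: cl.zero)
next
  case (sym b a cs)
  have "deg (plug (Node b a) cs) = deg (plug (Node a b) cs)"
    by (rule deg_plug_cong) (simp add: deg_Node add.commute)
  then show ?case using sym cl.sym by simp
next
  case (jac a c b cs)
  have "deg (plug (Node (Node a c) b) cs) = deg (plug (Node (Node a b) c) cs)"
    "deg (plug (Node a (Node b c)) cs) = deg (plug (Node (Node a b) c) cs)"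
    by (rule deg_plug_cong, simp add: deg_Node mod_simps ac_simps)+
  then show ?case using jac cl.jac by simp
qed

section \<open>Kreknin: solubility of the graded Lie ring\<close>

inductive_set gen :: "'a lie_tree set \<Rightarrow> 'a lie_tree set" for X where
  gen_base: "t \<in> X \<Longrightarrow> t \<in> gen X"
| gen_Node: "a \<in> gen X \<Longrightarrow> b \<in> gen X \<Longrightarrow> Node a b \<in> gen X"

text \<open>Sets closed under \<open>Node\<close> stand for subrings and \<open>der\<close> for the
  derived subring; linear spans are left to \<open>cl\<close>, so that no sums of trees
  occur.\<close>

definition closed :: "'a lie_tree set \<Rightarrow> bool" where
  "closed R \<longleftrightarrow> (\<forall>a\<in>R. \<forall>b\<in>R. Node a b \<in> R)"

definition der :: "'a lie_tree set \<Rightarrow> 'a lie_tree set" where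
  "der R = {Node a b |a b. a \<in> R \<and> b \<in> R}"

lemma der_subset: "closed R \<Longrightarrow> der R \<subseteq> R"
  by (auto simp: closed_def der_def)

lemma closed_der: "closed R \<Longrightarrow> closed (der R)"
  by (auto simp: closed_def der_def)

lemma closed_der_pow: "closed R \<Longrightarrow> closed ((der ^^ s) R)"
  by (induction s) (auto intro: closed_der)

lemma der_pow_subset: "closed R \<Longrightarrow> (der ^^ s) R \<subseteq> R"
  using closed_der_pow der_subset by (induction s) fastforce+

text \<open>Modulo \<open>cl\<close> the bracket is bilinear: both entries may be rewritten over
  \<open>gen Y\<close>, one after the other.\<close>

lemma gen_cl: "t \<in> gen X \<Longrightarrow> X \<subseteq> cl (gen Y) \<Longrightarrow> t \<in> cl (gen Y)"
proof (induction rule: gen.induct)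
  case (gen_Node a b)
  have "Node a' b \<in> cl (gen Y)" if "a' \<in> gen Y" for a'
    by (rule cl_Node2[of b "gen Y"]) (use gen_Node that in \<open>auto intro!: cl.base gen.gen_Node\<close>)
  then show ?case using gen_Node by (intro cl_Node1[of a "gen Y"]) auto
qed auto

lemma gen_closed_subset: "t \<in> gen X \<Longrightarrow> closed R \<Longrightarrow> X \<subseteq> R \<Longrightarrow> t \<in> R"
  by (induction rule: gen.induct) (auto simp: closed_def)

text \<open>Jacobi peels the right entry, [a, [b1, b2]] = [a, b1, b2] - [a, b2, b1], until it is a
  generator; the left entries [a, b1] and [a, b2] stay in \<open>R\<close>.\<close>

lemma Node_gen:
  assumes "b \<in> gen X" "closed R" "X \<subseteq> R" "a \<in> R"
  shows "Node a b \<in> cl {Node u y |u y. u \<in> R \<and> y \<in> X}"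
  using assms(1,4)
proof (induction arbitrary: a rule: gen.induct)
  case (gen_base t)
  then show ?case by (auto intro: cl.base)
next
  case (gen_Node b1 b2)
  have R: "b1 \<in> R" "b2 \<in> R" using gen_closed_subset gen_Node assms by blast+
  then have "Node a b1 \<in> R" "Node a b2 \<in> R"
    using gen_Node.prems assms by (auto simp: closed_def)
  then show ?case using gen_Node by (auto intro: cl_jac')
qed

text \<open>In a commutator of total degree \<open>k\<close> whose last entry has degree at least \<open>k\<close>, both
factors have degree greater than \<open>k\<close>, since no factor has degree zero.\<close>

lemma degree_component:
  assumes "closed R" "a \<in> R" "b \<in> cl (gen {t \<in> R. deg t \<ge> k})" "deg (Node a b) = k" "k > 0"
  shows "Node a b \<in> cl (gen {t \<in> R. deg t > k})"
proof -
  let ?X = "{t \<in> R. deg t \<ge> k}"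
  let ?U = "{Node u y |u y. u \<in> R \<and> y \<in> ?X}"
  have "Node a b \<in> cl ?U"
    using assms Node_gen[of _ ?X R a] by (auto intro!: cl_Node2[of b "gen ?X"])
  then have *: "Node a b \<in> cl {t \<in> ?U. deg t = k}"
    using cl_deg[of "Node a b" ?U] assms by simp
  have "Node u y \<in> cl (gen {t \<in> R. deg t > k})" if "u \<in> R" "y \<in> R" "deg y \<ge> k" "deg (Node u y) = k" for u y
  proof (cases "deg u = 0")
    case True
    then show ?thesis using zero[of u "[y]"] by simp
  next
    case False
    have e: "(deg u + deg y) mod p = k" using that deg_Node by simp
    have l: "deg u < p" "deg y < p" by (rule deg_less)+
    have s: "deg u + deg y = k + p"
    proof (cases "deg u + deg y < p")
      case True
      then show ?thesis using e that False by simp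
    next
      case 2: False
      then have "(deg u + deg y) mod p = deg u + deg y - p" using l by (simp add: mod_if)
      then show ?thesis using e 2 by simp
    qed
    then have "deg u > k" "deg y > k" using l by auto
    then have "Node u y \<in> gen {t \<in> R. deg t > k}"
      using that by (intro gen.gen_Node gen.gen_base) auto
    then show ?thesis by (rule cl.base)
  qed
  then show ?thesis using * by (auto intro: cl_trans)
qed

text \<open>Induction on \<open>k\<close> with \<open>R\<close> arbitrary, so that the hypothesis
  applies twice: to \<open>R\<close>, and to the term one derivation further on. In between,
  \<open>degree_component\<close> pushes elements of degree \<open>Suc k\<close> into higher
  degrees. With s(k) = 2^k - 1 the count is s(k) + 1 + s(k) = s(k + 1).\<close>

lemma kreknin_step:
  "closed R \<Longrightarrow> (der ^^ (2 ^ k - 1)) R \<subseteq> cl (gen {t \<in> R. deg t > k})"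
proof (induction k arbitrary: R)
  case 0
  have "t \<in> cl (gen {t \<in> R. 0 < deg t})" if "t \<in> R" for t
    using that by (cases "deg t = 0") (auto intro: cl_zero cl.base gen.intros)
  then show ?case by auto
next
  case (Suc k)
  let ?s = "2 ^ k - 1 :: nat"
  \<comment> \<open>The extra derivation makes every element of \<open>?R'\<close> a bracket of two
    elements of the \<open>?s\<close>-th derived term, the form that \<open>degree_component\<close>
    asks for.\<close>
  let ?R' = "(der ^^ Suc ?s) R"
  have cR': "closed ?R'" and sR': "?R' \<subseteq> R"
    using Suc.prems closed_der_pow der_pow_subset by blast+
  have ge: "{t \<in> A. deg t > k} = {t \<in> A. deg t \<ge> Suc k}" for A by auto
  have IH: "(der ^^ ?s) R \<subseteq> cl (gen {t \<in> R. deg t \<ge> Suc k})"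
    using Suc.IH[OF Suc.prems] ge by simp
  have X: "{t \<in> ?R'. deg t > k} \<subseteq> cl (gen {t \<in> R. deg t > Suc k})"
  proof
    fix t assume t: "t \<in> {t \<in> ?R'. deg t > k}"
    show "t \<in> cl (gen {t \<in> R. deg t > Suc k})"
    proof (cases "deg t = Suc k")
      case True
      obtain a b where ab: "t = Node a b" "a \<in> (der ^^ ?s) R" "b \<in> (der ^^ ?s) R"
        using t unfolding funpow.simps o_def der_def by auto
      show ?thesis unfolding ab(1)
        by (rule degree_component)
          (use ab True Suc.prems IH der_pow_subset in auto)
    next
      case False
      then show ?thesis using t sR' by (auto intro!: cl.base gen.intros)
    qed
  qed
  have "(der ^^ ?s) ?R' \<subseteq> cl (gen {t \<in> ?R'. deg t > k})" using Suc.IH[OF cR'] .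
  moreover have "gen {t \<in> ?R'. deg t > k} \<subseteq> cl (gen {t \<in> R. deg t > Suc k})"
    using X gen_cl by blast
  ultimately have "(der ^^ ?s) ?R' \<subseteq> cl (gen {t \<in> R. deg t > Suc k})" using cl_trans by blast
  moreover have "(der ^^ ?s) ?R' = (der ^^ (?s + Suc ?s)) R" by (metis funpow_add o_apply)
  moreover have "?s + Suc ?s = 2 ^ Suc k - 1"
  proof -
    have "(2::nat)^k \<ge> 1" by simp
    then show ?thesis by simp
  qed
  ultimately show ?case by (simp del: funpow.simps)
qed

text \<open>Degrees are smaller than \<open>p\<close>, so \<open>kreknin_step\<close> with
  \<open>k = p - 1\<close> leaves no generators at all.\<close>

lemma kreknin: "(der ^^ (2 ^ (p - 1) - 1)) UNIV \<subseteq> cl {}"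
proof -
  have "gen {t. deg t > p - 1} = {}"
  proof -
    have "\<not> deg t > p - 1" for t using deg_less[of t] by simp
    then have e: "{t. deg t > p - 1} = {}" by blast
    have "t \<in> gen {} \<Longrightarrow> False" for t by (induction rule: gen.induct) auto
    then show ?thesis unfolding e by blast
  qed
  moreover have "closed UNIV" by (simp add: closed_def)
  ultimately show ?thesis using kreknin_step[of UNIV "p - 1"] by simp
qed

section \<open>Higman, Kreknin and Kostrikin: from solubility to nilpotency\<close>

fun gam :: "'a lie_tree set \<Rightarrow> nat \<Rightarrow> 'a lie_tree set" where
  "gam R 0 = R"
| "gam R (Suc i) = {Node a z |a z. a \<in> gam R i \<and> z \<in> R}"

lemma gam_add: "gam R (i + j) = {plug t zs |t zs. t \<in> gam R i \<and> length zs = j \<and> set zs \<subseteq> R}"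
proof (induction j)
  case (Suc j)
  show ?case
  proof (intro equalityI subsetI)
    fix x assume "x \<in> gam R (i + Suc j)"
    then obtain t zs z where "x = Node (plug t zs) z" "t \<in> gam R i" "length zs = j" "set zs \<subseteq> R" "z \<in> R"
      using Suc by auto
    then show "x \<in> {plug t zs |t zs. t \<in> gam R i \<and> length zs = Suc j \<and> set zs \<subseteq> R}"
      by (auto intro!: exI[of _ t] exI[of _ "zs @ [z]"] simp: plug_snoc)
  next
    fix x assume "x \<in> {plug t zs |t zs. t \<in> gam R i \<and> length zs = Suc j \<and> set zs \<subseteq> R}"
    then obtain t zs where x: "x = plug t zs" "t \<in> gam R i" "length zs = Suc j" "set zs \<subseteq> R" by auto
    then obtain ys y where "zs = ys @ [y]" by (metis Zero_not_Suc list.size(3) rev_exhaust)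
    then show "x \<in> gam R (i + Suc j)" using x Suc by (auto simp: plug_snoc)
  qed
qed auto

text \<open>An element \<open>z\<close> of \<open>R\<close> acts as a derivation, [b, k, z] =
  [b, z, k] + [b, [k, z]], and preserves \<open>der R\<close>; so the lower central terms of
  \<open>der R\<close> behave as ideals of \<open>R\<close>.\<close>

lemma gam_der_invariant:
  assumes "closed R"
  shows "t \<in> cl (gam (der R) i) \<Longrightarrow> z \<in> R \<Longrightarrow> Node t z \<in> cl (gam (der R) i)"
proof (induction i arbitrary: t z)
  case 0
  show ?case
  proof (rule cl_Node1[OF "0.prems"(1)])
    fix a assume "a \<in> gam (der R) 0"
    then have "a \<in> R" using der_subset[OF assms] by auto
    then show "Node a z \<in> cl (gam (der R) 0)" using "0.prems"(2) by (auto intro!: cl.base simp: der_def)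
  qed
next
  case (Suc i)
  have "Node a z \<in> cl (gam (der R) (Suc i))" if as: "a \<in> gam (der R) (Suc i)" for a
  proof -
    obtain b k where a: "a = Node b k" "b \<in> gam (der R) i" "k \<in> der R" using as by auto
    have "Node (Node b z) k \<in> cl (gam (der R) (Suc i))"
      by (rule cl_Node1[OF Suc.IH[OF cl.base[OF a(2)] Suc.prems(2)]])
        (use a in \<open>auto intro!: cl.base\<close>)
    moreover have "Node b (Node k z) \<in> cl (gam (der R) (Suc i))"
    proof -
      have "Node k z \<in> der R" using a(3) Suc.prems(2) der_subset[OF assms] by (auto simp: der_def)
      then show ?thesis using a by (auto intro!: cl.base)
    qed
    ultimately show ?thesis using a cl_jac by blast
  qed
  then show ?case using Suc.prems by (auto intro!: cl_Node1[of t "gam (der R) (Suc i)"])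
qed

lemma gam_der_plug:
  assumes "closed R"
  shows "t \<in> cl (gam (der R) i) \<Longrightarrow> set zs \<subseteq> R \<Longrightarrow> plug t zs \<in> cl (gam (der R) i)"
  by (induction zs arbitrary: t) (auto intro: gam_der_invariant[OF assms])

text \<open>Exchanging neighbours costs [u, [a, b]] with [a, b] in \<open>der R\<close>. This lies
  one term deeper, and by \<open>gam_der_plug\<close> it stays there under the remaining
  entries.\<close>

lemma gam_der_swap:
  assumes R: "closed R" and t: "t \<in> gam (der R) i" and z: "set xs \<subseteq> R" "set ys \<subseteq> R" "a \<in> R" "b \<in> R"
    and *: "plug t (xs @ b # a # ys) \<in> cl (gam (der R) (Suc i))"
  shows "plug t (xs @ a # b # ys) \<in> cl (gam (der R) (Suc i))"
proof -
  let ?u = "plug t xs"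
  have u: "?u \<in> cl (gam (der R) i)" using gam_der_plug[OF R cl.base] t z by blast
  have "Node ?u (Node a b) \<in> cl (gam (der R) (Suc i))"
    by (rule cl_Node1[OF u]) (use z in \<open>auto intro!: cl.base simp: der_def\<close>)
  then have "plug (Node ?u (Node a b)) ys \<in> cl (gam (der R) (Suc i))"
    using gam_der_plug[OF R] z by blast
  then show ?thesis using * jac[of ?u b a ys] by (simp add: plug_append)
qed

lemma gam_der_bubble:
  assumes R: "closed R" and t: "t \<in> gam (der R) i"
  shows "set xs \<subseteq> R \<Longrightarrow> set ys \<subseteq> R \<Longrightarrow> a \<in> R \<Longrightarrow> set zs \<subseteq> R \<Longrightarrow>
    plug t (zs @ a # xs @ ys) \<in> cl (gam (der R) (Suc i)) \<Longrightarrow>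
    plug t (zs @ xs @ a # ys) \<in> cl (gam (der R) (Suc i))"
proof (induction xs arbitrary: zs)
  case (Cons x xs)
  have "plug t (zs @ x # a # xs @ ys) \<in> cl (gam (der R) (Suc i))"
    by (rule gam_der_swap[OF R t]) (use Cons.prems in auto)
  then show ?case using Cons.IH[of "zs @ [x]"] Cons.prems by simp
qed simp

lemma gam_der_perm:
  assumes R: "closed R" and t: "t \<in> gam (der R) i"
  shows "mset zs = mset ws \<Longrightarrow> set us \<union> set zs \<subseteq> R \<Longrightarrow>
    plug t (us @ ws) \<in> cl (gam (der R) (Suc i)) \<Longrightarrow> plug t (us @ zs) \<in> cl (gam (der R) (Suc i))"
proof (induction ws arbitrary: zs us)
  case (Cons w ws)
  then have "w \<in> set zs" by (metis list.set_intros(1) mset_eq_setD)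
  then obtain xs ys where zs: "zs = xs @ w # ys" by (meson split_list)
  then have "mset (xs @ ys) = mset ws" using Cons.prems by simp
  then have "plug t ((us @ [w]) @ (xs @ ys)) \<in> cl (gam (der R) (Suc i))"
    by (rule Cons.IH) (use Cons.prems zs in auto)
  then show ?case using gam_der_bubble[OF R t, of xs ys w us] Cons.prems zs by auto
qed simp

text \<open>A nonzero residue generates the additive group modulo a prime, so its shifts lead from
  one element of \<open>S\<close> to all residues.\<close>

lemma shift_closed_full:
  assumes "S \<subseteq> {..<p}" "S \<noteq> {}" "0 < a" "a < p" "(\<lambda>s. (s + a) mod p) ` S \<subseteq> S"
  shows "S = {..<p}"
proof -
  obtain s where s: "s \<in> S" "s < p" using assms by blast
  have i: "(s + i * a) mod p \<in> S" for i
  proof (induction i)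
    case (Suc i)
    have "((s + i * a) mod p + a) mod p \<in> S" using Suc assms(5) by blast
    then show ?case by (simp add: mod_simps ac_simps)
  qed (use s in auto)
  have "coprime a p" using assms p_prime
    by (meson coprime_commute nat_dvd_not_less prime_imp_coprime)
  then obtain x where x: "[a * x = 1] (mod p)" using cong_solve_coprime_nat by auto
  have "r \<in> S" if "r < p" for r
  proof -
    \<comment> \<open>From \<open>s\<close> the residue \<open>r\<close> is reached after x (r - s)
      shifts, \<open>x\<close> being the inverse of \<open>a\<close>; adding \<open>p\<close> keeps
      the subtraction of natural numbers exact.\<close>
    have "[s + (x * (r + p - s)) * a = s + 1 * (r + p - s)] (mod p)"
      using cong_scalar_right[OF x, of "r + p - s"] by (intro cong_add) (simp_all add: ac_simps)
    then have "(s + (x * (r + p - s)) * a) mod p = r" using s that by (simp add: cong_def)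
    then show ?thesis using i by metis
  qed
  then show ?thesis using assms by auto
qed

text \<open>The degrees that arise when some of the entries \<open>zs\<close> are moved next to
  \<open>t\<close>; their order does not affect the degree.\<close>

definition subsums :: "'a lie_tree \<Rightarrow> 'a lie_tree list \<Rightarrow> nat set" where
  "subsums t zs = {deg (plug t ys) |ys ws. mset zs = mset (ys @ ws)}"

lemma subsums_Cons:
  "subsums t zs \<union> (\<lambda>s. (s + deg z) mod p) ` subsums t zs \<subseteq> subsums t (z # zs)"
proof -
  have 1: "deg (plug t ys) \<in> subsums t (z # zs)" if "mset zs = mset (ys @ ws)" for ys ws
  proof -
    have "mset (z # zs) = mset (ys @ (z # ws))" using that by simp
    then show ?thesis unfolding subsums_def by blast
  qed
  have 2: "(deg (plug t ys) + deg z) mod p \<in> subsums t (z # zs)" if "mset zs = mset (ys @ ws)" for ys ws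
  proof -
    have "deg (plug t (ys @ [z])) = (deg (plug t ys) + deg z) mod p"
      by (simp add: plug_snoc deg_Node)
    moreover have "mset (z # zs) = mset ((ys @ [z]) @ ws)" using that by simp
    ultimately show ?thesis unfolding subsums_def by (metis (mono_tags, lifting) mem_Collect_eq)
  qed
  show ?thesis using 1 2 unfolding subsums_def[of t zs] by blast
qed

lemma subsums_bound: "subsums t zs \<subseteq> {..<p}"
  unfolding subsums_def using deg_less by auto

text \<open>The simplest instance of the Cauchy-Davenport argument: a further entry of nonzero
  degree either adds a residue or finds the set stable under a nonzero shift, hence already
  full.\<close>

lemma card_subsums:
  "(\<And>z. z \<in> set zs \<Longrightarrow> deg z \<noteq> 0) \<Longrightarrow> card (subsums t zs) \<ge> min p (Suc (length zs))"
proof (induction zs)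
  case Nil
  have "subsums t [] = {deg t}" by (auto simp: subsums_def)
  then show ?case by simp
next
  case (Cons z zs)
  let ?S = "subsums t zs" and ?S' = "subsums t (z # zs)"
  have fin: "finite ?S" "finite ?S'" using subsums_bound finite_subset by blast+
  have IH: "card ?S \<ge> min p (Suc (length zs))" using Cons by auto
  show ?case
  proof (cases "?S = ?S'")
    case True
    then have "(\<lambda>s. (s + deg z) mod p) ` ?S \<subseteq> ?S" using subsums_Cons by blast
    moreover have "?S \<noteq> {}" using IH p_pos by auto
    ultimately have "?S = {..<p}"
      using shift_closed_full[of ?S "deg z"] subsums_bound deg_less[of z] Cons.prems by auto
    then show ?thesis using True by simp
  next
    case False
    then have "?S \<subset> ?S'" using subsums_Cons by blast
    then have "card ?S < card ?S'" using fin psubset_card_mono by blast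
    then show ?thesis using IH by auto
  qed
qed

text \<open>Modulo \<open>gam (der R) (Suc i)\<close> the entries \<open>zs\<close> may be permuted, and among \<open>p - 1\<close> entries
of nonzero degree some have degrees adding up to minus the degree of \<open>t\<close>; moving these to the
front produces a subtree of degree zero.\<close>

lemma gam_der_step:
  assumes R: "closed R" and t: "t \<in> gam (der R) i" and zs: "length zs = p - 1" "set zs \<subseteq> R"
  shows "plug t zs \<in> cl (gam (der R) (Suc i))"
proof (cases "\<exists>z \<in> set zs. deg z = 0")
  case True
  then obtain z us vs where z: "zs = us @ z # vs" "deg z = 0" by (meson split_list)
  have "plug z (plug t us # vs) \<in> cl (gam (der R) (Suc i))" using z by (intro zero)
  then show ?thesis using sym[of z "plug t us" vs] z by (simp add: plug_append)
next
  case False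
  then have "card (subsums t zs) \<ge> p" using card_subsums[of zs t] zs p_pos by auto
  then have "subsums t zs = {..<p}"
    by (intro card_subset_eq) (use subsums_bound card_mono[OF _ subsums_bound[of t zs]] in auto)
  then have "0 \<in> subsums t zs" using p_pos by auto
  then obtain ys ws where y: "deg (plug t ys) = 0" "mset zs = mset (ys @ ws)"
    unfolding subsums_def by auto
  have "plug t ([] @ zs) \<in> cl (gam (der R) (Suc i))"
  proof (rule gam_der_perm[OF R t y(2)])
    show "plug t ([] @ (ys @ ws)) \<in> cl (gam (der R) (Suc i))"
      using zero[OF y(1)] by (simp add: plug_append)
  qed (use zs in auto)
  then show ?thesis by simp
qed

text \<open>One entry leads from \<open>R\<close> into \<open>der R\<close>; from then on every
  \<open>p - 1\<close> entries gain one more term, by \<open>gam_der_step\<close>.\<close>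

lemma gam_der_steps:
  assumes R: "closed R"
  shows "gam R (1 + (p - 1) * i) \<subseteq> cl (gam (der R) i)"
proof (induction i)
  case 0
  show ?case by (auto intro!: cl.base simp: der_def)
next
  case (Suc i)
  show ?case
  proof
    fix x assume "x \<in> gam R (1 + (p - 1) * Suc i)"
    then have "x \<in> gam R ((1 + (p - 1) * i) + (p - 1))" by (simp add: ac_simps)
    then obtain t zs where x: "x = plug t zs" "t \<in> gam R (1 + (p - 1) * i)" "length zs = p - 1" "set zs \<subseteq> R"
      unfolding gam_add by blast
    have "x \<in> cl ((\<lambda>t. plug t zs) ` gam (der R) i)" using cl_plug x Suc by blast
    then show "x \<in> cl (gam (der R) (Suc i))"
      by (rule cl_trans) (use gam_der_step[OF R] x in auto)
  qed
qed

text \<open>Induction on the derived length: applying the claim to \<open>der R\<close> gives c(s +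
  1) = 1 + (p - 1) c(s) with c(0) = 0, which the geometric sum solves.\<close>

lemma higman:
  "closed R \<Longrightarrow> (der ^^ s) R \<subseteq> cl {} \<Longrightarrow> gam R (\<Sum>i<s. (p - 1) ^ i) \<subseteq> cl {}"
proof (induction s arbitrary: R)
  case (Suc s)
  have c: "(\<Sum>i<Suc s. (p - 1) ^ i) = 1 + (p - 1) * (\<Sum>i<s. (p - 1) ^ i)"
    by (simp add: sum.lessThan_Suc_shift sum_distrib_left del: sum.lessThan_Suc)
  have "gam (der R) (\<Sum>i<s. (p - 1) ^ i) \<subseteq> cl {}"
    by (rule Suc.IH) (use Suc.prems closed_der in \<open>auto simp: funpow_swap1\<close>)
  then show ?case unfolding c using gam_der_steps[OF Suc.prems(1)] cl_trans by blast
qed auto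

theorem kreknin_higman:
  assumes "m \<ge> (\<Sum>i<2 ^ (p - 1) - 1. (p - 1) ^ i)"
  shows "gam UNIV m \<subseteq> cl {}"
proof
  let ?c = "\<Sum>i<2 ^ (p - 1) - 1. (p - 1) ^ i"
  fix x assume "x \<in> gam UNIV m"
  then have "x \<in> gam UNIV (?c + (m - ?c))" using assms by simp
  then obtain t zs where x: "x = plug t zs" "t \<in> gam UNIV ?c" unfolding gam_add by blast
  then have "t \<in> cl {}" using higman[OF _ kreknin] by (auto simp: closed_def)
  then show "x \<in> cl {}" using cl_plug[of t "{}" zs] x by simp
qed

end

section \<open>The lower central series\<close>

declare lcs.simps(2) [simp del]

section \<open>Commutator calculus and generation of the lower central series\<close>

context group
begin

definition cm :: "'a \<Rightarrow> 'a \<Rightarrow> 'a" where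
  "cm x y = x \<otimes> y \<otimes> inv x \<otimes> inv y"

text \<open>With these cancellations the rules \<open>word_simps\<close> bring group words to a
  right-associated reduced form, so that identities of free groups such as \<open>hall_witt\<close>
  follow by rewriting.\<close>

lemma mult_inv_cancel [simp]:
  "x \<in> carrier G \<Longrightarrow> y \<in> carrier G \<Longrightarrow> x \<otimes> (inv x \<otimes> y) = y"
  "x \<in> carrier G \<Longrightarrow> y \<in> carrier G \<Longrightarrow> inv x \<otimes> (x \<otimes> y) = y"
  by (simp_all add: m_assoc[symmetric])

lemmas word_simps = cm_def m_assoc inv_mult_group

lemma cm_closed [simp]: "x \<in> carrier G \<Longrightarrow> y \<in> carrier G \<Longrightarrow> cm x y \<in> carrier G"
  by (simp add: cm_def)

lemma inv_cm: "x \<in> carrier G \<Longrightarrow> y \<in> carrier G \<Longrightarrow> inv (cm x y) = cm y x"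
  by (simp add: word_simps)

lemma hall_witt:
  assumes "x \<in> carrier G" "y \<in> carrier G" "z \<in> carrier G"
  shows "cm (cm x y) (y \<otimes> z \<otimes> inv y) \<otimes> cm (cm y z) (z \<otimes> x \<otimes> inv z) \<otimes>
    cm (cm z x) (x \<otimes> y \<otimes> inv x) = \<one>"
  using assms by (simp add: word_simps)

lemma cm_one [simp]: "x \<in> carrier G \<Longrightarrow> cm x \<one> = \<one>" "x \<in> carrier G \<Longrightarrow> cm \<one> x = \<one>"
  by (simp_all add: cm_def)

lemma cm_mult_right:
  "x \<in> carrier G \<Longrightarrow> y \<in> carrier G \<Longrightarrow> z \<in> carrier G \<Longrightarrow>
    cm x (y \<otimes> z) = cm x y \<otimes> (y \<otimes> cm x z \<otimes> inv y)"
  by (simp add: word_simps)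

lemma cm_inv_right:
  "x \<in> carrier G \<Longrightarrow> y \<in> carrier G \<Longrightarrow> cm x (inv y) = inv y \<otimes> inv (cm x y) \<otimes> inv (inv y)"
  by (simp add: word_simps)

lemma conj_eq_cm: "g \<in> carrier G \<Longrightarrow> x \<in> carrier G \<Longrightarrow> g \<otimes> x \<otimes> inv g = cm g x \<otimes> x"
  by (simp add: word_simps)

lemma cm_in_normal:
  assumes "N \<lhd> G" "x \<in> N" "g \<in> carrier G"
  shows "cm x g \<in> N" "cm g x \<in> N"
proof -
  interpret N: normal N G by fact
  have x: "x \<in> carrier G" using assms by auto
  have "cm x g = x \<otimes> (g \<otimes> inv x \<otimes> inv g)" using x assms by (simp add: word_simps)
  then show 1: "cm x g \<in> N" using assms N.inv_op_closed2[of g "inv x"] by simp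
  have "cm g x = inv (cm x g)" using x assms by (simp add: inv_cm)
  then show "cm g x \<in> N" using 1 by simp
qed

text \<open>The set is the preimage of the centraliser of the image of \<open>A\<close> in the
  quotient by \<open>N\<close>. Inversion exchanges the two orders of the commutator.\<close>

lemma cm_set_subgroup:
  assumes "N \<lhd> G" "A \<subseteq> carrier G"
  shows "subgroup {y \<in> carrier G. \<forall>x \<in> A. cm x y \<in> N} G"
    and "subgroup {y \<in> carrier G. \<forall>x \<in> A. cm y x \<in> N} G"
proof -
  interpret N: normal N G by fact
  show 1: "subgroup {y \<in> carrier G. \<forall>x \<in> A. cm x y \<in> N} G"
  proof (rule subgroupI)
    show "{y \<in> carrier G. \<forall>x \<in> A. cm x y \<in> N} \<noteq> {}" using assms by (auto intro!: exI[of _ \<one>])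
  next
    fix a assume a: "a \<in> {y \<in> carrier G. \<forall>x \<in> A. cm x y \<in> N}"
    have "cm x (inv a) \<in> N" if "x \<in> A" for x
    proof -
      have x: "x \<in> carrier G" "cm x a \<in> N" using that a assms by auto
      then show ?thesis using a N.inv_op_closed2[of "inv a" "inv (cm x a)"] cm_inv_right[of x a] by simp
    qed
    then show "inv a \<in> {y \<in> carrier G. \<forall>x \<in> A. cm x y \<in> N}" using a by auto
  next
    fix a b assume ab: "a \<in> {y \<in> carrier G. \<forall>x \<in> A. cm x y \<in> N}" "b \<in> {y \<in> carrier G. \<forall>x \<in> A. cm x y \<in> N}"
    have "cm x (a \<otimes> b) \<in> N" if "x \<in> A" for x
    proof -
      have x: "x \<in> carrier G" "cm x a \<in> N" "cm x b \<in> N" using that ab assms by auto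
      then show ?thesis using ab N.inv_op_closed2[of a "cm x b"] cm_mult_right[of x a b] by simp
    qed
    then show "a \<otimes> b \<in> {y \<in> carrier G. \<forall>x \<in> A. cm x y \<in> N}" using ab by auto
  qed auto
  have "cm x y \<in> N \<longleftrightarrow> cm y x \<in> N" if "x \<in> carrier G" "y \<in> carrier G" for x y
    using that by (metis inv_cm N.m_inv_closed)
  then have "{y \<in> carrier G. \<forall>x \<in> A. cm y x \<in> N} = {y \<in> carrier G. \<forall>x \<in> A. cm x y \<in> N}"
    using assms by blast
  then show "subgroup {y \<in> carrier G. \<forall>x \<in> A. cm y x \<in> N} G" using 1 by simp
qed

text \<open>The set is the preimage of the centre of the quotient by \<open>N\<close>.\<close>

lemma central_mod_normal:
  assumes N: "N \<lhd> G"
  shows "{x \<in> carrier G. \<forall>g \<in> carrier G. cm x g \<in> N} \<lhd> G" (is "?T \<lhd> G")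
proof (rule normal_invI[OF cm_set_subgroup(2)[OF N order_refl]])
  fix g h assume g: "g \<in> carrier G" and h: "h \<in> ?T"
  have "cm (g \<otimes> h \<otimes> inv g) x \<in> N" if x: "x \<in> carrier G" for x
  proof -
    have "cm (g \<otimes> h \<otimes> inv g) x = g \<otimes> cm h (inv g \<otimes> x \<otimes> g) \<otimes> inv g"
      using g h x by (simp add: word_simps)
    then show ?thesis using g h x normal.inv_op_closed2[OF N] by simp
  qed
  then show "g \<otimes> h \<otimes> inv g \<in> ?T" using g h by simp
qed

lemma comm_set_eq: "comm_set G A B = {cm a b |a b. a \<in> A \<and> b \<in> B}"
  by (simp add: comm_set_def cm_def)

lemma lcs_normal: "lcs G i \<lhd> G"
proof (induction i)
  case 0
  show ?case using normal_self by simp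
next
  case (Suc i)
  interpret N: normal "lcs G i" G by fact
  show ?case unfolding lcs.simps(2)
  proof (rule normal_generateI)
    show "comm_set G (lcs G i) (carrier G) \<subseteq> carrier G"
      using N.subset by (auto simp: comm_set_eq)
  next
    fix h g assume "h \<in> comm_set G (lcs G i) (carrier G)" and g: "g \<in> carrier G"
    then obtain a b where h: "h = cm a b" "a \<in> lcs G i" "b \<in> carrier G" by (auto simp: comm_set_eq)
    have "g \<otimes> h \<otimes> inv g = cm (g \<otimes> a \<otimes> inv g) (g \<otimes> b \<otimes> inv g)"
      using h g by (simp add: word_simps)
    moreover have "g \<otimes> a \<otimes> inv g \<in> lcs G i" using N.inv_op_closed2 g h by blast
    ultimately show "g \<otimes> h \<otimes> inv g \<in> comm_set G (lcs G i) (carrier G)"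
      using g h unfolding comm_set_eq by blast
  qed
qed

lemma lcs_subgroup: "subgroup (lcs G i) G"
  using lcs_normal normal_imp_subgroup by blast

lemma lcs_carrier: "x \<in> lcs G i \<Longrightarrow> x \<in> carrier G"
  by (rule subgroup.mem_carrier[OF lcs_subgroup])

lemma lcs_one [simp]: "\<one> \<in> lcs G i"
  by (rule subgroup.one_closed[OF lcs_subgroup])

lemma lcs_mult: "x \<in> lcs G i \<Longrightarrow> y \<in> lcs G i \<Longrightarrow> x \<otimes> y \<in> lcs G i"
  by (rule subgroup.m_closed[OF lcs_subgroup])

lemma lcs_inv: "x \<in> lcs G i \<Longrightarrow> inv x \<in> lcs G i"
  by (rule subgroup.m_inv_closed[OF lcs_subgroup])

lemma lcs_cm_carrier: "x \<in> lcs G i \<Longrightarrow> g \<in> carrier G \<Longrightarrow> cm x g \<in> lcs G (Suc i)"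
  unfolding lcs.simps(2) comm_set_eq by (rule generate.incl) blast

lemma lcs_Suc_subset: "lcs G (Suc i) \<subseteq> lcs G i"
proof -
  have "comm_set G (lcs G i) (carrier G) \<subseteq> lcs G i"
    using cm_in_normal[OF lcs_normal] by (auto simp: comm_set_eq)
  then show ?thesis using generate_subgroup_incl[OF _ lcs_subgroup] by (simp add: lcs.simps(2))
qed

lemma lcs_antimono: "i \<le> j \<Longrightarrow> lcs G j \<subseteq> lcs G i"
  using lcs_Suc_subset by (rule lift_Suc_antimono_le)

text \<open>Three subgroups argument: to place [x, [y, z]], Hall-Witt expresses one of its three
  commutators through two that the induction covers. Since \<open>lcs G i\<close> is the term of
  weight i + 1, the index becomes i + j + 1.\<close>

lemma lcs_cm: "x \<in> lcs G i \<Longrightarrow> y \<in> lcs G j \<Longrightarrow> cm x y \<in> lcs G (i + j + 1)"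
proof (induction j arbitrary: i x y)
  case 0
  then show ?case using lcs_cm_carrier by simp
next
  case (Suc j)
  let ?N = "lcs G (i + j + 2)"
  interpret N: normal ?N G using lcs_normal .
  let ?T = "{y \<in> carrier G. \<forall>x \<in> lcs G i. cm x y \<in> ?N}"
  have T: "subgroup ?T G"
    by (rule cm_set_subgroup) (auto simp: lcs_normal lcs_carrier)
  have "cm y z \<in> ?T" if yz: "y \<in> lcs G j" "z \<in> carrier G" for y z
  proof -
    have yc: "y \<in> carrier G" using yz lcs_carrier by auto
    have *: "cm (cm y z) (z \<otimes> x \<otimes> inv z) \<in> ?N" if x: "x \<in> lcs G i" for x
    proof -
      have xc: "x \<in> carrier G" using x lcs_carrier by auto
      let ?a = "cm (cm x y) (y \<otimes> z \<otimes> inv y)" and ?b = "cm (cm y z) (z \<otimes> x \<otimes> inv z)"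
        and ?c = "cm (cm z x) (x \<otimes> y \<otimes> inv x)"
      have "cm x y \<in> lcs G (i + j + 1)" using Suc.IH x yz by blast
      then have a: "?a \<in> ?N" using lcs_cm_carrier yz yc by fastforce
      have "cm z x = inv (cm x z)" using inv_cm xc yz by simp
      moreover have "inv (cm x z) \<in> lcs G (Suc i)" using lcs_cm_carrier x yz lcs_inv by blast
      ultimately have "cm z x \<in> lcs G (Suc i)" by simp
      moreover have "x \<otimes> y \<otimes> inv x \<in> lcs G j"
        using normal.inv_op_closed2[OF lcs_normal] xc yz by blast
      ultimately have "?c \<in> lcs G (Suc i + j + 1)" by (rule Suc.IH)
      then have c: "?c \<in> ?N" by simp
      have "?a \<otimes> ?b \<otimes> ?c = \<one>" using hall_witt xc yc yz by blast
      then have "?a \<otimes> (?b \<otimes> ?c) = \<one>" using xc yc yz by (simp add: m_assoc)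
      then have "?b \<otimes> ?c = inv ?a" using xc yc yz by (metis cm_closed inv_closed inv_solve_left m_closed r_one one_closed)
      then have "?b = inv ?a \<otimes> inv ?c" using xc yc yz by (metis cm_closed inv_closed inv_solve_right m_closed)
      then show ?thesis using N.m_closed[OF N.m_inv_closed[OF a] N.m_inv_closed[OF c]] by simp
    qed
    have "cm x (cm y z) \<in> ?N" if x: "x \<in> lcs G i" for x
    proof -
      have xc: "x \<in> carrier G" using x lcs_carrier by auto
      \<comment> \<open>Conjugating \<open>x\<close> in advance cancels the conjugation by
        \<open>z\<close> that Hall-Witt brings in.\<close>
      have "inv z \<otimes> x \<otimes> z \<in> lcs G i" using normal.inv_op_closed1[OF lcs_normal] x yz by blast
      then have "cm (cm y z) (z \<otimes> (inv z \<otimes> x \<otimes> z) \<otimes> inv z) \<in> ?N" by (rule *)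
      then have "cm (cm y z) x \<in> ?N" using xc yz by (simp add: m_assoc)
      then show ?thesis using inv_cm xc yc yz by (metis N.m_inv_closed cm_closed)
    qed
    then show ?thesis using yz yc by simp
  qed
  then have "comm_set G (lcs G j) (carrier G) \<subseteq> ?T" by (auto simp: comm_set_eq)
  then have "lcs G (Suc j) \<subseteq> ?T" using generate_subgroup_incl[OF _ T] by (simp add: lcs.simps(2))
  then show ?case using Suc.prems by auto
qed

fun lnorm :: "'a set \<Rightarrow> nat \<Rightarrow> 'a set" where
  "lnorm S 0 = S"
| "lnorm S (Suc i) = {cm a s |a s. a \<in> lnorm S i \<and> s \<in> S}"

lemma lnorm_lcs: "S \<subseteq> carrier G \<Longrightarrow> lnorm S i \<subseteq> lcs G i"
  by (induction i) (auto intro: lcs_cm_carrier)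

lemma finite_lnorm: "finite S \<Longrightarrow> finite (lnorm S i)"
proof (induction i)
  case (Suc i)
  have "lnorm S (Suc i) = (\<lambda>(a, s). cm a s) ` (lnorm S i \<times> S)" by auto
  then show ?case using Suc by simp
qed simp

text \<open>Induction through the preimage of the centre modulo \<open>N\<close>, which is why
  \<open>N\<close> is arbitrary: if a term lies there, the next one lies in \<open>N\<close>. The
  effect is that left-normed commutators in the generators generate each term modulo the
  next.\<close>

lemma lcs_subset_of_lnorm:
  assumes S: "S \<subseteq> carrier G" "generate G S = carrier G"
  shows "N \<lhd> G \<Longrightarrow> lcs G (Suc i) \<subseteq> N \<Longrightarrow> lnorm S i \<subseteq> N \<Longrightarrow> lcs G i \<subseteq> N"
proof (induction i arbitrary: N)
  case 0
  then have "generate G S \<subseteq> N" by (intro generate_subgroup_incl normal_imp_subgroup) auto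
  then show ?case using S by simp
next
  case (Suc i)
  have cN: "cm a g \<in> N" if "a \<in> lnorm S i" "g \<in> carrier G" for a g
  proof -
    let ?T = "{y \<in> carrier G. \<forall>x \<in> lnorm S i. cm x y \<in> N}"
    have "subgroup ?T G"
      by (rule cm_set_subgroup) (use Suc.prems lnorm_lcs[OF S(1), of i] lcs_carrier in auto)
    moreover have "S \<subseteq> ?T"
    proof -
      have "cm x s \<in> N" if "x \<in> lnorm S i" "s \<in> S" for x s
        using subsetD[OF Suc.prems(3), of "cm x s"] that by auto
      then show ?thesis using S by auto
    qed
    ultimately have "generate G S \<subseteq> ?T" using generate_subgroup_incl by blast
    then show ?thesis using that S by auto
  qed
  let ?T = "{a \<in> carrier G. \<forall>g \<in> carrier G. cm a g \<in> N}"
  have "lcs G (Suc i) \<subseteq> ?T"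
    using lcs_cm_carrier[of _ "Suc i"] lcs_carrier[of _ "Suc i"] Suc.prems(2) by blast
  moreover have "lnorm S i \<subseteq> ?T" using cN lnorm_lcs[OF S(1), of i] lcs_carrier[of _ i] by blast
  ultimately have "lcs G i \<subseteq> ?T" by (intro Suc.IH central_mod_normal Suc.prems(1))
  then have "comm_set G (lcs G i) (carrier G) \<subseteq> N" by (auto simp: comm_set_eq)
  then show ?case using generate_subgroup_incl normal_imp_subgroup[OF Suc.prems(1)] by (simp add: lcs.simps(2))
qed

text \<open>Conjugation multiplies \<open>h\<close> by the commutator [g, h], which lies in the next
  term and hence in \<open>Q\<close>.\<close>

lemma normal_between_lcs:
  assumes "subgroup Q G" "lcs G (Suc i) \<subseteq> Q" "Q \<subseteq> lcs G i"
  shows "Q \<lhd> G"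
proof (rule normal_invI[OF assms(1)])
  fix g h assume g: "g \<in> carrier G" and h: "h \<in> Q"
  have hi: "h \<in> lcs G i" "h \<in> carrier G" using h assms lcs_carrier by auto
  have "cm g h = inv (cm h g)" using g hi by (simp add: inv_cm)
  then have "cm g h \<in> Q" using lcs_cm_carrier[OF hi(1) g] assms(1,2) subgroup.m_inv_closed by fastforce
  then show "g \<otimes> h \<otimes> inv g \<in> Q"
    using conj_eq_cm[OF g hi(2)] h subgroup.m_closed[OF assms(1)] by simp
qed

lemma lcs_subset_of_lnorm':
  assumes "S \<subseteq> carrier G" "generate G S = carrier G"
    and "subgroup Q G" "lcs G (Suc i) \<subseteq> Q" "lnorm S i \<subseteq> Q"
  shows "lcs G i \<subseteq> Q"
proof -
  have 1: "lcs G (Suc i) \<subseteq> Q \<inter> lcs G i" using assms(4) lcs_Suc_subset[of i] by (rule Int_greatest)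
  have "subgroup (Q \<inter> lcs G i) G" using assms(3) lcs_subgroup by (rule subgroups_Inter_pair)
  then have "Q \<inter> lcs G i \<lhd> G" using 1 by (rule normal_between_lcs) simp
  then have "lcs G i \<subseteq> Q \<inter> lcs G i"
    using 1 by (rule lcs_subset_of_lnorm[OF assms(1,2)]) (simp add: assms(5) lnorm_lcs[OF assms(1)])
  then show ?thesis by blast
qed

section \<open>The factors of the lower central series as abelian groups\<close>

definition gr :: "nat \<Rightarrow> 'a set monoid" where
  "gr w = (G\<lparr>carrier := lcs G w\<rparr>) Mod (lcs G (Suc w))"

text \<open>Computations are made with group elements and compared through their classes; the
  factors being multiplicative groups, \<open>finprod\<close> plays the role of sums.\<close>

definition gcl :: "nat \<Rightarrow> 'a \<Rightarrow> 'a set" where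
  "gcl w x = lcs G (Suc w) #> x"

lemma gr_normal: "lcs G (Suc w) \<lhd> G\<lparr>carrier := lcs G w\<rparr>"
  using normal_restrict_supergroup[OF lcs_subgroup lcs_normal lcs_Suc_subset] .

lemma gcl_mult:
  "x \<in> lcs G w \<Longrightarrow> y \<in> lcs G w \<Longrightarrow> gcl w (x \<otimes> y) = gcl w x \<otimes>\<^bsub>gr w\<^esub> gcl w y"
  using normal.rcos_sum[OF lcs_normal, of x y "Suc w"] lcs_carrier[of x w] lcs_carrier[of y w]
  by (simp add: gr_def gcl_def set_mult_def)

lemma carrier_gr: "carrier (gr w) = gcl w ` lcs G w"
  by (simp add: gr_def carrier_FactGroup gcl_def)

lemma gcl_closed [simp]: "x \<in> lcs G w \<Longrightarrow> gcl w x \<in> carrier (gr w)"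
  by (simp add: carrier_gr)

lemma gcl_eq_iff:
  assumes "x \<in> lcs G w" "y \<in> lcs G w"
  shows "gcl w x = gcl w y \<longleftrightarrow> x \<otimes> inv y \<in> lcs G (Suc w)"
proof
  have c: "x \<in> carrier G" "y \<in> carrier G" using assms lcs_carrier by auto
  note M = subgroup.rcos_module[OF lcs_subgroup is_group c(2,1)]
  show "gcl w x = gcl w y \<Longrightarrow> x \<otimes> inv y \<in> lcs G (Suc w)"
    using rcos_self[OF c(1) lcs_subgroup[of "Suc w"]] M unfolding gcl_def by simp
  assume "x \<otimes> inv y \<in> lcs G (Suc w)"
  then have "x \<in> lcs G (Suc w) #> y" using M by simp
  then show "gcl w x = gcl w y" unfolding gcl_def
    using repr_independence[OF _ c(2) lcs_subgroup[of "Suc w"]] by simp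
qed

lemma gcl_one [simp]: "gcl w \<one> = \<one>\<^bsub>gr w\<^esub>"
  using coset_mult_one[OF subgroup.subset[OF lcs_subgroup]] by (simp add: gcl_def gr_def)

lemma gcl_one_iff: "x \<in> lcs G w \<Longrightarrow> gcl w x = \<one>\<^bsub>gr w\<^esub> \<longleftrightarrow> x \<in> lcs G (Suc w)"
  using gcl_eq_iff[of x w \<one>] lcs_carrier[of x w] by simp

lemma gcl_commute:
  assumes "x \<in> lcs G w" "y \<in> lcs G w"
  shows "gcl w (x \<otimes> y) = gcl w (y \<otimes> x)"
proof -
  have c: "x \<in> carrier G" "y \<in> carrier G" using assms lcs_carrier by auto
  have "(x \<otimes> y) \<otimes> inv (y \<otimes> x) = cm x y" using c by (simp add: word_simps)
  moreover have "cm x y \<in> lcs G (Suc w)" using lcs_cm_carrier assms c by blast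
  ultimately show ?thesis using assms lcs_mult by (simp add: gcl_eq_iff)
qed

lemma comm_group_gr: "comm_group (gr w)"
proof -
  interpret A: group "gr w" unfolding gr_def by (rule normal.factorgroup_is_group[OF gr_normal])
  show ?thesis
  proof (rule A.group_comm_groupI)
    fix x y assume "x \<in> carrier (gr w)" "y \<in> carrier (gr w)"
    then show "x \<otimes>\<^bsub>gr w\<^esub> y = y \<otimes>\<^bsub>gr w\<^esub> x"
      
      using gcl_commute[of _ w] gcl_mult[of _ w] by (auto simp: carrier_gr)
  qed
qed

lemma gcl_inv:
  assumes "x \<in> lcs G w" shows "gcl w (inv x) = inv\<^bsub>gr w\<^esub> gcl w x"
proof -
  interpret A: comm_group "gr w" by (rule comm_group_gr)
  have "gcl w (inv x) \<otimes>\<^bsub>gr w\<^esub> gcl w x = \<one>\<^bsub>gr w\<^esub>"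
    using assms lcs_inv lcs_carrier[OF assms] by (simp flip: gcl_mult)
  then show ?thesis using assms lcs_inv by (intro A.inv_equality[symmetric]) auto
qed

lemma lcs_pow: "x \<in> lcs G w \<Longrightarrow> x [^] (n::nat) \<in> lcs G w"
  by (induction n) (auto intro: lcs_mult)

lemma gcl_pow: "x \<in> lcs G w \<Longrightarrow> gcl w (x [^] (n::nat)) = gcl w x [^]\<^bsub>gr w\<^esub> n"
  by (induction n) (auto simp: gcl_mult lcs_pow)

text \<open>Stands for a homomorphism from factor \<open>i\<close> to factor \<open>w\<close>, but
  given on group elements, so that commutation with a fixed element and \<beta> can be composed
  without choosing representatives of cosets.\<close>

definition lin :: "nat \<Rightarrow> nat \<Rightarrow> ('a \<Rightarrow> 'a) \<Rightarrow> bool" where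
  "lin i w F \<longleftrightarrow> (\<forall>x \<in> lcs G i. F x \<in> lcs G w) \<and> (\<forall>x \<in> lcs G (Suc i). F x \<in> lcs G (Suc w)) \<and>
     (\<forall>x \<in> lcs G i. \<forall>y \<in> lcs G i. gcl w (F (x \<otimes> y)) = gcl w (F x) \<otimes>\<^bsub>gr w\<^esub> gcl w (F y))"

lemma lin_closed: "lin i w F \<Longrightarrow> x \<in> lcs G i \<Longrightarrow> F x \<in> lcs G w"
  by (simp add: lin_def)

lemma lin_mult: "lin i w F \<Longrightarrow> x \<in> lcs G i \<Longrightarrow> y \<in> lcs G i \<Longrightarrow>
    gcl w (F (x \<otimes> y)) = gcl w (F x) \<otimes>\<^bsub>gr w\<^esub> gcl w (F y)"
  by (simp add: lin_def)

lemma lin_cong: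
  assumes F: "lin i w F" and xy: "x \<in> lcs G i" "y \<in> lcs G i" "gcl i x = gcl i y"
  shows "gcl w (F x) = gcl w (F y)"
proof -
  interpret A: comm_group "gr w" by (rule comm_group_gr)
  have c: "x \<in> carrier G" "y \<in> carrier G" using xy lcs_carrier by auto
  let ?e = "x \<otimes> inv y"
  have e: "?e \<in> lcs G (Suc i)" using xy gcl_eq_iff[OF xy(1,2)] by simp
  then have e': "?e \<in> lcs G i" using subsetD[OF lcs_Suc_subset] by simp
  have "gcl w (F (?e \<otimes> y)) = gcl w (F ?e) \<otimes>\<^bsub>gr w\<^esub> gcl w (F y)" using lin_mult[OF F e' xy(2)] .
  moreover have "?e \<otimes> y = x" using c by (simp add: m_assoc)
  moreover have "gcl w (F ?e) = \<one>\<^bsub>gr w\<^esub>"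
    using e F gcl_one_iff[of "F ?e" w] lin_closed[OF F e'] unfolding lin_def by simp
  ultimately show ?thesis using lin_closed[OF F xy(2)] by simp
qed

lemma lin_one: "lin i w F \<Longrightarrow> x \<in> lcs G i \<Longrightarrow> gcl i x = \<one>\<^bsub>gr i\<^esub> \<Longrightarrow> gcl w (F x) = \<one>\<^bsub>gr w\<^esub>"
  using gcl_one_iff[of x i] gcl_one_iff[of "F x" w] unfolding lin_def by simp

lemma lin_inv:
  assumes F: "lin i w F" and x: "x \<in> lcs G i"
  shows "gcl w (F (inv x)) = inv\<^bsub>gr w\<^esub> (gcl w (F x))"
proof -
  interpret A: comm_group "gr w" by (rule comm_group_gr)
  have "gcl w (F (inv x)) \<otimes>\<^bsub>gr w\<^esub> gcl w (F x) = gcl w (F \<one>)"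
    using lin_mult[OF F lcs_inv[OF x] x] lcs_carrier[OF x] by simp
  also have "\<dots> = \<one>\<^bsub>gr w\<^esub>" using lin_one[OF F, of \<one>] by simp
  finally show ?thesis using lin_closed[OF F] x lcs_inv[OF x] by (intro A.inv_equality[symmetric]) auto
qed

lemma lin_comp:
  assumes F: "lin i w F" and H: "lin w v H"
  shows "lin i v (\<lambda>x. H (F x))"
  unfolding lin_def
proof (intro conjI ballI)
  fix x y assume xy: "x \<in> lcs G i" "y \<in> lcs G i"
  note Fxy = lin_closed[OF F xy(1)] lin_closed[OF F xy(2)] lin_closed[OF F lcs_mult[OF xy]]
  have "gcl w (F (x \<otimes> y)) = gcl w (F x \<otimes> F y)" using lin_mult[OF F xy] gcl_mult Fxy by simp
  then have "gcl v (H (F (x \<otimes> y))) = gcl v (H (F x \<otimes> F y))"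
    using lin_cong[OF H Fxy(3) lcs_mult[OF Fxy(1,2)]] by simp
  then show "gcl v (H (F (x \<otimes> y))) = gcl v (H (F x)) \<otimes>\<^bsub>gr v\<^esub> gcl v (H (F y))"
    using lin_mult[OF H Fxy(1,2)] by simp
qed (use F H in \<open>auto simp: lin_def\<close>)

lemma lin_id: "lin i i (\<lambda>x. x)"
  by (simp add: lin_def gcl_mult)

text \<open>In [y, x z] = [y, x] (x [y, z] x^-1) the conjugation disappears modulo the next
  term.\<close>

lemma lin_cm2:
  assumes y: "y \<in> lcs G j" and w: "w = i + j + 1"
  shows "lin i w (\<lambda>x. cm y x)"
  unfolding lin_def
proof (intro conjI ballI)
  have cmw: "cm y x \<in> lcs G w" if "x \<in> lcs G i" for x
    using lcs_cm[OF y that] w by (simp add: add.commute)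
  {
    fix x assume "x \<in> lcs G i"
    then show "cm y x \<in> lcs G w" by (rule cmw)
  next
    fix x assume "x \<in> lcs G (Suc i)"
    then show "cm y x \<in> lcs G (Suc w)" using lcs_cm[OF y, of x "Suc i"] w by (simp add: add.commute)
  next
    fix x z assume xz: "x \<in> lcs G i" "z \<in> lcs G i"
    have c: "x \<in> carrier G" "y \<in> carrier G" "z \<in> carrier G" using xz y lcs_carrier by auto
    have x: "x \<otimes> cm y z \<otimes> inv x \<in> lcs G w"
      by (rule normal.inv_op_closed2[OF lcs_normal c(1) cmw[OF xz(2)]])
    have "cm y (x \<otimes> z) = cm y x \<otimes> (x \<otimes> cm y z \<otimes> inv x)" using cm_mult_right c by simp
    moreover have "gcl w (x \<otimes> cm y z \<otimes> inv x) = gcl w (cm y z)"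
    proof -
      have "(x \<otimes> cm y z \<otimes> inv x) \<otimes> inv (cm y z) = inv (cm (cm y z) x)"
        using c by (simp add: inv_cm cm_def[of x])
      moreover have "inv (cm (cm y z) x) \<in> lcs G (Suc w)"
        by (rule lcs_inv[OF lcs_cm_carrier[OF cmw[OF xz(2)] c(1)]])
      ultimately show ?thesis using gcl_eq_iff[OF x cmw[OF xz(2)]] by simp
    qed
    ultimately show "gcl w (cm y (x \<otimes> z)) = gcl w (cm y x) \<otimes>\<^bsub>gr w\<^esub> gcl w (cm y z)"
      using gcl_mult[OF cmw[OF xz(1)] x] by simp
  }
qed

lemma lin_cm1:
  assumes y: "y \<in> lcs G j" and w: "w = i + j + 1"
  shows "lin i w (\<lambda>x. cm x y)"
  unfolding lin_def
proof (intro conjI ballI)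
  interpret A: comm_group "gr w" by (rule comm_group_gr)
  note L = lin_cm2[OF y w]
  have yc: "y \<in> carrier G" using y lcs_carrier by auto
  {
    fix x assume x: "x \<in> lcs G i"
    show "cm x y \<in> lcs G w" using lcs_cm[OF x y] w by simp
  next
    fix x assume x: "x \<in> lcs G (Suc i)"
    show "cm x y \<in> lcs G (Suc w)" using lcs_cm[OF x y] w by simp
  next
    fix x z assume xz: "x \<in> lcs G i" "z \<in> lcs G i"
    have q: "gcl w (cm u y) = inv\<^bsub>gr w\<^esub> (gcl w (cm y u))" if "u \<in> lcs G i" for u
      using inv_cm[OF yc lcs_carrier[OF that]] gcl_inv[OF lin_closed[OF L that]] by simp
    show "gcl w (cm (x \<otimes> z) y) = gcl w (cm x y) \<otimes>\<^bsub>gr w\<^esub> gcl w (cm z y)"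
      unfolding q[OF xz(1)] q[OF xz(2)] q[OF lcs_mult[OF xz]] lin_mult[OF L xz]
      by (rule A.inv_mult) (simp_all add: lin_closed[OF L] xz)
  }
qed

text \<open>\<open>F\<close> acts on representatives and not on classes, so the induction carries
  one element \<open>z\<close> that represents the first product and whose image represents the
  second.\<close>

lemma lin_finprod:
  assumes F: "lin i w F" and "finite A" "\<And>a. a \<in> A \<Longrightarrow> f a \<in> lcs G i"
    and one: "finprod (gr i) (\<lambda>a. gcl i (f a)) A = \<one>\<^bsub>gr i\<^esub>"
  shows "finprod (gr w) (\<lambda>a. gcl w (F (f a))) A = \<one>\<^bsub>gr w\<^esub>"
proof -
  interpret A: comm_group "gr i" by (rule comm_group_gr)
  interpret W: comm_group "gr w" by (rule comm_group_gr)
  have "\<exists>z \<in> lcs G i. finprod (gr i) (\<lambda>a. gcl i (f a)) A = gcl i z \<and>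
      finprod (gr w) (\<lambda>a. gcl w (F (f a))) A = gcl w (F z)"
    using assms(2,3)
  proof (induction A rule: finite_induct)
    case empty
    have "gcl w (F \<one>) = \<one>\<^bsub>gr w\<^esub>" using lin_one[OF F, of \<one>] by simp
    then have "finprod (gr i) (\<lambda>a. gcl i (f a)) {} = gcl i \<one> \<and>
      finprod (gr w) (\<lambda>a. gcl w (F (f a))) {} = gcl w (F \<one>)" by simp
    then show ?case using lcs_one by (rule bexI)
  next
    case (insert a A)
    then obtain z where z: "z \<in> lcs G i" "finprod (gr i) (\<lambda>a. gcl i (f a)) A = gcl i z"
      "finprod (gr w) (\<lambda>a. gcl w (F (f a))) A = gcl w (F z)" by auto
    have fa: "f a \<in> lcs G i" "\<And>b. b \<in> A \<Longrightarrow> f b \<in> lcs G i" using insert by auto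
    have "finprod (gr i) (\<lambda>a. gcl i (f a)) (insert a A) = gcl i (f a \<otimes> z)"
      using insert(1,2) z fa gcl_mult[OF fa(1) z(1)] by (simp add: Pi_def)
    moreover have "finprod (gr w) (\<lambda>a. gcl w (F (f a))) (insert a A) = gcl w (F (f a \<otimes> z))"
      using insert(1,2) z fa lin_closed[OF F] lin_mult[OF F fa(1) z(1)] by (simp add: Pi_def)
    ultimately show ?case using lcs_mult[OF fa(1) z(1)] by blast
  qed
  then show ?thesis using one lin_one[OF F] by metis
qed

text \<open>Hall-Witt read modulo the next term, where conjugations vanish and the three commutators
  commute. The arrangement is that of the rule \<open>jac\<close> of \<open>cl\<close>.\<close>

lemma jacobi:
  assumes xyz: "x \<in> lcs G i" "y \<in> lcs G j" "z \<in> lcs G k" and w: "w = i + j + k + 2"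
  shows "gcl w (cm (cm x y) z) = gcl w (cm (cm x z) y) \<otimes>\<^bsub>gr w\<^esub> gcl w (cm x (cm y z))"
proof -
  interpret A: comm_group "gr w" by (rule comm_group_gr)
  have key: "gcl w (cm (cm a b) (b \<otimes> c \<otimes> inv b)) = gcl w (cm (cm a b) c) \<and> cm (cm a b) c \<in> lcs G w \<and>
      cm (cm a b) (b \<otimes> c \<otimes> inv b) \<in> lcs G w"
    if abc: "a \<in> lcs G i'" "b \<in> lcs G j'" "c \<in> lcs G k'" and w': "w = k' + (i' + j' + 1) + 1"
    for a b c i' j' k'
  proof -
    have cc: "a \<in> carrier G" "b \<in> carrier G" "c \<in> carrier G" using abc lcs_carrier by auto
    have bc: "b \<otimes> c \<otimes> inv b \<in> lcs G k'" by (rule normal.inv_op_closed2[OF lcs_normal cc(2) abc(3)])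
    note L = lin_cm2[OF lcs_cm[OF abc(1,2)] w']
    have "(b \<otimes> c \<otimes> inv b) \<otimes> inv c = inv (cm c b)" using cc by (simp add: inv_cm cm_def[of b])
    moreover have "inv (cm c b) \<in> lcs G (Suc k')" by (rule lcs_inv[OF lcs_cm_carrier[OF abc(3) cc(2)]])
    ultimately have "gcl k' (b \<otimes> c \<otimes> inv b) = gcl k' c" using gcl_eq_iff[OF bc abc(3)] by simp
    then show ?thesis using lin_cong[OF L bc abc(3)] lin_closed[OF L abc(3)] lin_closed[OF L bc] by simp
  qed
  have c: "x \<in> carrier G" "y \<in> carrier G" "z \<in> carrier G" using xyz lcs_carrier by auto
  note k1 = key[OF xyz(1,2,3)] and k2 = key[OF xyz(2,3,1)] and k3 = key[OF xyz(3,1,2)]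
  let ?X = "gcl w (cm (cm x y) z)" and ?Y = "gcl w (cm x (cm y z))" and ?Z = "gcl w (cm (cm x z) y)"
  have L: "lin (i + k + 1) w (\<lambda>u. cm u y)" by (rule lin_cm1[OF xyz(2)]) (simp add: w)
  have yzx: "cm (cm y z) x \<in> lcs G w" using k2 w by simp
  have X: "?X \<in> carrier (gr w)" using k1 w by simp
  have Z: "?Z \<in> carrier (gr w)" using lin_closed[OF L lcs_cm[OF xyz(1,3)]] by simp
  have Y: "?Y \<in> carrier (gr w)" "gcl w (cm (cm y z) x) = inv\<^bsub>gr w\<^esub> ?Y"
    using inv_cm[of "cm y z" x] c gcl_inv[OF yzx] yzx by (metis A.inv_closed A.inv_inv cm_closed gcl_closed)+
  have Z': "gcl w (cm (cm z x) y) = inv\<^bsub>gr w\<^esub> ?Z"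
    using lin_inv[OF L lcs_cm[OF xyz(1,3)]] c by (simp add: inv_cm)
  have "?X \<otimes>\<^bsub>gr w\<^esub> gcl w (cm (cm y z) x) \<otimes>\<^bsub>gr w\<^esub> gcl w (cm (cm z x) y) = \<one>\<^bsub>gr w\<^esub>"
    using arg_cong[OF hall_witt[OF c], of "gcl w"] k1 k2 k3 w by (simp add: gcl_mult lcs_mult)
  then have "?X \<otimes>\<^bsub>gr w\<^esub> inv\<^bsub>gr w\<^esub> ?Y \<otimes>\<^bsub>gr w\<^esub> inv\<^bsub>gr w\<^esub> ?Z = \<one>\<^bsub>gr w\<^esub>"
    using Y Z' by simp
  then have "inv\<^bsub>gr w\<^esub> (inv\<^bsub>gr w\<^esub> ?Z) = ?X \<otimes>\<^bsub>gr w\<^esub> inv\<^bsub>gr w\<^esub> ?Y"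
    using X Y Z by (intro A.inv_equality) auto
  then have "?Z = ?X \<otimes>\<^bsub>gr w\<^esub> inv\<^bsub>gr w\<^esub> ?Y" using Z by simp
  then show ?thesis using A.inv_solve_right[OF Z X Y(1)] by simp
qed

end

lemma comm_set_mono: "A \<subseteq> A' \<Longrightarrow> B \<subseteq> B' \<Longrightarrow> comm_set G A B \<subseteq> comm_set G A' B'"
  unfolding comm_set_def by blast

lemma (in group_hom) image_comm_set:
  assumes "A \<subseteq> carrier G" "B \<subseteq> carrier G"
  shows "h ` comm_set G A B = comm_set H (h ` A) (h ` B)"
proof -
  have e: "h (G.cm a b) = H.cm (h a) (h b)" if "a \<in> A" "b \<in> B" for a b
    using subsetD[OF assms(1) that(1)] subsetD[OF assms(2) that(2)] by (simp add: G.cm_def H.cm_def)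
  show ?thesis
  proof (intro equalityI subsetI)
    fix y assume "y \<in> h ` comm_set G A B"
    then obtain a b where "y = h (G.cm a b)" "a \<in> A" "b \<in> B" by (auto simp: G.comm_set_eq)
    then show "y \<in> comm_set H (h ` A) (h ` B)" using e by (auto simp: H.comm_set_eq)
  next
    fix y assume "y \<in> comm_set H (h ` A) (h ` B)"
    then obtain a b where ab: "y = H.cm (h a) (h b)" "a \<in> A" "b \<in> B" by (auto simp: H.comm_set_eq)
    then have "y = h (G.cm a b)" using e by simp
    then show "y \<in> h ` comm_set G A B" using ab(2,3) unfolding G.comm_set_eq by blast
  qed
qed

text \<open>The image of the carrier is kept in the formula, so that it serves both endomorphisms
  and quotient maps.\<close>

lemma (in group_hom) image_lcs_Suc: "h ` lcs G (Suc i) = generate H (comm_set H (h ` lcs G i) (h ` carrier G))"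
proof -
  have sub: "lcs G i \<subseteq> carrier G" using G.lcs_carrier[of _ i] by blast
  have "comm_set G (lcs G i) (carrier G) \<subseteq> carrier G"
    using G.lcs_carrier[of _ i] by (auto simp: G.comm_set_eq)
  then have "h ` lcs G (Suc i) = generate H (h ` comm_set G (lcs G i) (carrier G))"
    unfolding lcs.simps(2) by (rule generate_img[symmetric])
  then show ?thesis unfolding image_comm_set[OF sub order_refl] .
qed

section \<open>Endomorphisms annihilated by a cyclotomic polynomial on sections\<close>

text \<open>One less than the number of leaves, in accordance with the index shift of
  \<open>lcs\<close>: a tree evaluates into \<open>lcs G (idx t)\<close>.\<close>

fun idx :: "'b lie_tree \<Rightarrow> nat" where
  "idx (Leaf k) = 0"
| "idx (Node a b) = idx a + idx b + 1"

lemma size_leaves: "size (leaves t) = Suc (idx t)"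
  by (induction t) auto

lemma idx_plug: "idx (plug a cs) = idx a + (\<Sum>c\<leftarrow>cs. Suc (idx c))"
  by (induction cs arbitrary: a) auto

text \<open>Pairwise different labels make the tree multilinear: every leaf can be given its own
  element and its own power of \<beta>.\<close>

fun lntree :: "nat \<Rightarrow> nat lie_tree" where
  "lntree 0 = Leaf 0"
| "lntree (Suc m) = Node (lntree m) (Leaf (Suc m))"

lemma leaves_lntree: "leaves (lntree m) = mset_set {..m}"
  by (induction m) (auto simp: atMost_Suc)

text \<open>The coefficient \<open>j k0\<close> is invertible modulo \<open>p\<close>, so the other
  \<open>m\<close> coordinates of \<open>d\<close> are free and determine the one at
  \<open>k0\<close>.\<close>

lemma card_PiE_linear_eq:
  fixes j :: "nat \<Rightarrow> nat"
  assumes p: "prime p" and j: "k0 \<le> m" "0 < j k0" "j k0 < p"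
  shows "card {d \<in> {..m} \<rightarrow>\<^sub>E {..<p}. (\<Sum>k\<le>m. d k * j k) mod p = 1} = p ^ m"
proof -
  let ?I = "{..m} - {k0}"
  let ?D = "{d \<in> {..m} \<rightarrow>\<^sub>E {..<p}. (\<Sum>k\<le>m. d k * j k) mod p = 1}"
  have p1: "p > 1" using p prime_gt_1_nat by auto
  have cop: "coprime (j k0) p" using j p by (meson coprime_commute nat_dvd_not_less prime_imp_coprime)
  have split: "(\<Sum>k\<le>m. d k * j k) = d k0 * j k0 + (\<Sum>k\<in>?I. d k * j k)" for d :: "nat \<Rightarrow> nat"
    using j(1) by (subst sum.remove[of _ k0]) auto
  have inj: "inj_on (\<lambda>d. restrict d ?I) ?D"
  proof (rule inj_onI)
    fix d e assume d: "d \<in> ?D" and e: "e \<in> ?D" and eq: "restrict d ?I = restrict e ?I"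
    have I: "d k = e k" if "k \<in> ?I" for k using fun_cong[OF eq, of k] that by simp
    have "[d k0 * j k0 + (\<Sum>k\<in>?I. d k * j k) = e k0 * j k0 + (\<Sum>k\<in>?I. d k * j k)] (mod p)"
      using d e split[of d] split[of e] I by (simp add: cong_def)
    then have "[d k0 = e k0] (mod p)"
      using cop by (simp add: cong_add_rcancel_nat cong_mult_rcancel_nat)
    moreover have "d k0 < p" "e k0 < p" using d e j(1) by auto
    ultimately have k0: "d k0 = e k0" by (simp add: cong_def)
    show "d = e"
    proof (rule PiE_ext[of d "{..m}" "\<lambda>_. {..<p}" e])
      show "d k = e k" if "k \<in> {..m}" for k using I k0 that by (cases "k = k0") auto
    qed (use d e in auto)
  qed
  have im: "(\<lambda>d. restrict d ?I) ` ?D = ?I \<rightarrow>\<^sub>E {..<p}"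
  proof (intro equalityI subsetI)
    fix e assume "e \<in> (\<lambda>d. restrict d ?I) ` ?D"
    then obtain d where d: "d \<in> {..m} \<rightarrow>\<^sub>E {..<p}" "e = restrict d ?I" by blast
    then show "e \<in> ?I \<rightarrow>\<^sub>E {..<p}" by (simp add: PiE_iff)
  next
    fix e assume e: "e \<in> ?I \<rightarrow>\<^sub>E {..<p}"
    obtain x where x: "[j k0 * x = 1] (mod p)" using cop cong_solve_coprime_nat by auto
    define s where "s = (\<Sum>k\<in>?I. e k * j k)"
    \<comment> \<open>Solves c * j k0 = 1 - s modulo \<open>p\<close>; the term
      \<open>p - s mod p\<close> stands for -s.\<close>
    define c where "c = (x * (1 + (p - s mod p))) mod p"
    have "[c * j k0 + s = 1] (mod p)"
    proof -
      have "[c = x * (1 + (p - s mod p))] (mod p)" by (simp add: c_def cong_def)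
      then have "[c * j k0 = (j k0 * x) * (1 + (p - s mod p))] (mod p)"
        using cong_scalar_right[of c "x * (1 + (p - s mod p))" p "j k0"] by (simp only: ac_simps)
      also have "[(j k0 * x) * (1 + (p - s mod p)) = 1 * (1 + (p - s mod p))] (mod p)"
        using cong_scalar_right[OF x] .
      finally have "[c * j k0 + s = 1 * (1 + (p - s mod p)) + s mod p] (mod p)"
        by (intro cong_add) (simp_all add: cong_def)
      moreover have "1 * (1 + (p - s mod p)) + s mod p = 1 + p"
        using mod_less_divisor[of p s] p1 by simp
      moreover have "[1 + p = 1] (mod p)" by (simp only: cong_def mod_add_self2)
      ultimately show ?thesis using cong_trans by metis
    qed
    then have c: "(c * j k0 + s) mod p = 1" "c < p" using p1 by (auto simp: cong_def c_def)
    let ?d = "e(k0 := c)"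
    have "?d \<in> {..m} \<rightarrow>\<^sub>E {..<p}" using e c j(1) by (auto simp: PiE_iff extensional_def)
    moreover have "(\<Sum>k\<in>?I. ?d k * j k) = s" unfolding s_def by (rule sum.cong) auto
    then have "(\<Sum>k\<le>m. ?d k * j k) mod p = 1" using c unfolding split by simp
    moreover have "restrict ?d ?I = e"
    proof
      fix k show "restrict ?d ?I k = e k" using e by (cases "k \<in> ?I") (auto simp: PiE_iff extensional_def)
    qed
    ultimately show "e \<in> (\<lambda>d. restrict d ?I) ` ?D" by (intro image_eqI[of _ _ ?d]) auto
  qed
  have "card ?D = card (?I \<rightarrow>\<^sub>E {..<p})" using card_image[OF inj] unfolding im by simp
  also have "\<dots> = p ^ m" using j(1) by (simp add: card_PiE)
  finally show ?thesis .
qed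

context comm_monoid
begin

lemma finprod_swap:
  assumes "finite A" "finite B" "\<And>a b. a \<in> A \<Longrightarrow> b \<in> B \<Longrightarrow> f a b \<in> carrier G"
  shows "finprod G (\<lambda>a. finprod G (f a) B) A = finprod G (\<lambda>b. finprod G (\<lambda>a. f a b) A) B"
  using assms(1,3)
proof (induction A rule: finite_induct)
  case (insert a A)
  have "finprod G (\<lambda>b. finprod G (\<lambda>a. f a b) (insert a A)) B =
      finprod G (\<lambda>b. f a b \<otimes> finprod G (\<lambda>a. f a b) A) B"
    using insert by (intro finprod_cong') (auto simp: Pi_def)
  also have "\<dots> = finprod G (f a) B \<otimes> finprod G (\<lambda>b. finprod G (\<lambda>a. f a b) A) B"
    using insert by (intro finprod_multf) auto
  finally show ?case using insert by (simp add: Pi_def)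
qed simp

lemma finprod_pow:
  assumes "finite A" "f \<in> A \<rightarrow> carrier G"
  shows "finprod G (\<lambda>a. f a [^] (n::nat)) A = finprod G f A [^] n"
  using assms
proof (induction A rule: finite_induct)
  case (insert a A)
  then show ?case by (simp add: Pi_def nat_pow_distrib)
qed simp

end

section \<open>Evaluation of trees in a group\<close>

context group
begin

fun ev :: "(nat \<Rightarrow> 'a) \<Rightarrow> nat lie_tree \<Rightarrow> 'a" where
  "ev f (Leaf k) = f k"
| "ev f (Node a b) = cm (ev f a) (ev f b)"

lemma ev_lcs: "(\<And>k. f k \<in> carrier G) \<Longrightarrow> ev f t \<in> lcs G (idx t)"
  using lcs_cm by (induction t) auto

lemma ev_cong: "(\<And>k. k \<in># leaves t \<Longrightarrow> f k = g k) \<Longrightarrow> ev f t = ev g t"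
  by (induction t) auto

lemma ev_plug: "ev f (plug a cs) = foldl cm (ev f a) (map (ev f) cs)"
  by (induction cs arbitrary: a) auto

lemma lin_foldl_cm:
  assumes "\<And>k. f k \<in> carrier G"
  shows "lin i (i + (\<Sum>c\<leftarrow>cs. Suc (idx c))) (\<lambda>x. foldl cm x (map (ev f) cs))"
proof (induction cs arbitrary: i)
  case Nil
  show ?case using lin_id by simp
next
  case (Cons c cs)
  have 1: "lin i (i + idx c + 1) (\<lambda>x. cm x (ev f c))"
    by (rule lin_cm1[OF ev_lcs]) (use assms in auto)
  have "lin i (i + idx c + 1 + (\<Sum>c\<leftarrow>cs. Suc (idx c))) (\<lambda>x. foldl cm (cm x (ev f c)) (map (ev f) cs))"
    by (rule lin_comp[OF 1 Cons.IH])
  then show ?case by (simp add: ac_simps)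
qed

lemma lin_plug:
  "(\<And>k. f k \<in> carrier G) \<Longrightarrow> lin (idx a) (idx (plug a cs)) (\<lambda>x. foldl cm x (map (ev f) cs))"
  unfolding idx_plug by (rule lin_foldl_cm)

text \<open>The new entry is assigned to the label \<open>Suc m\<close>, which the earlier leaves do
  not carry.\<close>

lemma lnorm_ev:
  "x \<in> lnorm (carrier G) m \<Longrightarrow> \<exists>X. (\<forall>k. X k \<in> carrier G) \<and> x = ev X (lntree m)"
proof (induction m arbitrary: x)
  case 0
  then show ?case by (auto intro!: exI[of _ "\<lambda>_. x"])
next
  case (Suc m)
  then obtain a s where x: "x = cm a s" "a \<in> lnorm (carrier G) m" "s \<in> carrier G" by auto
  then obtain X where X: "\<forall>k. X k \<in> carrier G" "a = ev X (lntree m)" using Suc.IH by blast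
  have "ev (X(Suc m := s)) (lntree m) = ev X (lntree m)"
    by (rule ev_cong) (auto simp: leaves_lntree)
  then have "x = ev (X(Suc m := s)) (lntree (Suc m))"
    by (simp only: x X ev.simps lntree.simps fun_upd_same)
  moreover have "\<forall>k. (X(Suc m := s)) k \<in> carrier G" using X x by simp
  ultimately show ?case by blast
qed

end

locale group_endo = group G for G (structure) +
  fixes \<beta> :: "'a \<Rightarrow> 'a"
  assumes hom: "\<beta> \<in> hom G G"
begin

lemma beta_closed [simp]: "x \<in> carrier G \<Longrightarrow> \<beta> x \<in> carrier G"
  using hom hom_in_carrier by fastforce

lemma beta_cm: "x \<in> carrier G \<Longrightarrow> y \<in> carrier G \<Longrightarrow> \<beta> (cm x y) = cm (\<beta> x) (\<beta> y)"
proof -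
  interpret h: group_hom G G \<beta> using hom by unfold_locales
  show "x \<in> carrier G \<Longrightarrow> y \<in> carrier G \<Longrightarrow> ?thesis" by (simp add: cm_def)
qed

lemma beta_lcs: "x \<in> lcs G i \<Longrightarrow> \<beta> x \<in> lcs G i"
proof (induction i arbitrary: x)
  case 0
  then show ?case by simp
next
  case (Suc i)
  interpret h: group_hom G G \<beta> using hom by unfold_locales
  have "\<beta> ` lcs G i \<subseteq> lcs G i" "\<beta> ` carrier G \<subseteq> carrier G" using Suc.IH beta_closed by blast+
  then have "\<beta> ` lcs G (Suc i) \<subseteq> generate G (comm_set G (lcs G i) (carrier G))"
    unfolding h.image_lcs_Suc by (intro mono_generate comm_set_mono)
  then show ?case using Suc.prems unfolding lcs.simps(2) by blast
qed

lemma lin_beta: "lin i i \<beta>"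
proof -
  have "\<beta> (x \<otimes> y) = \<beta> x \<otimes> \<beta> y" if "x \<in> lcs G i" "y \<in> lcs G i" for x y
    using hom_mult[OF hom] lcs_carrier that by blast
  then show ?thesis by (simp add: lin_def beta_lcs gcl_mult)
qed

lemma beta_pow_lcs: "x \<in> lcs G i \<Longrightarrow> (\<beta> ^^ r) x \<in> lcs G i"
  by (induction r) (auto intro: beta_lcs)

lemma beta_pow_closed [simp]: "x \<in> carrier G \<Longrightarrow> (\<beta> ^^ r) x \<in> carrier G"
  by (induction r) auto

lemma beta_pow_hom: "\<beta> ^^ r \<in> hom G G"
proof -
  interpret h: group_hom G G \<beta> using hom by unfold_locales
  have "(\<beta> ^^ r) (x \<otimes> y) = (\<beta> ^^ r) x \<otimes> (\<beta> ^^ r) y" if "x \<in> carrier G" "y \<in> carrier G" for x y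
    using that by (induction r) auto
  then show ?thesis by (auto simp: hom_def)
qed

lemma beta_pow_int_pow: "x \<in> carrier G \<Longrightarrow> (\<beta> ^^ r) (x [^] (c::int)) = (\<beta> ^^ r) x [^] c"
  by (rule hom_int_pow[OF beta_pow_hom _ is_group is_group])

end

text \<open>The norm vanishes on factors only; on the group itself \<open>\<beta> ^^ p\<close> may
  differ from the identity, so comparisons are made modulo the next term.\<close>

locale sectional_endo = group_endo +
  fixes p :: nat
  assumes prime: "prime p"
    and norm_trivial: "x \<in> lcs G i \<Longrightarrow> finprod (gr i) (\<lambda>r. gcl i ((\<beta> ^^ r) x)) {..<p} = \<one>\<^bsub>gr i\<^esub>"
begin

lemma p_gt: "p > 0" "p > 1"
  using prime prime_gt_0_nat prime_gt_1_nat by auto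

text \<open>The norms of \<open>x\<close> and of \<open>\<beta> x\<close> are both trivial and share
  the terms with exponents 1 to p - 1; cancelling these equates the two that remain.\<close>

lemma gcl_beta_p:
  assumes x: "x \<in> lcs G i"
  shows "gcl i ((\<beta> ^^ p) x) = gcl i x"
proof -
  interpret A: comm_group "gr i" by (rule comm_group_gr)
  let ?f = "\<lambda>r. gcl i ((\<beta> ^^ r) x)"
  have f: "?f r \<in> carrier (gr i)" for r using beta_pow_lcs[OF x] by simp
  have "{..<p} = insert 0 {1..<p}" using p_gt by auto
  then have 1: "\<one>\<^bsub>gr i\<^esub> = ?f 0 \<otimes>\<^bsub>gr i\<^esub> finprod (gr i) ?f {1..<p}"
    using norm_trivial[OF x] f x by (simp add: Pi_def)
  have "finprod (gr i) (\<lambda>r. ?f (Suc r)) {..<p} = \<one>\<^bsub>gr i\<^esub>"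
    using norm_trivial[OF beta_lcs[OF x]] by (simp add: funpow_swap1)
  moreover have "finprod (gr i) ?f (Suc ` {..<p}) = finprod (gr i) (\<lambda>r. ?f (Suc r)) {..<p}"
    using f by (intro A.finprod_reindex) (auto simp del: funpow.simps)
  moreover have "Suc ` {..<p} = insert p {1..<p}"
    using p_gt unfolding image_Suc_lessThan by auto
  ultimately have 2: "\<one>\<^bsub>gr i\<^esub> = ?f p \<otimes>\<^bsub>gr i\<^esub> finprod (gr i) ?f {1..<p}"
    using f by (simp add: Pi_def del: funpow.simps)
  have "finprod (gr i) ?f {1..<p} \<in> carrier (gr i)" using f by auto
  then show ?thesis using 1 2 f[of 0] f[of p] A.right_cancel[of "finprod (gr i) ?f {1..<p}" "?f p" "?f 0"] by simp
qed

definition evj :: "(nat \<Rightarrow> 'a) \<Rightarrow> (nat \<Rightarrow> nat) \<Rightarrow> nat lie_tree \<Rightarrow> 'a" where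
  "evj X j = ev (\<lambda>k. (\<beta> ^^ j k) (X k))"

definition assgn :: "nat \<Rightarrow> (nat \<Rightarrow> nat) \<Rightarrow> nat \<Rightarrow> (nat \<Rightarrow> nat) set" where
  "assgn m d s = {j \<in> {..m} \<rightarrow>\<^sub>E {..<p}. (\<Sum>k\<le>m. d k * j k) mod p = s}"

text \<open>The coefficient of \<open>u^s\<close> in the commutator of shape \<open>t\<close> evaluated at the formal eigenvectors
\<open>\<Sum>j<p. u^(d k * j) (\<beta>^j (X k))\<close>, where \<open>u^p = 1\<close>. The zero rule only yields \<open>p\<close> times this
coefficient to be trivial, which is why powers of \<open>p\<close> accumulate.\<close>

definition eigen_coeff :: "nat \<Rightarrow> (nat \<Rightarrow> 'a) \<Rightarrow> (nat \<Rightarrow> nat) \<Rightarrow> nat \<Rightarrow> nat lie_tree \<Rightarrow> 'a set" where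
  "eigen_coeff m X d s t = finprod (gr m) (\<lambda>j. gcl m (evj X j t)) (assgn m d s)"

text \<open>Applies \<beta> once more at the labels in \<open>A\<close>, exponents being read
  cyclically.\<close>

definition shift :: "nat \<Rightarrow> nat set \<Rightarrow> (nat \<Rightarrow> nat) \<Rightarrow> nat \<Rightarrow> nat" where
  "shift m A j = (\<lambda>k\<in>{..m}. if k \<in> A then (j k + 1) mod p else j k)"

lemma finite_assgn: "finite (assgn m d s)"
  unfolding assgn_def by (rule finite_subset[of _ "{..m} \<rightarrow>\<^sub>E {..<p}"]) (auto intro: finite_PiE)

lemma evj_lcs: "(\<And>k. X k \<in> carrier G) \<Longrightarrow> evj X j t \<in> lcs G (idx t)"
  unfolding evj_def by (rule ev_lcs) simp

lemma inj_shift: "inj_on (shift m A) (assgn m d s)"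
proof (rule inj_onI)
  fix j l assume j: "j \<in> assgn m d s" and l: "l \<in> assgn m d s" and eq: "shift m A j = shift m A l"
  have "j k = l k" if "k \<in> {..m}" for k
  proof (cases "k \<in> A")
    case True
    then have "(j k + 1) mod p = (l k + 1) mod p" using fun_cong[OF eq, of k] that by (simp add: shift_def)
    then have "[j k = l k] (mod p)" unfolding cong_def[symmetric] by (simp only: cong_add_rcancel_nat)
    moreover have "j k < p" "l k < p" using j l that by (auto simp: assgn_def)
    ultimately show ?thesis by (simp add: cong_def)
  next
    case False
    then show ?thesis using fun_cong[OF eq, of k] that by (simp add: shift_def)
  qed
  then show "j = l" using j l by (intro PiE_ext[of j "{..m}" "\<lambda>_. {..<p}" l]) (auto simp: assgn_def)
qed

lemma shift_assgn:
  assumes j: "j \<in> assgn m d s" and A: "A \<subseteq> {..m}" "(\<Sum>k\<in>A. d k) mod p = 0"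
  shows "shift m A j \<in> assgn m d s"
proof -
  have "[(\<Sum>k\<le>m. d k * shift m A j k) = (\<Sum>k\<le>m. d k * j k + (if k \<in> A then d k else 0))] (mod p)"
  proof (rule cong_sum)
    fix k assume k: "k \<in> {..m}"
    have "[d k * ((j k + 1) mod p) = d k * (j k + 1)] (mod p)" by (simp add: cong_def mod_simps)
    then show "[d k * shift m A j k = d k * j k + (if k \<in> A then d k else 0)] (mod p)"
      using k by (auto simp: shift_def algebra_simps)
  qed
  also have "(\<Sum>k\<le>m. d k * j k + (if k \<in> A then d k else 0)) = (\<Sum>k\<le>m. d k * j k) + (\<Sum>k\<in>A. d k)"
    using A(1) by (simp add: sum.distrib sum.If_cases Int_absorb1)
  also have "[\<dots> = (\<Sum>k\<le>m. d k * j k) + 0] (mod p)"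
    using A(2) by (intro cong_add) (simp_all add: cong_def)
  finally have "(\<Sum>k\<le>m. d k * shift m A j k) mod p = s" using j by (simp add: cong_def assgn_def)
  then show ?thesis using j p_gt by (auto simp: assgn_def shift_def PiE_iff)
qed

lemma bij_shift:
  assumes "A \<subseteq> {..m}" "(\<Sum>k\<in>A. d k) mod p = 0"
  shows "shift m A ` assgn m d s = assgn m d s"
  by (rule endo_inj_surj[OF finite_assgn _ inj_shift]) (use shift_assgn assms in auto)

lemma evj_shift_disjoint:
  assumes "set_mset (leaves t) \<inter> A = {}" "set_mset (leaves t) \<subseteq> {..m}"
  shows "evj X (shift m A j) t = evj X j t"
  unfolding evj_def by (rule ev_cong) (use assms in \<open>auto simp: shift_def\<close>)

text \<open>Every leaf gains one \<beta>, and \<beta> commutes with commutators. Where an exponent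
  wraps from p - 1 to 0 this holds modulo the next term, by \<open>gcl_beta_p\<close>.\<close>

lemma evj_shift_subset:
  assumes X: "\<And>k. X k \<in> carrier G" and j: "j \<in> assgn m d s"
  shows "set_mset (leaves t) \<subseteq> A \<Longrightarrow> set_mset (leaves t) \<subseteq> {..m} \<Longrightarrow>
    gcl (idx t) (evj X (shift m A j) t) = gcl (idx t) (\<beta> (evj X j t))"
proof (induction t)
  case (Leaf k)
  have jk: "j k < p" using j Leaf by (auto simp: assgn_def)
  show ?case
  proof (cases "j k + 1 = p")
    case True
    have "gcl 0 (X k) = gcl 0 ((\<beta> ^^ p) (X k))" using gcl_beta_p[of "X k" 0] X by simp
    also have "(\<beta> ^^ p) (X k) = \<beta> ((\<beta> ^^ j k) (X k))" using True by (metis Suc_eq_plus1 funpow.simps(2) o_apply)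
    finally show ?thesis using True Leaf by (simp add: evj_def shift_def)
  next
    case False
    then show ?thesis using jk Leaf by (simp add: evj_def shift_def)
  qed
next
  case (Node a b)
  let ?w = "idx a + idx b + 1" and ?j = "shift m A j"
  note E = evj_lcs[OF X]
  have IH: "gcl (idx a) (evj X ?j a) = gcl (idx a) (\<beta> (evj X j a))"
    "gcl (idx b) (evj X ?j b) = gcl (idx b) (\<beta> (evj X j b))"
    using Node by auto
  have N: "evj X i (Node a b) = cm (evj X i a) (evj X i b)" for i by (simp add: evj_def)
  have "gcl ?w (cm (evj X ?j a) (evj X ?j b)) = gcl ?w (cm (\<beta> (evj X j a)) (evj X ?j b))"
    by (rule lin_cong[OF lin_cm1[OF E] E beta_lcs[OF E] IH(1)]) simp
  also have "\<dots> = gcl ?w (cm (\<beta> (evj X j a)) (\<beta> (evj X j b)))"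
    by (rule lin_cong[OF lin_cm2[OF beta_lcs[OF E]] E beta_lcs[OF E] IH(2)]) simp
  also have "cm (\<beta> (evj X j a)) (\<beta> (evj X j b)) = \<beta> (evj X j (Node a b))"
    unfolding N using beta_cm lcs_carrier[OF E] by simp
  finally show ?case unfolding N by simp
qed

text \<open>The degrees of the leaves of \<open>a\<close> sum to zero, so shifting at these leaves
  permutes the assignments counted by the coefficient. The product of p shifted copies is therefore
  the p-th power; with the two products exchanged, each assignment contributes the norm of the value
  of \<open>a\<close>, placed in a linear context, and this is trivial.\<close>

lemma eigen_coeff_zero:
  assumes X: "\<And>k. X k \<in> carrier G" and L: "leaves (plug a cs) = mset_set {..m}"
    and a: "(\<Sum>k\<in>#leaves a. d k) mod p = 0"
  shows "eigen_coeff m X d s (plug a cs) [^]\<^bsub>gr m\<^esub> p = \<one>\<^bsub>gr m\<^esub>"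
proof -
  interpret A: comm_group "gr m" by (rule comm_group_gr)
  let ?A = "set_mset (leaves a)" and ?J = "assgn m d s" and ?t = "plug a cs"
  let ?\<sigma> = "shift m ?A" and ?f = "\<lambda>j. gcl m (evj X j ?t)"
  have im: "idx ?t = m" using arg_cong[OF L, of size] by (simp add: size_leaves)
  have sum: "mset_set {..m} = leaves a + sum_list (map leaves cs)" using L leaves_plug by metis
  have A: "?A \<subseteq> {..m}" using arg_cong[OF sum, of set_mset] by auto
  have dis: "set_mset (leaves c) \<inter> ?A = {} \<and> set_mset (leaves c) \<subseteq> {..m}" if "c \<in> set cs" for c
  proof -
    have "leaves c \<subseteq># sum_list (map leaves cs)"
      using that by (metis in_set_conv_decomp list.simps(9) map_append mset_subset_eq_add_left mset_subset_eq_add_right subset_mset.order_trans sum_list.Cons sum_list_append)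
    then have c: "leaves c + leaves a \<subseteq># mset_set {..m}" unfolding sum by (simp add: add.commute)
    have False if "x \<in># leaves c" "x \<in># leaves a" for x
    proof -
      have "count (leaves c + leaves a) x \<ge> 2"
        using that by (simp flip: count_greater_zero_iff)
      moreover have "count (mset_set {..m}) x \<le> 1" by (simp add: count_mset_set')
      ultimately show False using mset_subset_eq_count[OF c, of x] by simp
    qed
    moreover have "set_mset (leaves c) \<subseteq> {..m}" using set_mset_mono[OF c] by auto
    ultimately show ?thesis by blast
  qed
  \<comment> \<open>All labels are distinct, so summing over the multiset of leaves is summing over
    the set of labels.\<close>
  have "leaves a = mset_set ?A"
  proof (rule multiset_eqI)
    fix x
    have "count (leaves a) x \<le> count (mset_set {..m}) x" unfolding sum by simp
    also have "\<dots> \<le> 1" by (simp add: count_mset_set')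
    finally have "count (leaves a) x = (if x \<in># leaves a then 1 else 0)"
      by (cases "count (leaves a) x") (auto simp: not_in_iff)
    then show "count (leaves a) x = count (mset_set ?A) x" by (simp add: count_mset_set')
  qed
  then have dA: "(\<Sum>k\<in>?A. d k) mod p = 0" using a by (metis sum_unfold_sum_mset)
  have f: "?f j \<in> carrier (gr m)" for j using evj_lcs[of X j ?t, OF X] im by simp
  have reidx: "finprod (gr m) (\<lambda>j. ?f ((?\<sigma> ^^ r) j)) ?J = eigen_coeff m X d s ?t" for r
  proof (induction r)
    case 0
    show ?case by (simp add: eigen_coeff_def)
  next
    case (Suc r)
    have "finprod (gr m) (\<lambda>j. ?f ((?\<sigma> ^^ r) j)) (?\<sigma> ` ?J) = finprod (gr m) (\<lambda>j. ?f ((?\<sigma> ^^ r) (?\<sigma> j))) ?J"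
      by (rule A.finprod_reindex) (use f inj_shift in auto)
    then show ?case using Suc bij_shift[OF A dA] by (simp add: funpow_swap1)
  qed
  have orbit: "finprod (gr m) (\<lambda>r. ?f ((?\<sigma> ^^ r) j)) {..<p} = \<one>\<^bsub>gr m\<^esub>" if j: "j \<in> ?J" for j
  proof -
    let ?F = "\<lambda>x. foldl cm x (map (evj X j) cs)" and ?y = "evj X j a"
    have F: "lin (idx a) m ?F" using lin_plug[of "\<lambda>k. (\<beta> ^^ j k) (X k)" a cs] im X by (simp add: evj_def)
    have y: "?y \<in> lcs G (idx a)" using evj_lcs X by blast
    have \<sigma>: "(?\<sigma> ^^ r) j \<in> ?J" for r by (induction r) (auto intro: shift_assgn[OF _ A dA] j)
    have ea: "gcl (idx a) (evj X ((?\<sigma> ^^ r) j) a) = gcl (idx a) ((\<beta> ^^ r) ?y)" for r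
    proof (induction r)
      case (Suc r)
      have "gcl (idx a) (evj X (?\<sigma> ((?\<sigma> ^^ r) j)) a) = gcl (idx a) (\<beta> (evj X ((?\<sigma> ^^ r) j) a))"
        by (rule evj_shift_subset[OF X \<sigma>]) (use A in auto)
      also have "\<dots> = gcl (idx a) (\<beta> ((\<beta> ^^ r) ?y))"
        by (rule lin_cong[OF lin_beta evj_lcs[OF X] beta_pow_lcs[OF y] Suc])
      finally show ?case by simp
    qed simp
    have ec: "evj X ((?\<sigma> ^^ r) j) c = evj X j c" if "c \<in> set cs" for r c
      using evj_shift_disjoint dis[OF that] by (induction r) auto
    have "?f ((?\<sigma> ^^ r) j) = gcl m (?F ((\<beta> ^^ r) ?y))" for r
    proof -
      have "evj X ((?\<sigma> ^^ r) j) ?t = foldl cm (evj X ((?\<sigma> ^^ r) j) a) (map (evj X ((?\<sigma> ^^ r) j)) cs)"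
        unfolding evj_def by (rule ev_plug)
      also have "map (evj X ((?\<sigma> ^^ r) j)) cs = map (evj X j) cs" using ec by simp
      finally show ?thesis
        using lin_cong[OF F evj_lcs[OF X] beta_pow_lcs[OF y] ea] by simp
    qed
    then show ?thesis
      using lin_finprod[OF F _ _ norm_trivial[OF y]] beta_pow_lcs[OF y] by simp
  qed
  have "eigen_coeff m X d s ?t [^]\<^bsub>gr m\<^esub> p = finprod (gr m) (\<lambda>r. eigen_coeff m X d s ?t) {..<p}"
    using A.finprod_const[of "eigen_coeff m X d s ?t" "{..<p}"] f by (simp add: eigen_coeff_def)
  also have "\<dots> = finprod (gr m) (\<lambda>r. finprod (gr m) (\<lambda>j. ?f ((?\<sigma> ^^ r) j)) ?J) {..<p}"
    using reidx by simp
  also have "\<dots> = finprod (gr m) (\<lambda>j. finprod (gr m) (\<lambda>r. ?f ((?\<sigma> ^^ r) j)) {..<p}) ?J"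
    using f finite_assgn by (intro A.finprod_swap) auto
  also have "\<dots> = \<one>\<^bsub>gr m\<^esub>" using orbit by (rule A.finprod_one_eqI)
  finally show ?thesis .
qed

lemma eigen_coeff_mult:
  assumes "\<And>j. gcl m (evj X j t) = gcl m (evj X j u) \<otimes>\<^bsub>gr m\<^esub> gcl m (evj X j v)"
    and "\<And>j. evj X j u \<in> lcs G m" "\<And>j. evj X j v \<in> lcs G m"
  shows "eigen_coeff m X d s t = eigen_coeff m X d s u \<otimes>\<^bsub>gr m\<^esub> eigen_coeff m X d s v"
proof -
  interpret A: comm_group "gr m" by (rule comm_group_gr)
  show ?thesis unfolding eigen_coeff_def assms(1) by (rule A.finprod_multf) (use assms in auto)
qed

lemma eigen_coeff_closed: "(\<And>j. evj X j t \<in> lcs G m) \<Longrightarrow> eigen_coeff m X d s t \<in> carrier (gr m)"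
proof -
  interpret A: comm_group "gr m" by (rule comm_group_gr)
  show "(\<And>j. evj X j t \<in> lcs G m) \<Longrightarrow> ?thesis" unfolding eigen_coeff_def by (rule A.finprod_closed) auto
qed

text \<open>Induction over the derivation: antisymmetry and Jacobi hold for each assignment, hence
  for coefficients, and \<open>zero\<close> is \<open>eigen_coeff_zero\<close>. Each rule preserves
  triviality of the p-th power, so the exponent does not grow with the length of the
  derivation.\<close>

lemma eigen_coeff_cl:
  assumes X: "\<And>k. X k \<in> carrier G"
  shows "t \<in> graded_trees.cl p d {} \<Longrightarrow> leaves t = mset_set {..m} \<Longrightarrow>
    eigen_coeff m X d s t [^]\<^bsub>gr m\<^esub> p = \<one>\<^bsub>gr m\<^esub>"
proof -
  interpret A: comm_group "gr m" by (rule comm_group_gr)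
  interpret T: graded_trees p d using prime by unfold_locales
  have E: "evj X j t \<in> lcs G m" if "leaves t = mset_set {..m}" for t j
  proof -
    have "idx t = m" using arg_cong[OF that, of size] by (simp add: size_leaves)
    then show ?thesis using evj_lcs X by blast
  qed
  have plugE: "evj X j (plug a cs) = foldl cm (evj X j a) (map (evj X j) cs)" for j a cs
    unfolding evj_def by (rule ev_plug)
  have L: "lin (idx a) (idx (plug a cs)) (\<lambda>x. foldl cm x (map (evj X j) cs))" for a cs j
    unfolding evj_def by (rule lin_plug) (use X in auto)
  have I: "idx t = m" if "leaves t = mset_set {..m}" for t :: "nat lie_tree"
    using arg_cong[OF that, of size] by (simp add: size_leaves)
  show "t \<in> graded_trees.cl p d {} \<Longrightarrow> leaves t = mset_set {..m} \<Longrightarrow> ?thesis"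
  proof (induction rule: T.cl.induct)
    case (zero a cs)
    then show ?case using eigen_coeff_zero[OF X] by (simp add: T.deg_def)
  next
    case (sym b a cs)
    let ?t = "plug (Node a b) cs" and ?u = "plug (Node b a) cs"
    have u: "leaves ?u = mset_set {..m}" using sym by (simp add: leaves_plug ac_simps)
    have L': "lin (idx (Node a b)) m (\<lambda>x. foldl cm x (map (evj X j) cs))" for j
      using L[of "Node a b" cs j] I[OF sym.prems] by simp
    have "gcl m (evj X j ?t) \<otimes>\<^bsub>gr m\<^esub> gcl m (evj X j ?u) = \<one>\<^bsub>gr m\<^esub>" for j
    proof -
      have ab: "evj X j (Node a b) \<in> lcs G (idx (Node a b))" by (rule evj_lcs[OF X])
      have "evj X j (Node b a) = inv (evj X j (Node a b))"
        using inv_cm lcs_carrier[OF evj_lcs[OF X]] by (simp add: evj_def)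
      then have "gcl m (evj X j ?u) = inv\<^bsub>gr m\<^esub> gcl m (evj X j ?t)"
        unfolding plugE using lin_inv[OF L' ab] by simp
      then show ?thesis using E[OF sym.prems] by simp
    qed
    then have "eigen_coeff m X d s ?t \<otimes>\<^bsub>gr m\<^esub> eigen_coeff m X d s ?u = \<one>\<^bsub>gr m\<^esub>"
      unfolding eigen_coeff_def using E[OF sym.prems] E[OF u]
      by (subst A.finprod_multf[symmetric]) (auto intro!: A.finprod_one_eqI)
    moreover have c: "eigen_coeff m X d s ?t \<in> carrier (gr m)" "eigen_coeff m X d s ?u \<in> carrier (gr m)"
      using eigen_coeff_closed[OF E[OF u]] eigen_coeff_closed[OF E[OF sym.prems]] by auto
    ultimately have "eigen_coeff m X d s ?t [^]\<^bsub>gr m\<^esub> p \<otimes>\<^bsub>gr m\<^esub> eigen_coeff m X d s ?u [^]\<^bsub>gr m\<^esub> p = \<one>\<^bsub>gr m\<^esub>"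
      by (metis A.nat_pow_distrib A.nat_pow_one)
    then show ?case using sym.IH[OF u] c by simp
  next
    case (jac a c b cs)
    let ?t = "plug (Node (Node a b) c) cs" and ?u = "plug (Node (Node a c) b) cs"
      and ?v = "plug (Node a (Node b c)) cs"
    have u: "leaves ?u = mset_set {..m}" and v: "leaves ?v = mset_set {..m}"
      using jac by (simp_all add: leaves_plug ac_simps)
    let ?i = "idx (Node (Node a b) c)"
    have L': "lin ?i m (\<lambda>x. foldl cm x (map (evj X j) cs))" for j
      using L[of "Node (Node a b) c" cs j] I[OF jac.prems] by simp
    have "gcl m (evj X j ?t) = gcl m (evj X j ?u) \<otimes>\<^bsub>gr m\<^esub> gcl m (evj X j ?v)" for j
    proof -
      let ?x = "evj X j (Node (Node a b) c)" and ?y = "evj X j (Node (Node a c) b)"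
        and ?z = "evj X j (Node a (Node b c))"
      have i: "idx (Node (Node a c) b) = ?i" "idx (Node a (Node b c)) = ?i" by simp_all
      have xyz: "?x \<in> lcs G ?i" "?y \<in> lcs G ?i" "?z \<in> lcs G ?i"
        using evj_lcs[of X j "Node (Node a b) c", OF X] evj_lcs[of X j "Node (Node a c) b", OF X]
          evj_lcs[of X j "Node a (Node b c)", OF X] unfolding i by this
      have "gcl ?i ?x = gcl ?i ?y \<otimes>\<^bsub>gr ?i\<^esub> gcl ?i ?z"
        using jacobi[OF ev_lcs ev_lcs ev_lcs, of "\<lambda>k. (\<beta> ^^ j k) (X k)" "\<lambda>k. (\<beta> ^^ j k) (X k)" "\<lambda>k. (\<beta> ^^ j k) (X k)" ?i a b c] X
        by (simp add: evj_def)
      then have "gcl ?i ?x = gcl ?i (?y \<otimes> ?z)" using gcl_mult xyz by simp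
      then have "gcl m (evj X j ?t) = gcl m (foldl cm (?y \<otimes> ?z) (map (evj X j) cs))"
        unfolding plugE by (rule lin_cong[OF L' xyz(1) lcs_mult[OF xyz(2,3)]])
      then show ?thesis unfolding plugE using lin_mult[OF L' xyz(2,3)] by simp
    qed
    then have "eigen_coeff m X d s ?t = eigen_coeff m X d s ?u \<otimes>\<^bsub>gr m\<^esub> eigen_coeff m X d s ?v"
      using E[OF u] E[OF v] by (rule eigen_coeff_mult)
    then show ?case
      using jac.IH(1)[OF u] jac.IH(2)[OF v] eigen_coeff_closed[OF E[OF u]] eigen_coeff_closed[OF E[OF v]]
      by (simp add: A.nat_pow_distrib)
  qed simp
qed

text \<open>\<open>gam\<close> does not involve the grading, so a constant degree function serves to
  enter the locale.\<close>

lemma lntree_gam: "lntree m \<in> graded_trees.gam UNIV m"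
proof -
  interpret T: graded_trees p "\<lambda>_. 0" using prime by unfold_locales
  show ?thesis by (induction m) auto
qed

text \<open>In the product over all degree functions \<open>d\<close> of the coefficients at \<open>u^1\<close>, an assignment
\<open>j \<noteq> 0\<close> is counted \<open>p ^ m\<close> times and \<open>j = 0\<close> never; comparing with the product over all
assignments isolates \<open>j = 0\<close>, the commutator of the \<open>X k\<close> themselves.\<close>

lemma lntree_power:
  assumes X: "\<And>k. X k \<in> carrier G" and m: "m \<ge> (\<Sum>i<2 ^ (p - 1) - 1. (p - 1) ^ i)"
  shows "gcl m (ev X (lntree m)) [^]\<^bsub>gr m\<^esub> (p ^ Suc m) = \<one>\<^bsub>gr m\<^esub>"
proof -
  interpret A: comm_group "gr m" by (rule comm_group_gr)
  let ?t = "lntree m" and ?J = "{..m} \<rightarrow>\<^sub>E {..<p}"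
  let ?f = "\<lambda>j. gcl m (evj X j ?t)"
  have im: "idx ?t = m" by (induction m) auto
  have f: "?f j \<in> carrier (gr m)" for j using evj_lcs[of X j ?t, OF X] im by simp
  have fin: "finite ?J" by (simp add: finite_PiE)
  have tcl: "?t \<in> graded_trees.cl p d {}" for d
  proof -
    interpret T: graded_trees p d using prime by unfold_locales
    show ?thesis using T.kreknin_higman[OF m] lntree_gam by blast
  qed
  have eigen_coeff: "eigen_coeff m X d s ?t [^]\<^bsub>gr m\<^esub> p = \<one>\<^bsub>gr m\<^esub>" for d s
    by (rule eigen_coeff_cl[OF X tcl leaves_lntree])
  define j0 where "j0 = (\<lambda>k\<in>{..m}. 0 :: nat)"
  have j0: "j0 \<in> ?J" using p_gt by (simp add: j0_def)
  define R where "R = finprod (gr m) ?f (?J - {j0})"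
  have Rc: "R \<in> carrier (gr m)" using f by (auto simp: R_def)
  \<comment> \<open>For the zero degree function the coefficient at u^0 is the product over all
    assignments.\<close>
  have "assgn m (\<lambda>_. 0) 0 = ?J" by (auto simp: assgn_def)
  then have "eigen_coeff m X (\<lambda>_. 0) 0 ?t = finprod (gr m) ?f (insert j0 (?J - {j0}))"
    using j0 by (simp add: eigen_coeff_def insert_absorb)
  also have "\<dots> = ?f j0 \<otimes>\<^bsub>gr m\<^esub> R" unfolding R_def using f fin by (intro A.finprod_insert) auto
  finally have 1: "(?f j0 \<otimes>\<^bsub>gr m\<^esub> R) [^]\<^bsub>gr m\<^esub> p = \<one>\<^bsub>gr m\<^esub>" using eigen_coeff by metis
  let ?g = "\<lambda>d j. if (\<Sum>k\<le>m. d k * j k) mod p = 1 then ?f j else \<one>\<^bsub>gr m\<^esub>"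
  have g: "finprod (gr m) (\<lambda>d. ?g d j) ?J = (if j = j0 then \<one>\<^bsub>gr m\<^esub> else ?f j [^]\<^bsub>gr m\<^esub> (p ^ m))"
    if j: "j \<in> ?J" for j
  proof -
    let ?D = "{d \<in> ?J. (\<Sum>k\<le>m. d k * j k) mod p = 1}"
    have e: "finprod (gr m) (\<lambda>d. ?g d j) ?J = finprod (gr m) (\<lambda>_. ?f j) ?D"
      by (rule A.finprod_mono_neutral_cong_right[symmetric, THEN sym]) (use fin f in auto)
    show ?thesis
    proof (cases "j = j0")
      case True
      then have "?D = {}" by (auto simp: j0_def)
      then show ?thesis unfolding e using True by (simp only: A.finprod_empty simp_thms if_True)
    next
      case False
      then obtain k0 where "k0 \<in> {..m}" "j k0 \<noteq> j0 k0"
        using PiE_ext[OF j j0] by blast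
      then have "k0 \<le> m" "0 < j k0" "j k0 < p" using j by (auto simp: j0_def)
      then have "card ?D = p ^ m" by (rule card_PiE_linear_eq[OF prime])
      then show ?thesis unfolding e A.finprod_const[OF f] using False by simp
    qed
  qed
  have eigen_coeff_g: "eigen_coeff m X d 1 ?t = finprod (gr m) (?g d) ?J" for d
    unfolding eigen_coeff_def assgn_def
    by (rule A.finprod_mono_neutral_cong_left) (use fin f in auto)
  have "\<one>\<^bsub>gr m\<^esub> = finprod (gr m) (\<lambda>d. eigen_coeff m X d 1 ?t [^]\<^bsub>gr m\<^esub> p) ?J"
    using eigen_coeff by simp
  also have "\<dots> = finprod (gr m) (\<lambda>d. finprod (gr m) (?g d) ?J) ?J [^]\<^bsub>gr m\<^esub> p"
    unfolding eigen_coeff_g using f fin by (intro A.finprod_pow) auto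
  also have "finprod (gr m) (\<lambda>d. finprod (gr m) (?g d) ?J) ?J =
      finprod (gr m) (\<lambda>j. finprod (gr m) (\<lambda>d. ?g d j) ?J) ?J"
    using f fin by (intro A.finprod_swap) auto
  also have "\<dots> = finprod (gr m) (\<lambda>j. if j = j0 then \<one>\<^bsub>gr m\<^esub> else ?f j [^]\<^bsub>gr m\<^esub> (p ^ m)) ?J"
    using g f by (intro A.finprod_cong') auto
  also have "\<dots> = finprod (gr m) (\<lambda>j. ?f j [^]\<^bsub>gr m\<^esub> (p ^ m)) (?J - {j0})"
    by (rule A.finprod_mono_neutral_cong_right) (use fin f in auto)
  also have "\<dots> = R [^]\<^bsub>gr m\<^esub> (p ^ m)" unfolding R_def using fin f by (intro A.finprod_pow) auto
  finally have 2: "R [^]\<^bsub>gr m\<^esub> (p ^ Suc m) = \<one>\<^bsub>gr m\<^esub>"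
    using Rc by (simp add: A.nat_pow_pow mult.commute)
  have "(?f j0 \<otimes>\<^bsub>gr m\<^esub> R) [^]\<^bsub>gr m\<^esub> (p ^ Suc m) = ((?f j0 \<otimes>\<^bsub>gr m\<^esub> R) [^]\<^bsub>gr m\<^esub> p) [^]\<^bsub>gr m\<^esub> (p ^ m)"
    using f Rc by (simp add: A.nat_pow_pow)
  also have "\<dots> = \<one>\<^bsub>gr m\<^esub>" using 1 by simp
  finally have "?f j0 [^]\<^bsub>gr m\<^esub> (p ^ Suc m) = \<one>\<^bsub>gr m\<^esub>"
    using 2 f[of j0] Rc by (simp add: A.nat_pow_distrib)
  moreover have "evj X j0 ?t = ev X ?t"
    unfolding evj_def by (rule ev_cong) (auto simp: leaves_lntree j0_def)
  ultimately show ?thesis by simp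
qed

text \<open>The factor is abelian, so the elements whose class is killed by p^(m + 1) form a
  subgroup; it contains the next term and, by \<open>lntree_power\<close>, all left-normed
  commutators of this weight.\<close>

lemma lcs_section_exponent:
  assumes m: "m \<ge> (\<Sum>i<2 ^ (p - 1) - 1. (p - 1) ^ i)" and x: "x \<in> lcs G m"
  shows "x [^] (p ^ Suc m) \<in> lcs G (Suc m)"
proof -
  interpret A: comm_group "gr m" by (rule comm_group_gr)
  let ?Q = "{x \<in> lcs G m. gcl m x [^]\<^bsub>gr m\<^esub> (p ^ Suc m) = \<one>\<^bsub>gr m\<^esub>}"
  have "subgroup ?Q G"
  proof (rule subgroupI)
    show "?Q \<subseteq> carrier G" using lcs_carrier[of _ m] by blast
    have "\<one> \<in> ?Q" by (simp del: power_Suc)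
    then show "?Q \<noteq> {}" by blast
  next
    fix a assume "a \<in> ?Q"
    then show "inv a \<in> ?Q" by (simp add: lcs_inv gcl_inv A.nat_pow_inv del: power_Suc)
  next
    fix a b assume "a \<in> ?Q" "b \<in> ?Q"
    then show "a \<otimes> b \<in> ?Q" by (simp add: lcs_mult gcl_mult A.nat_pow_distrib del: power_Suc)
  qed
  moreover have "lcs G (Suc m) \<subseteq> ?Q"
  proof
    fix y assume y: "y \<in> lcs G (Suc m)"
    then have y': "y \<in> lcs G m" using lcs_Suc_subset[of m] by auto
    then have "gcl m y = \<one>\<^bsub>gr m\<^esub>" using y gcl_one_iff by simp
    then show "y \<in> ?Q" using y' by (simp del: power_Suc)
  qed
  moreover have "lnorm (carrier G) m \<subseteq> ?Q"
  proof
    fix y assume y: "y \<in> lnorm (carrier G) m"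
    then obtain X where X: "\<forall>k. X k \<in> carrier G" "y = ev X (lntree m)" using lnorm_ev by blast
    have "y \<in> lcs G m" using lnorm_lcs[OF order_refl, of m] y by auto
    then show "y \<in> ?Q" using lntree_power[OF _ m, of X] X by blast
  qed
  moreover have "generate G (carrier G) = carrier G"
    by (rule equalityI[OF generate_incl[OF order_refl]]) (auto intro: generate.incl)
  ultimately have "lcs G m \<subseteq> ?Q" by (rule lcs_subset_of_lnorm'[OF order_refl, rotated])
  then have "gcl m x [^]\<^bsub>gr m\<^esub> (p ^ Suc m) = \<one>\<^bsub>gr m\<^esub>" using x by blast
  then show ?thesis using gcl_one_iff[OF lcs_pow[OF x]] gcl_pow[OF x] by metis
qed

text \<open>Each factor from \<open>c\<close> on contributes a further power of \<open>p\<close>,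
  and nilpotency ends the descent.\<close>

lemma lcs_exponent:
  assumes c: "c \<ge> (\<Sum>i<2 ^ (p - 1) - 1. (p - 1) ^ i)" and nil: "lcs G C = {\<one>}"
  shows "\<exists>n. \<forall>x \<in> lcs G c. x [^] (p ^ n) = \<one>"
proof -
  have "\<exists>n. \<forall>x \<in> lcs G c. x [^] (p ^ n) \<in> lcs G (c + i)" for i
  proof (induction i)
    case 0
    show ?case by (rule exI[of _ 0]) (simp add: lcs_carrier[of _ c])
  next
    case (Suc i)
    then obtain n where n: "\<forall>x \<in> lcs G c. x [^] (p ^ n) \<in> lcs G (c + i)" by blast
    have "x [^] (p ^ (n + Suc (c + i))) \<in> lcs G (c + Suc i)" if "x \<in> lcs G c" for x
    proof -
      have "(x [^] (p ^ n)) [^] (p ^ Suc (c + i)) \<in> lcs G (Suc (c + i))"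
        using n that c by (intro lcs_section_exponent) auto
      then show ?thesis using lcs_carrier[OF that] by (simp add: nat_pow_pow power_add ac_simps)
    qed
    then show ?case by blast
  qed
  then obtain n where "\<forall>x \<in> lcs G c. x [^] (p ^ n) \<in> lcs G (c + C)" by blast
  then show ?thesis using lcs_antimono[of C "c + C"] nil by auto
qed

end

section \<open>Finite quotients of finitely generated nilpotent groups\<close>

text \<open>The least positive integer in any member generates all later ones, since division with
  remainder would otherwise produce a smaller one; the chain is constant from a member containing
  it.\<close>

lemma int_chain_stabilizes:
  fixes E :: "nat \<Rightarrow> int set"
  assumes zero: "\<And>j. 0 \<in> E j" and diff: "\<And>j a b. a \<in> E j \<Longrightarrow> b \<in> E j \<Longrightarrow> a - b \<in> E j"
    and chain: "\<And>j. E j \<subseteq> E (Suc j)"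
  shows "\<exists>j0. \<forall>j \<ge> j0. E j = E j0"
proof (cases "\<exists>j. \<exists>e \<in> E j. e \<noteq> 0")
  case False
  then have "E j = {0}" for j using zero by blast
  then show ?thesis by simp
next
  case True
  have mono: "i \<le> j \<Longrightarrow> E i \<subseteq> E j" for i j using lift_Suc_mono_le[of E, OF chain] by blast
  have neg: "a \<in> E j \<Longrightarrow> - a \<in> E j" for a j using diff[OF zero] by force
  have add: "a \<in> E j \<Longrightarrow> b \<in> E j \<Longrightarrow> a + b \<in> E j" for a b j using diff[of a j "- b"] neg by simp
  have natmult: "a \<in> E j \<Longrightarrow> int n * a \<in> E j" for a j n
    by (induction n) (auto simp: zero add distrib_right)
  have mult: "q * a \<in> E j" if "a \<in> E j" for a j q
    using natmult[OF that, of "nat q"] neg[OF natmult[OF that, of "nat (- q)"]] by (cases "q \<ge> 0") auto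
  let ?P = "\<lambda>d::nat. d > 0 \<and> (\<exists>j. int d \<in> E j)"
  obtain j e where je: "e \<in> E j" "e \<noteq> 0" using True by blast
  have "?P (nat \<bar>e\<bar>)" using je neg by (auto simp: abs_if intro!: exI[of _ j])
  then have P: "?P (LEAST d. ?P d)" by (rule LeastI)
  define d where "d = (LEAST d. ?P d)"
  obtain j0 where j0: "int d \<in> E j0" "d > 0" using P d_def by auto
  have "E j \<subseteq> E j0" if "j \<ge> j0" for j
  proof
    fix e assume e: "e \<in> E j"
    have "e mod int d = e - (e div int d) * int d" by (simp add: minus_div_mult_eq_mod)
    also have "\<dots> \<in> E j" using e j0 mono[OF that] by (intro diff mult) auto
    finally have m: "e mod int d \<in> E j" .
    have "e mod int d = 0"
    proof (rule ccontr)
      assume nz: "e mod int d \<noteq> 0"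
      have b: "0 \<le> e mod int d" "e mod int d < int d" using j0 by auto
      then have "?P (nat (e mod int d))" using m nz by auto
      then have "d \<le> nat (e mod int d)" unfolding d_def by (rule Least_le)
      then show False using b by simp
    qed
    then have "e = (e div int d) * int d" by (metis add.right_neutral div_mult_mod_eq)
    then show "e \<in> E j0" using mult[OF j0(1)] by metis
  qed
  then show ?thesis using mono by blast
qed

section \<open>Polycyclic series, ascending chains and finite p-quotients\<close>

context group
begin

definition cyc_ext :: "'a set \<Rightarrow> 'a \<Rightarrow> 'a set" where
  "cyc_ext H x = {h \<otimes> x [^] (i::int) |h i. h \<in> H}"

text \<open>Each term that gets extended is normal in all of \<open>G\<close>; the lower central
  series provides this, and it makes \<open>cyc_ext H x\<close> a subgroup.\<close>

inductive polycyclic :: "'a set \<Rightarrow> bool" where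
  "polycyclic {\<one>}"
| "polycyclic H \<Longrightarrow> H \<lhd> G \<Longrightarrow> x \<in> carrier G \<Longrightarrow> polycyclic (cyc_ext H x)"

lemma cyc_ext_mult:
  assumes "H \<lhd> G" "x \<in> carrier G" "h \<in> H" "h' \<in> H"
  shows "\<exists>h''\<in>H. (h \<otimes> x [^] (i::int)) \<otimes> inv (h' \<otimes> x [^] (j::int)) = h'' \<otimes> x [^] (i - j)"
proof -
  interpret H: normal H G by fact
  have c: "h \<in> carrier G" "h' \<in> carrier G" using assms by auto
  let ?y = "x [^] (i - j)"
  have "(h \<otimes> x [^] i) \<otimes> inv (h' \<otimes> x [^] j) = h \<otimes> ((x [^] i \<otimes> inv (x [^] j)) \<otimes> inv h')"
    using c assms by (simp add: m_assoc inv_mult_group)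
  also have "x [^] i \<otimes> inv (x [^] j) = ?y" using assms by (simp add: int_pow_diff)
  also have "h \<otimes> (?y \<otimes> inv h') = (h \<otimes> (?y \<otimes> inv h' \<otimes> inv ?y)) \<otimes> ?y"
    using c assms by (simp add: m_assoc)
  finally show ?thesis using assms H.inv_op_closed2[of ?y "inv h'"] by blast
qed

lemma cyc_ext_subgroup:
  assumes "H \<lhd> G" "x \<in> carrier G"
  shows "subgroup (cyc_ext H x) G"
proof -
  interpret H: normal H G by fact
  have one: "\<one> \<in> cyc_ext H x" unfolding cyc_ext_def
    by (rule CollectI) (rule exI[of _ \<one>], rule exI[of _ 0], simp)
  have div: "a \<otimes> inv b \<in> cyc_ext H x" if "a \<in> cyc_ext H x" "b \<in> cyc_ext H x" for a b
    using that cyc_ext_mult[OF assms] unfolding cyc_ext_def by blast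
  have sub: "cyc_ext H x \<subseteq> carrier G" using assms by (auto simp: cyc_ext_def)
  have inv: "inv b \<in> cyc_ext H x" if "b \<in> cyc_ext H x" for b
    using div[OF one that] that sub by auto
  show ?thesis
  proof (rule subgroupI)
    show "a \<otimes> b \<in> cyc_ext H x" if "a \<in> cyc_ext H x" "b \<in> cyc_ext H x" for a b
      using div[OF that(1) inv[OF that(2)]] that sub by auto
  qed (use one inv sub in auto)
qed

lemma cyc_ext_incl:
  assumes "H \<lhd> G" "x \<in> carrier G"
  shows "H \<subseteq> cyc_ext H x" "x \<in> cyc_ext H x"
proof -
  interpret H: normal H G by fact
  show "H \<subseteq> cyc_ext H x"
  proof
    fix h assume "h \<in> H"
    then show "h \<in> cyc_ext H x" unfolding cyc_ext_def
      by (intro CollectI exI[of _ h] exI[of _ "0::int"]) simp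
  qed
  show "x \<in> cyc_ext H x" unfolding cyc_ext_def using assms
    by (intro CollectI exI[of _ \<one>] exI[of _ "1::int"]) (simp add: int_pow_1)
qed

text \<open>Two comparable subgroups agree once they have the same intersection with
  \<open>H\<close> and the same exponents of \<open>x\<close> modulo \<open>H\<close>. The
  intersections stabilise by induction, the exponents as subgroups of the integers.\<close>

lemma polycyclic_chain_stabilizes:
  assumes "polycyclic H" "\<And>j. subgroup (K j) G" "\<And>j. K j \<subseteq> K (Suc j)" "\<And>j. K j \<subseteq> H"
  shows "\<exists>j0. \<forall>j \<ge> j0. K j = K j0"
  using assms
proof (induction arbitrary: K rule: polycyclic.induct)
  case 1
  then have "K j = {\<one>}" for j using subgroup.one_closed by fastforce
  then show ?case by simp
next
  case (2 H x)
  interpret H: normal H G by fact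
  have mono: "i \<le> j \<Longrightarrow> K i \<subseteq> K j" for i j using lift_Suc_mono_le[of K, OF 2(6)] by blast
  have "\<exists>j0. \<forall>j \<ge> j0. K j \<inter> H = K j0 \<inter> H"
  proof (rule "2.IH")
    show "subgroup (K j \<inter> H) G" for j using 2(5) H.subgroup_axioms subgroups_Inter_pair by blast
  qed (use 2(6) in auto)
  then obtain j1 where j1: "\<And>j. j \<ge> j1 \<Longrightarrow> K j \<inter> H = K j1 \<inter> H" by blast
  define E where "E j = {i::int. \<exists>h\<in>H. h \<otimes> x [^] i \<in> K j}" for j
  have "\<exists>j0. \<forall>j \<ge> j0. E j = E j0"
  proof (rule int_chain_stabilizes)
    show "0 \<in> E j" for j unfolding E_def
      using subgroup.one_closed[OF 2(5)[of j]] by (auto intro!: bexI[of _ \<one>])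
    show "a - b \<in> E j" if ab: "a \<in> E j" "b \<in> E j" for a b j
    proof -
      obtain h h' where h: "h \<in> H" "h \<otimes> x [^] a \<in> K j" "h' \<in> H" "h' \<otimes> x [^] b \<in> K j"
        using ab unfolding E_def by blast
      then obtain h'' where "h'' \<in> H" "(h \<otimes> x [^] a) \<otimes> inv (h' \<otimes> x [^] b) = h'' \<otimes> x [^] (a - b)"
        using cyc_ext_mult[OF 2(2,3) h(1,3)] by blast
      moreover have "(h \<otimes> x [^] a) \<otimes> inv (h' \<otimes> x [^] b) \<in> K j"
        using subgroup.m_closed[OF 2(5)[of j] h(2) subgroup.m_inv_closed[OF 2(5)[of j] h(4)]] .
      ultimately show ?thesis unfolding E_def by auto
    qed
    show "E j \<subseteq> E (Suc j)" for j using 2(6)[of j] unfolding E_def by blast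
  qed
  then obtain j2 where j2: "\<And>j. j \<ge> j2 \<Longrightarrow> E j = E j2" by blast
  let ?m = "max j1 j2"
  have "K j \<subseteq> K ?m" if j: "j \<ge> ?m" for j
  proof
    fix k assume k: "k \<in> K j"
    then obtain h i where hi: "k = h \<otimes> x [^] (i::int)" "h \<in> H" using 2(7)[of j] unfolding cyc_ext_def by blast
    then have "i \<in> E j" using k unfolding E_def by blast
    then have "i \<in> E ?m" using j2[of j] j2[of ?m] j by simp
    then obtain h' where h': "h' \<in> H" "h' \<otimes> x [^] i \<in> K ?m" unfolding E_def by blast
    let ?k' = "h' \<otimes> x [^] i"
    have c: "h \<in> carrier G" "h' \<in> carrier G" using hi h' by auto
    have k': "?k' \<in> K j" using h' mono[OF j] by auto
    \<comment> \<open>The two elements share the exponent of \<open>x\<close>, so their quotient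
      lies in \<open>H\<close>, where the chain is already constant.\<close>
    have e: "k \<otimes> inv ?k' = h \<otimes> inv h'" using hi c 2(3) by (simp add: m_assoc inv_mult_group)
    have "k \<otimes> inv ?k' \<in> K j" using subgroup.m_closed[OF 2(5)[of j] k subgroup.m_inv_closed[OF 2(5)[of j] k']] .
    then have "k \<otimes> inv ?k' \<in> K j \<inter> H" unfolding e using hi(2) h'(1) by simp
    then have "k \<otimes> inv ?k' \<in> K ?m" using j1[of j] j1[of ?m] j by auto
    then have "(k \<otimes> inv ?k') \<otimes> ?k' \<in> K ?m" using subgroup.m_closed[OF 2(5)[of ?m]] h'(2) by blast
    moreover have "(k \<otimes> inv ?k') \<otimes> ?k' = k" using hi(1) c 2(3) by (simp add: m_assoc)
    ultimately show "k \<in> K ?m" by simp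
  qed
  then show ?case using mono by blast
qed

text \<open>Representatives are built along the series: as x^q lies in \<open>N\<close>, exponents
  of \<open>x\<close> below \<open>q\<close> suffice at each step.\<close>

lemma polycyclic_finite_index:
  assumes "polycyclic H" and N: "N \<lhd> G" and q: "q > 0" "\<And>x. x \<in> carrier G \<Longrightarrow> x [^] (q::nat) \<in> N"
  shows "\<exists>F. finite F \<and> F \<subseteq> carrier G \<and> (\<forall>h\<in>H. \<exists>f\<in>F. N #> h = N #> f)"
  using assms(1)
proof (induction rule: polycyclic.induct)
  case 1
  show ?case by (rule exI[of _ "{\<one>}"]) auto
next
  case (2 H x)
  interpret N: normal N G by fact
  interpret Q: group "G Mod N" by (rule N.factorgroup_is_group)
  obtain F where F: "finite F" "F \<subseteq> carrier G" "\<forall>h\<in>H. \<exists>f\<in>F. N #> h = N #> f" using 2 by blast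
  have x: "x \<in> carrier G" by fact
  let ?F = "(\<lambda>(f, r). f \<otimes> x [^] (r::nat)) ` (F \<times> {..<q})"
  have "\<exists>f\<in>?F. N #> k = N #> f" if kx: "k \<in> cyc_ext H x" for k
  proof -
    obtain h i where k: "k = h \<otimes> x [^] (i::int)" "h \<in> H" using kx unfolding cyc_ext_def by blast
    obtain f where f: "f \<in> F" "N #> h = N #> f" using F k by blast
    have c: "h \<in> carrier G" "f \<in> carrier G" using subgroup.mem_carrier[OF normal_imp_subgroup[OF 2(2)] k(2)] f F by auto
    define r where "r = nat (i mod int q)"
    have r: "r < q" "int r = i mod int q" using q(1) by (auto simp: r_def nat_less_iff)
    have "x [^] i = x [^] (int q * (i div int q) + int r)" using r by simp
    also have "\<dots> = (x [^] q) [^] (i div int q) \<otimes> x [^] r"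
      using x int_pow_pow[OF x, of "int q" "i div int q"] by (simp add: int_pow_mult int_pow_int mult.commute)
    finally have xi: "x [^] i = (x [^] q) [^] (i div int q) \<otimes> x [^] r" .
    have "(x [^] q) [^] (i div int q) \<in> N" using subgroup_int_pow_closed[OF N.subgroup_axioms q(2)[OF x]] .
    then have "N #> x [^] i = N #> x [^] r"
      unfolding xi using coset_mult_assoc[OF N.subset, of "(x [^] q) [^] (i div int q)" "x [^] r"] x
      by (simp add: N.rcos_const[OF is_group])
    then have "N #> k = N #> (f \<otimes> x [^] r)"
      unfolding k(1) using c x f(2) by (simp flip: N.rcos_sum)
    then show ?thesis using f(1) r(1) by auto
  qed
  moreover have "finite ?F" "?F \<subseteq> carrier G" using F x by auto
  ultimately show ?case by blast
qed

lemma polycyclic_between_lcs: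
  assumes "polycyclic (lcs G (Suc i))"
  shows "finite T \<Longrightarrow> T \<subseteq> lcs G i \<Longrightarrow>
    \<exists>H. polycyclic H \<and> subgroup H G \<and> lcs G (Suc i) \<subseteq> H \<and> H \<subseteq> lcs G i \<and> T \<subseteq> H"
proof (induction T rule: finite_induct)
  case empty
  show ?case using assms lcs_subgroup[of "Suc i"] lcs_Suc_subset[of i] by (intro exI[of _ "lcs G (Suc i)"]) auto
next
  case (insert x T)
  then obtain H where H: "polycyclic H" "subgroup H G" "lcs G (Suc i) \<subseteq> H" "H \<subseteq> lcs G i" "T \<subseteq> H" by auto
  have n: "H \<lhd> G" by (rule normal_between_lcs[OF H(2-4)])
  have x: "x \<in> lcs G i" "x \<in> carrier G" using insert lcs_carrier[of x i] by auto
  have "h \<otimes> x [^] (j::int) \<in> lcs G i" if "h \<in> H" for h j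
    using H(4) that subgroup_int_pow_closed[OF lcs_subgroup x(1)] by (intro lcs_mult) auto
  then have "cyc_ext H x \<subseteq> lcs G i" by (auto simp: cyc_ext_def)
  then show ?case
    using polycyclic.intros(2)[OF H(1) n x(2)] cyc_ext_subgroup[OF n x(2)] cyc_ext_incl[OF n x(2)] H
    by (intro exI[of _ "cyc_ext H x"]) auto
qed

text \<open>Going up from the trivial term, each factor is generated by finitely many left-normed
  commutators in \<open>S\<close>, which are adjoined one at a time.\<close>

lemma polycyclic_nilpotent:
  assumes S: "finite S" "S \<subseteq> carrier G" "generate G S = carrier G" and nil: "lcs G C = {\<one>}"
  shows "polycyclic (carrier G)"
proof -
  have "polycyclic (lcs G (C - i))" for i
  proof (induction i)
    case 0
    show ?case using nil polycyclic.intros(1) by simp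
  next
    case (Suc i)
    show ?case
    proof (cases "i < C")
      case True
      let ?j = "C - Suc i"
      have j: "Suc ?j = C - i" using True by simp
      have "polycyclic (lcs G (Suc ?j))" unfolding j by (rule Suc)
      then obtain H where H: "polycyclic H" "subgroup H G" "lcs G (Suc ?j) \<subseteq> H" "H \<subseteq> lcs G ?j"
          "lnorm S ?j \<subseteq> H"
        using polycyclic_between_lcs[OF _ finite_lnorm[OF S(1)] lnorm_lcs[OF S(2)]] by blast
      have "lcs G ?j \<subseteq> H" by (rule lcs_subset_of_lnorm'[OF S(2,3) H(2,3,5)])
      then have "H = lcs G ?j" using H by blast
      then show ?thesis using H by simp
    next
      case False
      then show ?thesis using Suc by simp
    qed
  qed
  from this[of C] show ?thesis by simp
qed

text \<open>Preimages of the upper central series of the quotient by \<open>N\<close>.\<close>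

fun ucs :: "'a set \<Rightarrow> nat \<Rightarrow> 'a set" where
  "ucs N 0 = N"
| "ucs N (Suc i) = {x \<in> carrier G. \<forall>g \<in> carrier G. cm x g \<in> ucs N i}"

lemma ucs_normal: "N \<lhd> G \<Longrightarrow> ucs N i \<lhd> G"
  by (induction i) (auto intro: central_mod_normal)

lemma lcs_ucs:
  assumes "N \<lhd> G" "lcs G C = {\<one>}"
  shows "i \<le> C \<Longrightarrow> lcs G (C - i) \<subseteq> ucs N i"
proof (induction i)
  case 0
  show ?case using assms subgroup.one_closed[OF normal_imp_subgroup] by simp
next
  case (Suc i)
  have e: "Suc (C - Suc i) = C - i" using Suc.prems by simp
  have "cm x g \<in> ucs N i" if "x \<in> lcs G (C - Suc i)" "g \<in> carrier G" for x g
    using lcs_cm_carrier[OF that] Suc unfolding e by auto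
  then show ?case using lcs_carrier[of _ "C - Suc i"] by auto
qed

text \<open>As [x, g] is central modulo \<open>N\<close>, commutation with \<open>g\<close> is
  multiplicative on powers of \<open>x\<close> modulo \<open>N\<close>.\<close>

lemma cm_pow_left:
  assumes n: "N \<lhd> G" and x: "x \<in> carrier G" "g \<in> carrier G" "cm x g \<in> ucs N (Suc 0)"
  shows "\<exists>u\<in>N. cm (x [^] (k::nat)) g = u \<otimes> cm x g [^] k"
proof (induction k)
  interpret N: normal N G by fact
  case 0
  show ?case using x by (intro bexI[of _ \<one>]) auto
next
  interpret N: normal N G by fact
  case (Suc k)
  then obtain u where u: "u \<in> N" "cm (x [^] k) g = u \<otimes> cm x g [^] k" by blast
  let ?c = "cm x g" and ?v = "cm (x [^] k) (cm x g)"
  have uc: "u \<in> carrier G" using u by auto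
  have c: "?c \<in> carrier G" using x by simp
  have "cm ?c (x [^] k) \<in> N" using x(1,3) by simp
  then have v: "?v \<in> N" using inv_cm[OF c, of "x [^] k"] x(1) by (metis N.m_inv_closed nat_pow_closed)
  have "cm (x [^] Suc k) g = ?v \<otimes> ?c \<otimes> cm (x [^] k) g"
    using x(1,2) by (simp add: word_simps)
  also have "\<dots> = ?v \<otimes> ((?c \<otimes> u \<otimes> inv ?c) \<otimes> (?c \<otimes> ?c [^] k))"
    unfolding u(2) using c uc x by (simp add: m_assoc)
  also have "?c \<otimes> ?c [^] k = ?c [^] Suc k" using c by (metis nat_pow_Suc2)
  finally have "cm (x [^] Suc k) g = (?v \<otimes> (?c \<otimes> u \<otimes> inv ?c)) \<otimes> ?c [^] Suc k"
    using c uc x by (simp add: m_assoc)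
  moreover have "?v \<otimes> (?c \<otimes> u \<otimes> inv ?c) \<in> N" using v N.inv_op_closed2[OF c u(1)] by simp
  ultimately show ?case by blast
qed

text \<open>Commutation with \<open>g\<close> leads one step down the series and respects q-th
  powers modulo a lower term, so an exponent of the centre is one of every higher factor.\<close>

lemma ucs_exponent_step:
  assumes n: "N \<lhd> G" and q: "\<And>x. x \<in> ucs N (Suc 0) \<Longrightarrow> x [^] (q::nat) \<in> N"
  shows "x \<in> ucs N (Suc i) \<Longrightarrow> x [^] q \<in> ucs N i"
proof (induction i arbitrary: x)
  case 0
  then show ?case using q by simp
next
  case (Suc i)
  have x: "x \<in> carrier G" using Suc.prems by simp
  have "cm (x [^] q) g \<in> ucs N i" if g: "g \<in> carrier G" for g
  proof -
    have c: "cm x g \<in> ucs N (Suc i)" using Suc.prems g by simp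
    then have "cm x g \<in> ucs (ucs N i) (Suc 0)" by simp
    then obtain u where "u \<in> ucs N i" "cm (x [^] q) g = u \<otimes> cm x g [^] q"
      using cm_pow_left[OF ucs_normal[OF n] x g] by blast
    then show ?thesis
      using Suc.IH[OF c] subgroup.m_closed[OF normal_imp_subgroup[OF ucs_normal[OF n]]] by simp
  qed
  then show ?case using x by simp
qed

lemma exponent_mod_normal:
  assumes n: "N \<lhd> G" and nil: "lcs G C = {\<one>}"
    and q: "\<And>x. x \<in> ucs N (Suc 0) \<Longrightarrow> x [^] (q::nat) \<in> N" and x: "x \<in> carrier G"
  shows "x [^] (q ^ C) \<in> N"
proof -
  have "x [^] (q ^ i) \<in> ucs N (C - i)" if "i \<le> C" for i
    using that
  proof (induction i)
    case 0
    then show ?case using lcs_ucs[OF n nil, of C] x by auto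
  next
    case (Suc i)
    then have "x [^] (q ^ i) \<in> ucs N (Suc (C - Suc i))" by (simp add: Suc_diff_Suc del: ucs.simps)
    then have "(x [^] (q ^ i)) [^] q \<in> ucs N (C - Suc i)" by (rule ucs_exponent_step[OF n, rotated]) (rule q)
    then show ?case using x by (simp add: nat_pow_pow mult.commute)
  qed
  from this[of C] show ?thesis by simp
qed

text \<open>The normal subgroup is maximal among the \<open>\<beta>\<close>-invariant ones avoiding \<open>z\<close>; then by the
ascending chain condition the centre of the quotient has exponent a power of \<open>p\<close>.\<close>

lemma finite_p_quotient_avoiding:
  assumes S: "finite S" "S \<subseteq> carrier G" "generate G S = carrier G" and nil: "lcs G C = {\<one>}"
    and \<beta>: "\<beta> \<in> hom G G" "\<beta> ` carrier G = carrier G"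
    and z: "z \<in> carrier G" "z \<noteq> \<one>" "z [^] (p ^ n :: nat) = \<one>" and p: "p > 0"
  obtains N e where "N \<lhd> G" "\<beta> ` N \<subseteq> N" "z \<notin> N" "finite (carrier (G Mod N))"
    "\<forall>x \<in> carrier G. x [^] (p ^ e :: nat) \<in> N"
proof -
  interpret b: group_hom G G \<beta> using \<beta> by unfold_locales
  let ?A = "{N. N \<lhd> G \<and> \<beta> ` N \<subseteq> N \<and> z \<notin> N}"
  have "\<exists>M\<in>?A. \<forall>X\<in>?A. M \<subseteq> X \<longrightarrow> X = M"
  proof (rule subset_Zorn_nonempty)
    have "{\<one>} \<in> ?A" using z one_is_normal by auto
    then show "?A \<noteq> {}" by blast
  next
    fix \<C> assume ne: "\<C> \<noteq> {}" and ch: "subset.chain ?A \<C>"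
    have mem: "X \<lhd> G" "\<beta> ` X \<subseteq> X" "z \<notin> X" if "X \<in> \<C>" for X
      using ch that by (auto simp: subset.chain_def)
    have sg: "subgroup X G" if "X \<in> \<C>" for X using normal_imp_subgroup[OF mem(1)[OF that]] .
    have "subgroup (\<Union>\<C>) G"
    proof (rule subgroupI)
      show "\<Union>\<C> \<subseteq> carrier G" using subgroup.subset[OF sg] by blast
      show "\<Union>\<C> \<noteq> {}" using ne subgroup.one_closed[OF sg] by blast
      show "inv a \<in> \<Union>\<C>" if "a \<in> \<Union>\<C>" for a using that subgroup.m_inv_closed[OF sg] by blast
      show "a \<otimes> b \<in> \<Union>\<C>" if ab: "a \<in> \<Union>\<C>" "b \<in> \<Union>\<C>" for a b
      proof -
        obtain X Y where XY: "X \<in> \<C>" "Y \<in> \<C>" "a \<in> X" "b \<in> Y" using ab by blast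
        then have "X \<subseteq> Y \<or> Y \<subseteq> X" using ch by (auto simp: subset.chain_def)
        then show ?thesis using XY subgroup.m_closed[OF sg[OF XY(1)]] subgroup.m_closed[OF sg[OF XY(2)]] by blast
      qed
    qed
    then have "\<Union>\<C> \<lhd> G"
      by (rule normal_invI) (use normal.inv_op_closed2[OF mem(1)] in blast)
    then show "\<Union>\<C> \<in> ?A" using mem by blast
  qed
  then obtain N where "N \<in> ?A" and N': "\<forall>X\<in>?A. N \<subseteq> X \<longrightarrow> X = N" by (rule bexE)
  then have N: "N \<lhd> G" "\<beta> ` N \<subseteq> N" "z \<notin> N" by auto
  have max: "X = N" if "X \<lhd> G" "\<beta> ` X \<subseteq> X" "z \<notin> X" "N \<subseteq> X" for X
    using N' that by simp
  interpret N: normal N G by fact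
  interpret Q: group "G Mod N" by (rule N.factorgroup_is_group)
  let ?\<pi> = "\<lambda>x. N #> x"
  have \<pi>c: "?\<pi> x \<in> carrier (G Mod N)" if "x \<in> carrier G" for x
    using that by (auto simp: carrier_FactGroup)
  have \<pi>m: "?\<pi> (x \<otimes> y) = ?\<pi> x \<otimes>\<^bsub>G Mod N\<^esub> ?\<pi> y" if "x \<in> carrier G" "y \<in> carrier G" for x y
    using that N.rcos_sum by simp
  have \<pi>1: "?\<pi> x = \<one>\<^bsub>G Mod N\<^esub> \<longleftrightarrow> x \<in> N" if "x \<in> carrier G" for x
    using that rcos_self[OF that N.subgroup_axioms] by (auto simp: N.rcos_const is_group)
  have \<pi>p: "?\<pi> (x [^] k) = ?\<pi> x [^]\<^bsub>G Mod N\<^esub> k" if "x \<in> carrier G" for x and k :: nat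
    using N.FactGroup_pow[OF that] by simp
  note [simp del] = mult_FactGroup one_FactGroup
  let ?Z = "ucs N (Suc 0)"
  have Zc: "a \<in> carrier G" if "a \<in> ?Z" for a using that by simp
  have comm: "?\<pi> a \<otimes>\<^bsub>G Mod N\<^esub> ?\<pi> g = ?\<pi> g \<otimes>\<^bsub>G Mod N\<^esub> ?\<pi> a" if "a \<in> ?Z" "g \<in> carrier G" for a g
  proof -
    have "a \<otimes> g = cm a g \<otimes> (g \<otimes> a)" using that by (simp add: word_simps)
    then have "?\<pi> (a \<otimes> g) = ?\<pi> (cm a g) \<otimes>\<^bsub>G Mod N\<^esub> ?\<pi> (g \<otimes> a)" using that \<pi>m by simp
    moreover have "?\<pi> (cm a g) = \<one>\<^bsub>G Mod N\<^esub>" using that \<pi>1[of "cm a g"] by simp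
    ultimately show ?thesis using that \<pi>m[of a g] \<pi>m[of g a] \<pi>c[of "g \<otimes> a"] by simp
  qed
  have Zs: "subgroup ?Z G" using normal_imp_subgroup[OF ucs_normal[OF N(1)]] .
  have Zpow: "?\<pi> ((a \<otimes> b) [^] k) = ?\<pi> (a [^] k) \<otimes>\<^bsub>G Mod N\<^esub> ?\<pi> (b [^] k)"
    if "a \<in> ?Z" "b \<in> ?Z" for a b and k :: nat
  proof -
    note c = Zc[OF that(1)] Zc[OF that(2)]
    show ?thesis unfolding \<pi>p[OF m_closed[OF c]] \<pi>m[OF c] \<pi>p[OF c(1)] \<pi>p[OF c(2)]
      by (rule Q.pow_mult_distrib[OF comm[OF that(1) c(2)] \<pi>c[OF c(1)] \<pi>c[OF c(2)]])
  qed
  \<comment> \<open>The elements of the centre of the quotient killed by p^j; this chain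
    stabilises.\<close>
  define K where "K j = {x \<in> ?Z. x [^] (p ^ j) \<in> N}" for j
  have K: "subgroup (K j) G" for j
  proof (rule subgroupI)
    show "K j \<subseteq> carrier G" using Zc K_def by blast
    have "\<one> \<in> K j" using subgroup.one_closed[OF Zs] by (simp add: K_def)
    then show "K j \<noteq> {}" by blast
    show "inv a \<in> K j" if "a \<in> K j" for a
      using that subgroup.m_inv_closed[OF Zs, of a] Zc[of a] by (auto simp: K_def nat_pow_inv simp del: ucs.simps)
    show "a \<otimes> b \<in> K j" if "a \<in> K j" "b \<in> K j" for a b
    proof -
      have ab: "a \<in> ?Z" "b \<in> ?Z" "a [^] (p ^ j) \<in> N" "b [^] (p ^ j) \<in> N" using that by (auto simp: K_def)
      note c = Zc[OF ab(1)] Zc[OF ab(2)]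
      have "?\<pi> (a [^] (p ^ j)) = \<one>\<^bsub>G Mod N\<^esub>" "?\<pi> (b [^] (p ^ j)) = \<one>\<^bsub>G Mod N\<^esub>"
        using ab(3,4) \<pi>1[OF nat_pow_closed[OF c(1)]] \<pi>1[OF nat_pow_closed[OF c(2)]] by simp_all
      then have "?\<pi> ((a \<otimes> b) [^] (p ^ j)) = \<one>\<^bsub>G Mod N\<^esub>"
        unfolding Zpow[OF ab(1,2)] by simp
      then have "(a \<otimes> b) [^] (p ^ j) \<in> N" using \<pi>1[OF nat_pow_closed[OF m_closed[OF c]]] by simp
      then show ?thesis using subgroup.m_closed[OF Zs ab(1,2)] by (simp add: K_def del: ucs.simps)
    qed
  qed
  have Kpow: "x [^] (p ^ (j + i)) \<in> N" if "x \<in> carrier G" "x [^] (p ^ j) \<in> N" for x j i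
  proof -
    have "y [^] k \<in> N" if "y \<in> N" for y and k :: nat
      using that by (induction k) auto
    then have "(x [^] (p ^ j)) [^] (p ^ i) \<in> N" using that(2) .
    then show ?thesis using that(1) by (simp add: nat_pow_pow power_add)
  qed
  have Kmono: "K j \<subseteq> K (Suc j)" for j 
  proof
    fix x assume "x \<in> K j"
    then have x: "x \<in> ?Z" "x [^] (p ^ j) \<in> N" unfolding K_def by blast+
    have "x [^] (p ^ Suc j) \<in> N" using Kpow[OF Zc[OF x(1)] x(2), of 1] by (simp only: Suc_eq_plus1)
    then show "x \<in> K (Suc j)" using x(1) unfolding K_def by blast
  qed
  have "\<exists>j0. \<forall>j \<ge> j0. K j = K j0"
    by (rule polycyclic_chain_stabilizes[where K = K, OF polycyclic_nilpotent[OF S nil] K Kmono])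
      (rule subgroup.subset[OF K])
  then obtain j where j: "\<And>j'. j' \<ge> j \<Longrightarrow> K j' = K j" by blast
  \<comment> \<open>This is N Z^(p^j), with Z the preimage of the centre. If it contained
    \<open>z\<close>, then z = a^(p^j) modulo \<open>N\<close> with a in Z; as \<open>z\<close> has
    p-power order, a lies in some term of \<open>K\<close>, hence in \<open>K j\<close>, and
    \<open>z\<close> would lie in \<open>N\<close>. So maximality forces \<open>?B = N\<close>,
    which says that Z has exponent p^j modulo \<open>N\<close>.\<close>
  let ?B = "{u \<otimes> a [^] (p ^ j) |u a. u \<in> N \<and> a \<in> ?Z}"
  have \<pi>B: "?\<pi> (u \<otimes> y) = ?\<pi> y" if "u \<in> N" "y \<in> carrier G" for u y
    using \<pi>m[of u y] \<pi>1[of u] that \<pi>c by simp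
  have B_iff: "b \<in> ?B \<longleftrightarrow> b \<in> carrier G \<and> (\<exists>a\<in>?Z. ?\<pi> b = ?\<pi> (a [^] (p ^ j)))" for b
  proof
    assume "b \<in> ?B"
    then obtain u a where ua: "b = u \<otimes> a [^] (p ^ j)" "u \<in> N" "a \<in> ?Z" by blast
    note ac = nat_pow_closed[OF Zc[OF ua(3)], of "p ^ j"]
    have "b \<in> carrier G" unfolding ua(1) using N.mem_carrier[OF ua(2)] ac by (rule m_closed)
    moreover have "?\<pi> b = ?\<pi> (a [^] (p ^ j))" unfolding ua(1) by (rule \<pi>B[OF ua(2) ac])
    ultimately show "b \<in> carrier G \<and> (\<exists>a\<in>?Z. ?\<pi> b = ?\<pi> (a [^] (p ^ j)))" using ua(3) by blast
  next
    assume "b \<in> carrier G \<and> (\<exists>a\<in>?Z. ?\<pi> b = ?\<pi> (a [^] (p ^ j)))"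
    then obtain a where a: "b \<in> carrier G" "a \<in> ?Z" "?\<pi> b = ?\<pi> (a [^] (p ^ j))" by blast
    have ac: "a [^] (p ^ j) \<in> carrier G" by (rule nat_pow_closed[OF Zc[OF a(2)]])
    have "b \<in> N #> a [^] (p ^ j)" using rcos_self[OF a(1) N.subgroup_axioms] a(3) by simp
    then obtain u where "u \<in> N" "b = u \<otimes> a [^] (p ^ j)" by (auto simp: r_coset_def)
    then show "b \<in> ?B" using a(2) by blast
  qed
  have Bs: "subgroup ?B G"
  proof (rule subgroupI)
    show "?B \<subseteq> carrier G" using B_iff by blast
    have "\<one> \<in> ?B" unfolding B_iff using subgroup.one_closed[OF Zs] by (intro conjI one_closed bexI[of _ \<one>]) simp_all
    then show "?B \<noteq> {}" by blast
    show "inv b \<in> ?B" if "b \<in> ?B" for b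
    proof -
      obtain a where a: "b \<in> carrier G" "a \<in> ?Z" "?\<pi> b = ?\<pi> (a [^] (p ^ j))" using \<open>b \<in> ?B\<close> unfolding B_iff by blast
      have ac: "a \<in> carrier G" by (rule Zc[OF a(2)])
      have "?\<pi> (inv b) = ?\<pi> ((inv a) [^] (p ^ j))"
        using N.rcos_inv[OF a(1)] N.rcos_inv[of "a [^] (p ^ j)"] a(3) ac by (simp add: nat_pow_inv)
      then show ?thesis unfolding B_iff using inv_closed[OF a(1)] subgroup.m_inv_closed[OF Zs a(2)] by blast
    qed
    show "b \<otimes> c \<in> ?B" if "b \<in> ?B" "c \<in> ?B" for b c
    proof -
      obtain a where a: "b \<in> carrier G" "a \<in> ?Z" "?\<pi> b = ?\<pi> (a [^] (p ^ j))" using \<open>b \<in> ?B\<close> unfolding B_iff by blast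
      obtain d where d: "c \<in> carrier G" "d \<in> ?Z" "?\<pi> c = ?\<pi> (d [^] (p ^ j))" using \<open>c \<in> ?B\<close> unfolding B_iff by blast
      have "?\<pi> (b \<otimes> c) = ?\<pi> ((a \<otimes> d) [^] (p ^ j))" unfolding \<pi>m[OF a(1) d(1)] a(3) d(3) Zpow[OF a(2) d(2)] ..
      then show ?thesis unfolding B_iff using m_closed[OF a(1) d(1)] subgroup.m_closed[OF Zs a(2) d(2)] by blast
    qed
  qed
  have Bn: "?B \<lhd> G"
  proof (rule normal_invI[OF Bs])
    fix g h assume g: "g \<in> carrier G" and h: "h \<in> ?B"
    obtain a where a: "h \<in> carrier G" "a \<in> ?Z" "?\<pi> h = ?\<pi> (a [^] (p ^ j))" using h unfolding B_iff by blast
    let ?a = "a [^] (p ^ j)"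
    have aZ: "?a \<in> ?Z" using subgroup_int_pow_closed[OF Zs a(2), of "int (p ^ j)"] unfolding int_pow_int .
    have ac: "?a \<in> carrier G" using Zc[OF aZ] .
    have "?\<pi> (g \<otimes> h \<otimes> inv g) = ?\<pi> (g \<otimes> ?a \<otimes> inv g)" using g a(1,3) ac \<pi>m[OF g a(1)] \<pi>m[OF g ac] \<pi>m[of "g \<otimes> h" "inv g"] \<pi>m[of "g \<otimes> ?a" "inv g"] by simp
    also have "\<dots> = ?\<pi> ?a"
    proof -
      have "?\<pi> (g \<otimes> ?a \<otimes> inv g) = ?\<pi> (?a \<otimes> g) \<otimes>\<^bsub>G Mod N\<^esub> ?\<pi> (inv g)"
        using comm[OF aZ g] \<pi>m[OF g ac] \<pi>m[OF ac g] \<pi>m[of "g \<otimes> ?a" "inv g"] g ac by simp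
      also have "\<dots> = ?\<pi> (?a \<otimes> g \<otimes> inv g)" using \<pi>m[of "?a \<otimes> g" "inv g"] g ac by simp
      also have "?a \<otimes> g \<otimes> inv g = ?a" using g ac by (simp add: m_assoc)
      finally show ?thesis .
    qed
    finally show "g \<otimes> h \<otimes> inv g \<in> ?B" unfolding B_iff using a(1,2) g m_closed inv_closed by blast
  qed
  have Bb: "\<beta> ` ?B \<subseteq> ?B"
  proof
    fix y assume "y \<in> \<beta> ` ?B"
    then obtain u a where ua: "y = \<beta> (u \<otimes> a [^] (p ^ j))" "u \<in> N" "a \<in> ?Z" by blast
    have "\<beta> a \<in> ?Z"
    proof -
      have "cm (\<beta> a) g \<in> N" if g: "g \<in> carrier G" for g
      proof -
        \<comment> \<open>Surjectivity of \<beta> makes the preimage of the centre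
          invariant.\<close>
        obtain g' where g': "g = \<beta> g'" "g' \<in> carrier G" using g \<beta>(2) by blast
        have "cm (\<beta> a) g = \<beta> (cm a g')" using g' Zc[OF ua(3)] by (simp add: cm_def)
        then show ?thesis using N(2) ua(3) g' by auto
      qed
      then show ?thesis using Zc[OF ua(3)] by simp
    qed
    moreover have "y = \<beta> u \<otimes> \<beta> a [^] (p ^ j)"
      using ua Zc[OF ua(3)] by (simp add: b.hom_nat_pow)
    moreover have "\<beta> u \<in> N" using N(2) ua(2) by blast
    ultimately show "y \<in> ?B" by blast
  qed
  have NB: "N \<subseteq> ?B"
  proof
    fix u assume "u \<in> N"
    then show "u \<in> ?B" using subgroup.one_closed[OF Zs] by (intro CollectI exI[of _ u] exI[of _ \<one>]) auto
  qed
  have "z \<notin> ?B"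
  proof
    assume "z \<in> ?B"
    then obtain a where a: "a \<in> ?Z" "?\<pi> z = ?\<pi> (a [^] (p ^ j))" unfolding B_iff by blast
    have ac: "a \<in> carrier G" using Zc a by blast
    have "?\<pi> (a [^] (p ^ (j + n))) = ?\<pi> ((a [^] (p ^ j)) [^] (p ^ n))"
      using ac by (simp add: nat_pow_pow power_add)
    also have "\<dots> = ?\<pi> (z [^] (p ^ n))" 
      unfolding \<pi>p[OF z(1)] \<pi>p[OF nat_pow_closed[OF ac]] a(2) ..
    also have "\<dots> = \<one>\<^bsub>G Mod N\<^esub>" unfolding z(3) using \<pi>1[OF one_closed] by simp
    finally have "a [^] (p ^ (j + n)) \<in> N" using \<pi>1[OF nat_pow_closed[OF ac]] by simp
    then have "a \<in> K (j + n)" using a(1) unfolding K_def by blast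
    then have "a \<in> K j" using j[of "j + n"] by simp
    then have "a [^] (p ^ j) \<in> N" unfolding K_def by blast
    then have "?\<pi> z = \<one>\<^bsub>G Mod N\<^esub>" unfolding a(2) using \<pi>1[OF nat_pow_closed[OF ac]] by simp
    then show False using N(3) \<pi>1[OF z(1)] by simp
  qed
  then have B: "?B = N" by (rule max[OF Bn Bb _ NB])
  have q: "a [^] (p ^ j) \<in> N" if "a \<in> ?Z" for a
  proof -
    have "a [^] (p ^ j) \<in> ?B" unfolding B_iff using that nat_pow_closed[OF Zc[OF that]] by blast
    then show ?thesis unfolding B .
  qed
  have exp: "x [^] (p ^ (j * C)) \<in> N" if "x \<in> carrier G" for x
  proof -
    have "x [^] ((p ^ j) ^ C) \<in> N" by (rule exponent_mod_normal[OF N(1) nil _ that]) (rule q)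
    then show ?thesis by (simp add: power_mult)
  qed
  have "finite (carrier (G Mod N))"
  proof -
    obtain F where F: "finite F" "\<forall>h\<in>carrier G. \<exists>f\<in>F. N #> h = N #> f"
      using polycyclic_finite_index[OF polycyclic_nilpotent[OF S nil] N(1), of "p ^ (j * C)"] exp p by auto
    then have "carrier (G Mod N) \<subseteq> (\<lambda>f. N #> f) ` F" by (auto simp: carrier_FactGroup)
    then show ?thesis by (rule finite_subset[OF _ finite_imageI[OF F(1)]])
  qed
  then show ?thesis using exp by (intro that[OF N, of "j * C"]) simp_all
qed

text \<open>Another prime \<open>r\<close> dividing the order would give, by Sylow, a subgroup of
  order \<open>r\<close>, whose elements have orders dividing both \<open>r\<close> and p^e.\<close>

lemma card_p_power:
  assumes fin: "finite (carrier G)" and p: "prime p"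
    and exp: "\<And>x. x \<in> carrier G \<Longrightarrow> x [^] (p ^ e :: nat) = \<one>"
  shows "\<exists>m. card (carrier G) = p ^ m"
proof -
  have "Coset.order G > 0" using fin by (simp add: order_gt_0_iff_finite)
  then obtain a m where am: "Coset.order G = p ^ a * m" "\<not> p dvd m"
    using prime_power_canonical[OF p] by (metis mult.commute)
  have "m = 1"
  proof (rule ccontr)
    assume "m \<noteq> 1"
    then obtain r where r: "prime r" "r dvd m" using prime_factor_nat by blast
    then obtain t where t: "Coset.order G = r ^ 1 * t" using am by (metis dvd_def dvd_mult power_one_right)
    obtain H where H: "subgroup H G" "card H = r" using sylow_thm[OF r(1) is_group t fin] by auto
    interpret H: group "G\<lparr>carrier := H\<rparr>" using subgroup_imp_group[OF H(1)] .
    have "\<not> H \<subseteq> {\<one>}"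
      using card_mono[of "{\<one>}" H] H(2) prime_gt_1_nat[OF r(1)] by auto
    then obtain x where x: "x \<in> H" "x \<noteq> \<one>" by blast
    have xc: "x \<in> carrier G" using subgroup.mem_carrier[OF H(1) x(1)] .
    have "x [^]\<^bsub>G\<lparr>carrier := H\<rparr>\<^esub> Coset.order (G\<lparr>carrier := H\<rparr>) = \<one>\<^bsub>G\<lparr>carrier := H\<rparr>\<^esub>"
      by (rule H.pow_order_eq_1) (simp add: x)
    then have "x [^] r = \<one>" using H(2) nat_pow_consistent[of x r H] by (simp add: Coset.order_def)
    then have "ord x dvd r" "ord x dvd p ^ e" using exp[OF xc] pow_eq_id[OF xc] by auto
    moreover have "coprime r (p ^ e)"
      using r am(2) p primes_coprime[of r p] by auto
    ultimately have "ord x = 1" by (metis coprime_common_divisor nat_dvd_1_iff_1)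
    then show False using x(2) ord_eq_1[OF xc] by simp
  qed
  then show ?thesis using am by (auto simp: Coset.order_def)
qed

end

text \<open>Gives access to \<open>khukhro_bound\<close>, whose groups live on the natural
  numbers.\<close>

lemma finite_group_iso_nat:
  assumes "group Q" "finite (carrier Q)"
  obtains H :: "nat monoid" and f where "group H" "f \<in> hom Q H" "bij_betw f (carrier Q) (carrier H)"
proof -
  interpret Q: group Q by fact
  obtain f :: "_ \<Rightarrow> nat" where f: "inj_on f (carrier Q)" using finite_imp_inj_to_nat_seg[OF assms(2)] by blast
  let ?g = "inv_into (carrier Q) f"
  \<comment> \<open>Carrier and unit are placeholders, replaced in \<open>?H\<close>: outside the
    image of \<open>f\<close> the inverse \<open>?g\<close> is arbitrary, and only the image becomes
    a group.\<close>
  let ?H0 = "\<lparr>carrier = UNIV, monoid.mult = (\<lambda>x y. f (?g x \<otimes>\<^bsub>Q\<^esub> ?g y)), one = 0\<rparr> :: nat monoid"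
  have hom: "f \<in> hom Q ?H0" using f by (simp add: hom_def)
  let ?H = "?H0\<lparr>carrier := f ` carrier Q, one := f \<one>\<^bsub>Q\<^esub>\<rparr>"
  have "group ?H" by (rule Q.hom_imp_img_group[OF hom])
  moreover have "f \<in> hom Q ?H" using f by (simp add: hom_def)
  moreover have "bij_betw f (carrier Q) (carrier ?H)" using f by (simp add: bij_betw_def)
  ultimately show ?thesis using that by blast
qed

section \<open>Transport to finite quotients and Khukhro's bound\<close>

locale surj_hom = group_hom G H h for G (structure) and H (structure) and h +
  assumes surj: "h ` carrier G = carrier H"
begin

lemma image_lcs: "h ` lcs G i = lcs H i"
proof (induction i)
  case 0
  then show ?case using surj by simp
next
  case (Suc i)
  then show ?case unfolding image_lcs_Suc surj lcs.simps(2)[of H] by simp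
qed

lemma image_k_generated: "k_generated G k (carrier G) \<Longrightarrow> k_generated H k (carrier H)"
proof -
  assume "k_generated G k (carrier G)"
  then obtain S where S: "finite S" "card S \<le> k" "S \<subseteq> carrier G" "carrier G = generate G S"
    unfolding k_generated_def by blast
  have "carrier H = generate H (h ` S)" using generate_img[OF S(3)] S(4) surj by simp
  moreover have "card (h ` S) \<le> k" using card_image_le[OF S(1)] S(2) by (rule order_trans)
  moreover have "h ` S \<subseteq> carrier H" "finite (h ` S)" using S(1,3) surj by blast+
  ultimately show ?thesis unfolding k_generated_def by blast
qed

lemma image_ordered_prod:
  "(\<And>i. f i \<in> carrier G) \<Longrightarrow> h (ordered_prod G f n) = ordered_prod H (\<lambda>i. h (f i)) n \<and> ordered_prod G f n \<in> carrier G"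
  by (induction n) auto

text \<open>The kernel is mapped into itself, so \<beta> induces an endomorphism of
  \<open>H\<close>; it is onto because \<beta> is, and bijective because \<open>H\<close> is
  finite.\<close>

lemma image_cyclotomic:
  assumes cyc: "cyclotomic_aut G n \<beta>" and fin: "finite (carrier H)"
    and inv: "\<And>x. x \<in> carrier G \<Longrightarrow> h x = \<one>\<^bsub>H\<^esub> \<Longrightarrow> h (\<beta> x) = \<one>\<^bsub>H\<^esub>"
  shows "\<exists>\<gamma>. cyclotomic_aut H n \<gamma>"
proof -
  have \<beta>: "\<beta> \<in> hom G G" "\<beta> ` carrier G = carrier G"
    using cyc by (auto simp: cyclotomic_aut_def iso_def bij_betw_def)
  interpret b: group_hom G G \<beta> using \<beta> by unfold_locales
  define \<gamma> where "\<gamma> y = h (\<beta> (SOME x. x \<in> carrier G \<and> h x = y))" for y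
  have \<gamma>: "\<gamma> (h x) = h (\<beta> x)" if x: "x \<in> carrier G" for x
  proof -
    let ?x = "SOME u. u \<in> carrier G \<and> h u = h x"
    have u: "?x \<in> carrier G \<and> h ?x = h x" by (rule someI[of _ x]) (use x in auto)
    have "h (?x \<otimes> inv x) = \<one>\<^bsub>H\<^esub>" using u x by simp
    then have "h (\<beta> (?x \<otimes> inv x)) = \<one>\<^bsub>H\<^esub>" by (intro inv) (use u x in auto)
    then have "h (\<beta> ?x) \<otimes>\<^bsub>H\<^esub> inv\<^bsub>H\<^esub> h (\<beta> x) = \<one>\<^bsub>H\<^esub>" using u x by simp
    then have "inv\<^bsub>H\<^esub> (inv\<^bsub>H\<^esub> h (\<beta> x)) = h (\<beta> ?x)" using u x by (intro H.inv_equality) auto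
    then have "h (\<beta> ?x) = h (\<beta> x)" using x by simp
    then show ?thesis by (simp add: \<gamma>_def)
  qed
  have \<gamma>c: "\<gamma> y \<in> carrier H" if "y \<in> carrier H" for y
    using that \<gamma> unfolding surj[symmetric] by auto
  have hom: "\<gamma> \<in> hom H H"
  proof (rule homI)
    fix x y assume "x \<in> carrier H" "y \<in> carrier H"
    then obtain u v where "x = h u" "y = h v" "u \<in> carrier G" "v \<in> carrier G" using surj by blast
    then show "\<gamma> (x \<otimes>\<^bsub>H\<^esub> y) = \<gamma> x \<otimes>\<^bsub>H\<^esub> \<gamma> y" using \<gamma>[of "u \<otimes> v"] \<gamma>[of u] \<gamma>[of v] by simp
  qed (use \<gamma>c in auto)
  have sj: "\<gamma> ` carrier H = carrier H"
  proof -
    have "\<gamma> ` carrier H = h ` \<beta> ` carrier G" unfolding surj[symmetric] using \<gamma> by (auto simp: image_iff)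
    then show ?thesis using \<beta>(2) surj by simp
  qed
  then have "bij_betw \<gamma> (carrier H) (carrier H)" using fin by (simp add: bij_betw_def finite_surj_inj)
  then have iso: "\<gamma> \<in> iso H H" using hom by (simp add: iso_def)
  have bc: "(\<beta> ^^ i) x \<in> carrier G" if "x \<in> carrier G" for i x
    using that by (induction i) auto
  have pow: "(\<gamma> ^^ i) (h x) = h ((\<beta> ^^ i) x)" if "x \<in> carrier G" for i x
    using that by (induction i) (auto simp: \<gamma> bc)
  have "ordered_prod H (\<lambda>i. (\<gamma> ^^ i) (y [^]\<^bsub>H\<^esub> Polynomial.coeff (cyclotomic_poly n) i)) (degree (cyclotomic_poly n)) = \<one>\<^bsub>H\<^esub>"
    if "y \<in> carrier H" for y
  proof -
    obtain x where x: "y = h x" "x \<in> carrier G" using \<open>y \<in> carrier H\<close> surj by blast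
    let ?f = "\<lambda>i. (\<beta> ^^ i) (x [^] Polynomial.coeff (cyclotomic_poly n) i)"
    have "(\<gamma> ^^ i) (y [^]\<^bsub>H\<^esub> Polynomial.coeff (cyclotomic_poly n) i) = h (?f i)" for i
      using x pow by (simp flip: hom_int_pow)
    moreover have "h (ordered_prod G ?f (degree (cyclotomic_poly n))) =
        ordered_prod H (\<lambda>i. h (?f i)) (degree (cyclotomic_poly n))"
      using image_ordered_prod[of ?f] bc x by simp
    moreover have "ordered_prod G ?f (degree (cyclotomic_poly n)) = \<one>"
      using cyc x by (simp add: cyclotomic_aut_def)
    ultimately show ?thesis by simp
  qed
  then show ?thesis using iso unfolding cyclotomic_aut_def by blast
qed

end

text \<open>Khukhro's bound trivialises the image of the term containing \<open>z\<close>, which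
  contradicts the survival of \<open>z\<close> in the quotient.\<close>

lemma khukhro_nilpotent:
  fixes G (structure)
  assumes kb: "khukhro_bound B" and p: "prime p" and G: "group G" and gen: "k_generated G k (carrier G)"
    and cyc: "cyclotomic_aut G p \<beta>" and nil: "lcs G C = {\<one>}"
    and z: "z \<in> lcs G (B k p)" "z [^] (p ^ n :: nat) = \<one>"
  shows "z = \<one>"
proof (rule ccontr)
  interpret group G by fact
  assume "z \<noteq> \<one>"
  have zc: "z \<in> carrier G" using lcs_carrier[OF z(1)] .
  obtain S where S: "finite S" "card S \<le> k" "S \<subseteq> carrier G" "generate G S = carrier G"
    using gen unfolding k_generated_def by blast
  have \<beta>: "\<beta> \<in> hom G G" "\<beta> ` carrier G = carrier G"
    using cyc by (auto simp: cyclotomic_aut_def iso_def bij_betw_def)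
  obtain N e where N: "N \<lhd> G" "\<beta> ` N \<subseteq> N" "z \<notin> N" "finite (carrier (G Mod N))"
    and e: "\<forall>x \<in> carrier G. x [^] (p ^ e :: nat) \<in> N"
    by (rule finite_p_quotient_avoiding[OF S(1,3,4) nil \<beta> zc \<open>z \<noteq> \<one>\<close> z(2) prime_gt_0_nat[OF p]])
  interpret N: normal N G by fact
  obtain H :: "nat monoid" and f where H: "group H" "f \<in> hom (G Mod N) H"
      "bij_betw f (carrier (G Mod N)) (carrier H)"
    using finite_group_iso_nat[OF N.factorgroup_is_group N(4)] by blast
  interpret H: group H by fact
  let ?h = "\<lambda>x. f (N #> x)"
  have hom: "?h \<in> hom G H"
    using N.r_coset_hom_Mod H(2) by (auto simp: hom_def Pi_def)
  have im: "?h ` carrier G = carrier H"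
    using H(3) unfolding bij_betw_def carrier_FactGroup by (simp add: image_image)
  interpret h: surj_hom G H ?h
    by unfold_locales (use hom im in auto)
  have one: "?h x = \<one>\<^bsub>H\<^esub> \<longleftrightarrow> x \<in> N" if "x \<in> carrier G" for x
  proof -
    have inj: "inj_on f (carrier (G Mod N))" using H(3) by (simp add: bij_betw_def)
    have c: "N #> x \<in> carrier (G Mod N)" "N #> \<one> \<in> carrier (G Mod N)"
      unfolding carrier_FactGroup using that by blast+
    have N1: "N #> \<one> = N" using N.subset by (rule coset_mult_one)
    have "N #> x = N \<longleftrightarrow> x \<in> N"
      using rcos_self[OF that N.subgroup_axioms] N.rcos_const[OF is_group] by auto
    then have "?h x = ?h \<one> \<longleftrightarrow> x \<in> N" using inj_on_eq_iff[OF inj c] N1 by simp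
    then show ?thesis unfolding h.hom_one .
  qed
  have finH: "finite (carrier H)" using N(4) bij_betw_finite[OF H(3)] by simp
  have "\<exists>\<gamma>. cyclotomic_aut H p \<gamma>"
  proof (rule h.image_cyclotomic[OF cyc finH])
    fix x assume x: "x \<in> carrier G" "?h x = \<one>\<^bsub>H\<^esub>"
    then have "x \<in> N" using one by simp
    then have "\<beta> x \<in> N" using N(2) by blast
    then show "?h (\<beta> x) = \<one>\<^bsub>H\<^esub>" using one N.subset by blast
  qed
  then obtain \<gamma> where \<gamma>: "cyclotomic_aut H p \<gamma>" by blast
  have "y [^]\<^bsub>H\<^esub> (p ^ e) = \<one>\<^bsub>H\<^esub>" if y: "y \<in> carrier H" for y
  proof -
    obtain x where x: "y = ?h x" "x \<in> carrier G" using y im by blast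
    then have "y [^]\<^bsub>H\<^esub> (p ^ e) = ?h (x [^] (p ^ e))" using h.hom_nat_pow by simp
    then show ?thesis using one e x by simp
  qed
  then obtain m where "card (carrier H) = p ^ m" using H.card_p_power[OF finH p] by blast
  then have "nilpotent_class_le H (B k p)"
    using kb p H(1) finH h.image_k_generated[OF gen] \<gamma> unfolding khukhro_bound_def by blast
  then have "?h z = \<one>\<^bsub>H\<^esub>" using h.image_lcs[of "B k p"] z(1) unfolding nilpotent_class_le_def by blast
  then show False using one N(3) zc by simp
qed

section \<open>Cyclotomic polynomials\<close>

abbreviation complex_poly :: "int poly \<Rightarrow> complex poly" where
  "complex_poly \<equiv> map_poly of_int"

lemma coeff_complex_poly [simp]: "Polynomial.coeff (complex_poly f) i = of_int (Polynomial.coeff f i)"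
  by (simp add: coeff_map_poly)

lemma degree_complex_poly [simp]: "degree (complex_poly f) = degree f"
  by (rule degree_map_poly) simp

lemma complex_poly_simps:
  "complex_poly (f + g) = complex_poly f + complex_poly g"
  "complex_poly (f - g) = complex_poly f - complex_poly g"
  "complex_poly (f * g) = complex_poly f * complex_poly g"
  "complex_poly 0 = 0" "complex_poly 1 = 1" "complex_poly (Polynomial.monom c n) = Polynomial.monom (of_int c) n"
  by (intro poly_eqI; simp add: coeff_mult)+

lemma complex_poly_prod: "complex_poly (\<Prod>i\<in>A. f i) = (\<Prod>i\<in>A. complex_poly (f i))"
  by (induction A rule: infinite_finite_induct) (simp_all add: complex_poly_simps)

lemma complex_poly_sum: "complex_poly (\<Sum>i\<in>A. f i) = (\<Sum>i\<in>A. complex_poly (f i))"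
  by (induction A rule: infinite_finite_induct) (simp_all add: complex_poly_simps)

lemma complex_poly_inject: "complex_poly f = complex_poly g \<Longrightarrow> f = g"
  by (rule poly_eqI) (metis coeff_complex_poly of_int_eq_iff)

text \<open>Division by a monic polynomial stays within the integers; over the complex numbers the
  remainder is divisible by \<open>A\<close> and of smaller degree, hence zero.\<close>

lemma complex_poly_dvd:
  assumes lc: "lead_coeff A = 1" and dvd: "complex_poly A dvd complex_poly B"
  shows "A dvd B"
proof -
  have A: "A \<noteq> 0" using lc by auto
  obtain q r where qr: "pseudo_divmod B A = (q, r)" by (cases "pseudo_divmod B A") auto
  have B: "B = A * q + r" and r: "r = 0 \<or> degree r < degree A"
    using pseudo_divmod[OF A qr] lc by simp_all
  have "complex_poly A dvd complex_poly A * complex_poly q + complex_poly r"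
    using dvd unfolding B complex_poly_simps .
  then have d: "complex_poly A dvd complex_poly r" by (simp add: dvd_add_right_iff)
  have "r = 0"
  proof (rule ccontr)
    assume nz: "r \<noteq> 0"
    then have "complex_poly r \<noteq> 0" using complex_poly_inject[of r 0] complex_poly_simps(4) by auto
    then have "degree A \<le> degree r" using dvd_imp_degree_le[OF d] by simp
    then show False using r nz by simp
  qed
  then show ?thesis using B by simp
qed

definition root_poly :: "complex set \<Rightarrow> complex poly" where
  "root_poly A = (\<Prod>z\<in>A. [:- z, 1:])"

lemma poly_root_poly: "finite A \<Longrightarrow> poly (root_poly A) x = 0 \<longleftrightarrow> x \<in> A"
  by (auto simp: root_poly_def poly_prod)

lemma lead_coeff_root_poly: "lead_coeff (root_poly A) = 1"
  by (simp add: root_poly_def lead_coeff_prod)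

lemma root_poly_nonzero: "root_poly A \<noteq> 0"
  using lead_coeff_root_poly[of A] by auto

lemma degree_root_poly: "finite A \<Longrightarrow> degree (root_poly A) = card A"
  unfolding root_poly_def by (subst degree_prod_eq_sum_degree) auto

lemma root_poly_Un: "finite A \<Longrightarrow> finite B \<Longrightarrow> A \<inter> B = {} \<Longrightarrow> root_poly (A \<union> B) = root_poly A * root_poly B"
  by (simp add: root_poly_def prod.union_disjoint)

lemma root_poly_dvd:
  assumes "finite A" "\<And>z. z \<in> A \<Longrightarrow> poly f z = 0"
  shows "root_poly A dvd f"
  using assms
proof (induction A rule: finite_induct)
  case (insert z A)
  then obtain g where g: "f = root_poly A * g" by (meson dvdE insertI2)
  have "poly f z = 0" "poly (root_poly A) z \<noteq> 0" using insert poly_root_poly by auto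
  then have "poly g z = 0" using g by simp
  then obtain h where "g = [:- z, 1:] * h" by (meson dvdE poly_eq_0_iff_dvd)
  moreover have "root_poly (insert z A) = [:- z, 1:] * root_poly A" using insert by (simp add: root_poly_def)
  ultimately have "f = root_poly (insert z A) * h" using g by (simp only: ac_simps)
  then show ?case by simp
qed (simp add: root_poly_def)

lemma root_poly_unity:
  assumes "n > 0"
  shows "root_poly {z. z ^ n = 1} = Polynomial.monom 1 n - 1"
proof -
  let ?A = "{z::complex. z ^ n = 1}" and ?f = "Polynomial.monom 1 n - 1 :: complex poly"
  have fin: "finite ?A" using finite_roots_unity[of n] assms by simp
  obtain g where g: "?f = root_poly ?A * g"
    using root_poly_dvd[OF fin, of ?f] by (auto simp: poly_monom)
  have deg: "degree ?f = n"
  proof (rule antisym)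
    show "degree ?f \<le> n" using assms by (intro degree_diff_le) (auto simp: degree_monom_le)
    show "n \<le> degree ?f" using assms by (intro le_degree) simp
  qed
  have lc: "lead_coeff ?f = 1" unfolding deg using assms by simp
  have nz: "?f \<noteq> 0" using lc leading_coeff_0_iff[of ?f] by (metis zero_neq_one)
  then have "g \<noteq> 0" using g by auto
  then have "n = n + degree g"
    using arg_cong[OF g, of degree] deg degree_root_poly[OF fin] card_roots_unity_eq[OF assms]
    by (simp add: degree_mult_eq root_poly_nonzero)
  then have "degree g = 0" by simp
  then obtain c where c: "g = [:c:]" by (rule degree_eq_zeroE)
  have "lead_coeff g = 1" using arg_cong[OF g, of lead_coeff] lc lead_coeff_root_poly by (simp add: lead_coeff_mult)
  then show ?thesis using g c by (simp add: one_pCons)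
qed

lemma finite_complex_roots_unity: "n > 0 \<Longrightarrow> finite {z::complex. z ^ n = 1}"
  by (rule finite_roots_unity) simp

section \<open>Primitive roots of unity and integrality\<close>

definition prim_roots :: "nat \<Rightarrow> complex set" where
  "prim_roots n = {z. z ^ n = 1 \<and> (\<forall>d. 0 < d \<and> d < n \<longrightarrow> z ^ d \<noteq> 1)}"

lemma prim_roots_dvd:
  assumes "z \<in> prim_roots d" "d > 0"
  shows "z ^ n = 1 \<longleftrightarrow> d dvd n"
proof
  have z: "z ^ d = 1" "\<And>i. 0 < i \<Longrightarrow> i < d \<Longrightarrow> z ^ i \<noteq> 1" using assms by (auto simp: prim_roots_def)
  assume "z ^ n = 1"
  moreover have "z ^ n = (z ^ d) ^ (n div d) * z ^ (n mod d)"
    by (simp flip: power_mult power_add)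
  ultimately have "z ^ (n mod d) = 1" using z by simp
  then show "d dvd n" using z(2)[of "n mod d"] assms(2) by (metis bot_nat_0.not_eq_extremum mod_eq_0_iff_dvd mod_less_divisor)
next
  assume "d dvd n"
  then show "z ^ n = 1" using assms by (auto simp: prim_roots_def power_mult)
qed

lemma roots_unity_Union: "n > 0 \<Longrightarrow> {z. z ^ n = 1} = (\<Union>d\<in>{d. d dvd n}. prim_roots d)"
proof (intro equalityI subsetI)
  fix z :: complex assume n: "n > 0" and z: "z \<in> {z. z ^ n = 1}"
  define d where "d = (LEAST d. 0 < d \<and> z ^ d = 1)"
  have d: "0 < d \<and> z ^ d = 1" unfolding d_def by (rule LeastI[of _ n]) (use n z in auto)
  moreover have "z ^ i \<noteq> 1" if "0 < i" "i < d" for i using not_less_Least[of i] that d_def by auto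
  ultimately have p: "z \<in> prim_roots d" by (simp add: prim_roots_def)
  then have "d dvd n" using prim_roots_dvd[OF p, of n] d z by auto
  then show "z \<in> (\<Union>d\<in>{d. d dvd n}. prim_roots d)" using p by blast
next
  fix z assume n: "n > 0" and "z \<in> (\<Union>d\<in>{d. d dvd n}. prim_roots d)"
  then obtain d where d: "d dvd n" "z \<in> prim_roots d" by blast
  then have "d > 0" using n by (metis dvd_0_left_iff not_gr_zero)
  then show "z \<in> {z. z ^ n = 1}" using prim_roots_dvd d by auto
qed

lemma prim_roots_disjoint:
  "0 < d \<Longrightarrow> 0 < e \<Longrightarrow> d \<noteq> e \<Longrightarrow> prim_roots d \<inter> prim_roots e = {}"
  using prim_roots_dvd by (metis dvd_antisym dvd_refl disjoint_iff)

lemma finite_prim_roots: "n > 0 \<Longrightarrow> finite (prim_roots n)"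
  using finite_complex_roots_unity[of n] by (auto simp: prim_roots_def intro: rev_finite_subset)

text \<open>X^n - 1 is the product over all divisors of \<open>n\<close>. By induction the proper
  divisors give a monic integer polynomial \<open>A\<close>, and division by it stays within the
  integers. This is the existence behind the \<open>THE\<close> in
  \<open>cyclotomic_poly\<close>.\<close>

lemma root_poly_prim_roots_int:
  "n > 0 \<Longrightarrow> \<exists>q. complex_poly q = root_poly (prim_roots n)"
proof (induction n rule: less_induct)
  case (less n)
  let ?D = "{d. d dvd n} - {n}"
  have D: "d > 0" "d < n" if "d \<in> ?D" for d
    using that less.prems by (auto intro!: Nat.gr0I dest: dvd_imp_le)
  have finD: "finite ?D" using less.prems by simp
  then have "\<forall>d\<in>?D. \<exists>q. complex_poly q = root_poly (prim_roots d)" using less.IH D by blast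
  then obtain q where q: "\<And>d. d \<in> ?D \<Longrightarrow> complex_poly (q d) = root_poly (prim_roots d)" by metis
  define A where "A = (\<Prod>d\<in>?D. q d)"
  have A: "complex_poly A = (\<Prod>d\<in>?D. root_poly (prim_roots d))"
    unfolding A_def complex_poly_prod by (rule prod.cong) (use q in auto)
  have "lead_coeff (complex_poly A) = 1"
    unfolding A lead_coeff_prod by (simp add: lead_coeff_root_poly)
  then have lcA: "lead_coeff A = 1" by simp
  have "root_poly {z. z ^ n = 1} = (\<Prod>d\<in>{d. d dvd n}. root_poly (prim_roots d))"
    unfolding roots_unity_Union[OF less.prems] root_poly_def
  proof (rule prod.UNION_disjoint)
    have pos: "d > 0" if "d dvd n" for d using that less.prems by (auto intro!: Nat.gr0I)
    show "\<forall>i\<in>{d. d dvd n}. finite (prim_roots i)" using finite_prim_roots pos by blast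
    show "\<forall>i\<in>{d. d dvd n}. \<forall>j\<in>{d. d dvd n}. i \<noteq> j \<longrightarrow> prim_roots i \<inter> prim_roots j = {}"
      using prim_roots_disjoint pos by blast
  qed (use less.prems in simp)
  also have "{d. d dvd n} = insert n ?D" by auto
  also have "(\<Prod>d\<in>insert n ?D. root_poly (prim_roots d)) = root_poly (prim_roots n) * complex_poly A"
    unfolding A using finD by (subst prod.insert) auto
  finally have e: "complex_poly (Polynomial.monom 1 n - 1) = root_poly (prim_roots n) * complex_poly A"
    unfolding root_poly_unity[OF less.prems] complex_poly_simps by simp
  then have "A dvd Polynomial.monom 1 n - 1" by (intro complex_poly_dvd[OF lcA]) simp
  then obtain Q where "Polynomial.monom 1 n - 1 = A * Q" by blast
  then have "complex_poly A * complex_poly Q = root_poly (prim_roots n) * complex_poly A"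
    using e by (simp add: complex_poly_simps)
  moreover have "complex_poly A \<noteq> 0" using lcA complex_poly_inject[of A 0] complex_poly_simps(4) by fastforce
  ultimately have "complex_poly Q = root_poly (prim_roots n)" by (simp add: mult.commute)
  then show ?case by blast
qed

lemma bij_betw_prim_roots:
  assumes "n > 1"
  shows "bij_betw (\<lambda>k. cis (2 * pi * real k / real n)) {k. 1 \<le> k \<and> k \<le> n \<and> coprime k n} (prim_roots n)"
proof -
  let ?f = "\<lambda>k. cis (2 * pi * real k / real n)" and ?K = "{k. 1 \<le> k \<and> k \<le> n \<and> coprime k n}"
  have bij: "bij_betw ?f {..<n} {z. z ^ n = 1}" using bij_betw_roots_unity assms by simp
  have pow: "?f k ^ d = ?f (k * d)" for k d by (simp add: DeMoivre mult_ac)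
  have mod: "?f k = ?f (k mod n)" for k
  proof -
    have k: "real n * real (k div n) + real (k mod n) = real k"
      unfolding of_nat_mult[symmetric] of_nat_add[symmetric] by (simp only: mult_div_mod_eq)
    have "2 * pi * real k / real n = 2 * pi * real (k div n) + 2 * pi * real (k mod n) / real n"
      unfolding k[symmetric] using assms by (simp add: field_simps)
    moreover have "cis (2 * pi * real (k div n)) = 1" using cis_multiple_2pi[of "real (k div n)"] by simp
    ultimately show ?thesis by (simp flip: cis_mult)
  qed
  have one: "?f k = 1 \<longleftrightarrow> n dvd k" for k
  proof -
    have "?f k = 1 \<longleftrightarrow> ?f (k mod n) = ?f 0" using mod[of k] by simp
    also have "\<dots> \<longleftrightarrow> k mod n = 0"
      using bij assms by (intro inj_on_eq_iff[of ?f "{..<n}"]) (auto simp: bij_betw_def)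
    finally show ?thesis by auto
  qed
  \<comment> \<open>For n > 1 the index k = n is not coprime to \<open>n\<close>, so the indices
    fall into 0, ..., n - 1, where the exponential is injective.\<close>
  have K: "?K \<subseteq> {..<n}" using assms by (auto simp: nat_less_le)
  have prim: "?f k \<in> prim_roots n \<longleftrightarrow> coprime k n" if "k < n" for k
  proof
    assume p: "?f k \<in> prim_roots n"
    define g where "g = gcd k n"
    have g: "g > 0" "g dvd n" "g dvd k" using assms by (auto simp: g_def)
    have "n dvd k * (n div g)" using g by (metis dvd_div_mult dvd_triv_right mult.commute)
    then have "?f k ^ (n div g) = 1" unfolding pow one .
    then have "\<not> (0 < n div g \<and> n div g < n)" using p by (auto simp: prim_roots_def)
    moreover have "0 < n div g" using g assms by (simp add: dvd_imp_le div_greater_zero_iff)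
    ultimately have "g = 1" using g assms by (metis div_less_dividend nat_neq_iff less_one less_trans zero_less_one)
    then show "coprime k n" by (simp add: g_def coprime_iff_gcd_eq_1)
  next
    assume c: "coprime k n"
    have "?f k ^ d \<noteq> 1" if "0 < d" "d < n" for d
      using c that one pow by (metis coprime_commute coprime_dvd_mult_right_iff nat_dvd_not_less)
    moreover have "?f k ^ n = 1" unfolding pow one by simp
    ultimately show "?f k \<in> prim_roots n" by (simp add: prim_roots_def)
  qed
  have "?f ` ?K = prim_roots n"
  proof (intro equalityI subsetI)
    fix z assume "z \<in> prim_roots n"
    then have "z \<in> ?f ` {..<n}" using bij by (auto simp: bij_betw_def prim_roots_def)
    then obtain k where k: "k < n" "z = ?f k" by blast
    then have c: "coprime k n" using prim \<open>z \<in> prim_roots n\<close> by blast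
    have "k \<noteq> 0" by (cases "k = 0") (use c assms in auto)
    then show "z \<in> ?f ` ?K" using k c by auto
  qed (use prim K in auto)
  moreover have "inj_on ?f ?K" using bij K by (auto simp: bij_betw_def intro: inj_on_subset)
  ultimately show ?thesis by (simp add: bij_betw_def)
qed

lemma complex_poly_cyclotomic:
  assumes "n > 1"
  shows "complex_poly (cyclotomic_poly n) = root_poly (prim_roots n)"
proof -
  have e: "(\<Prod>k\<in>{k. 1 \<le> k \<and> k \<le> n \<and> coprime k n}. [: - cis (2 * pi * real k / real n), 1:]) = root_poly (prim_roots n)"
    unfolding root_poly_def by (rule prod.reindex_bij_betw[OF bij_betw_prim_roots[OF assms]])
  obtain q where q: "complex_poly q = root_poly (prim_roots n)"
    using root_poly_prim_roots_int[of n] assms by auto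
  show ?thesis unfolding cyclotomic_poly_def e
    by (rule theI[of _ q]) (use q complex_poly_inject in auto)
qed

lemma lead_coeff_cyclotomic: "n > 1 \<Longrightarrow> lead_coeff (cyclotomic_poly n) = 1"
  using complex_poly_cyclotomic[of n] lead_coeff_root_poly[of "prim_roots n"]
  by (metis coeff_complex_poly degree_complex_poly of_int_eq_1_iff)

lemma degree_cyclotomic_pos:
  assumes "n > 1"
  shows "degree (cyclotomic_poly n) > 0"
proof -
  have "1 \<in> {k. 1 \<le> k \<and> k \<le> n \<and> coprime k n}" using assms by simp
  then have "prim_roots n \<noteq> {}" using bij_betw_prim_roots[OF assms] unfolding bij_betw_def by blast
  then have "card (prim_roots n) > 0" using finite_prim_roots[of n] assms by (simp add: card_gt_0_iff)
  then have "degree (root_poly (prim_roots n)) > 0"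
    using degree_root_poly finite_prim_roots assms by simp
  then show ?thesis using complex_poly_cyclotomic[OF assms] by (metis degree_complex_poly)
qed

section \<open>Geometric sums as multiples of cyclotomic polynomials\<close>

definition geom_poly :: "nat \<Rightarrow> nat \<Rightarrow> int poly" where
  "geom_poly r m = (\<Sum>i<r. Polynomial.monom 1 (i * m))"

text \<open>Multiplied by X^m - 1, both sides become X^(m r) - 1.\<close>

lemma complex_geom_poly:
  assumes "m > 0" "r > 0"
  shows "complex_poly (geom_poly r m) = root_poly ({z. z ^ (m * r) = 1} - {z. z ^ m = 1})"
proof -
  let ?A = "{z::complex. z ^ (m * r) = 1}" and ?B = "{z::complex. z ^ m = 1}"
  have fin: "finite ?A" "finite ?B" using finite_complex_roots_unity assms by simp_all
  have "?B \<subseteq> ?A" by (auto simp: power_mult)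
  then have "?A = (?A - ?B) \<union> ?B" by auto
  then have 1: "root_poly ?A = root_poly (?A - ?B) * root_poly ?B"
    using root_poly_Un[of "?A - ?B" ?B] fin by auto
  let ?x = "Polynomial.monom 1 m :: complex poly"
  have "?x ^ r - 1 = (?x - 1) * (\<Sum>i<r. ?x ^ i)" by (rule power_diff_1_eq)
  moreover have "?x ^ i = Polynomial.monom 1 (i * m)" for i by (simp add: monom_power mult.commute)
  moreover have "complex_poly (geom_poly r m) = (\<Sum>i<r. Polynomial.monom 1 (i * m))"
    by (simp add: geom_poly_def complex_poly_sum complex_poly_simps)
  ultimately have 2: "root_poly ?A = root_poly ?B * complex_poly (geom_poly r m)"
    using assms by (simp add: root_poly_unity mult.commute)
  show ?thesis using 1 2 root_poly_nonzero[of ?B] by (simp add: mult.commute)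
qed

lemma prim_roots_subset: "n > 1 \<Longrightarrow> n = m * r \<Longrightarrow> r > 1 \<Longrightarrow> prim_roots n \<subseteq> {z. z ^ (m * r) = 1} - {z. z ^ m = 1}"
proof -
  assume "n > 1" "n = m * r" "r > 1"
  then have "0 < m" "m < m * r" by (auto intro!: Nat.gr0I)
  then show ?thesis using \<open>n = m * r\<close> by (auto simp: prim_roots_def)
qed

text \<open>Primitive n-th roots are roots of X^n - 1 but not of X^(n/r) - 1, hence of the quotient;
  monicity brings the divisibility back to the integers.\<close>

lemma cyclotomic_dvd_geom_poly:
  assumes "n > 1" "prime r" "r dvd n"
  shows "cyclotomic_poly n dvd geom_poly r (n div r)"
proof -
  let ?m = "n div r" let ?T = "{z::complex. z ^ (?m * r) = 1} - {z. z ^ ?m = 1}"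
  have r: "r > 1" using assms prime_gt_1_nat by blast
  have n: "n = ?m * r" using assms by simp
  have m: "?m > 0" using n assms(1) by (metis gr0I mult_0 not_less_zero)
  have T: "finite ?T" using finite_complex_roots_unity[of "?m * r"] m r by simp
  have P: "prim_roots n \<subseteq> ?T" using prim_roots_subset[OF assms(1) n r] .
  have "root_poly (prim_roots n) dvd root_poly ?T"
    using P T poly_root_poly[OF T] by (intro root_poly_dvd) (auto intro: finite_subset)
  then have "complex_poly (cyclotomic_poly n) dvd complex_poly (geom_poly r ?m)"
    using complex_poly_cyclotomic[OF assms(1)] complex_geom_poly[OF m, of r] r by simp
  then show ?thesis by (rule complex_poly_dvd[OF lead_coeff_cyclotomic[OF assms(1)]])
qed

text \<open>The only divisor of p^(a + 1) that does not divide p^a is p^(a + 1) itself, so all roots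
  of the geometric sum are primitive.\<close>

lemma cyclotomic_prime_power:
  assumes "prime p"
  shows "cyclotomic_poly (p ^ Suc a) = geom_poly p (p ^ a)"
proof -
  have p: "p > 1" using assms prime_gt_1_nat by blast
  have n: "p ^ Suc a > 1" "p ^ Suc a = p ^ a * p" using p one_less_power[of p "Suc a"] by simp_all
  let ?T = "{z::complex. z ^ (p ^ a * p) = 1} - {z. z ^ (p ^ a) = 1}"
  have "?T \<subseteq> prim_roots (p ^ Suc a)"
  proof
    fix z assume z: "z \<in> ?T"
    then have "z \<in> {z. z ^ (p ^ Suc a) = 1}" unfolding n(2) by blast
    then have "z \<in> (\<Union>d\<in>{d. d dvd p ^ Suc a}. prim_roots d)"
      unfolding roots_unity_Union[OF order.strict_trans[OF zero_less_one n(1)]] .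
    then obtain d where d: "d dvd p ^ Suc a" "z \<in> prim_roots d" by blast
    then obtain i where i: "i \<le> Suc a" "d = p ^ i" using divides_primepow_nat[OF assms] by blast
    have "d > 0" using i p by simp
    then have "\<not> d dvd p ^ a" using prim_roots_dvd[OF d(2), of "p ^ a"] z by simp
    then have "\<not> i \<le> a" using i le_imp_power_dvd by blast
    then show "z \<in> prim_roots (p ^ Suc a)" using i d by (metis le_Suc_eq)
  qed
  then have "prim_roots (p ^ Suc a) = ?T" using prim_roots_subset[OF n p] by blast
  then have "complex_poly (cyclotomic_poly (p ^ Suc a)) = complex_poly (geom_poly p (p ^ a))"
    using complex_poly_cyclotomic[OF n(1)] complex_geom_poly[of "p ^ a" p] p by simp
  then show ?thesis by (rule complex_poly_inject)
qed

lemma coeff_geom_poly: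
  assumes "m > 0"
  shows "Polynomial.coeff (geom_poly r m) k = (if k \<in> (\<lambda>i. i * m) ` {..<r} then 1 else 0)"
proof -
  have "Polynomial.coeff (geom_poly r m) k = (\<Sum>i<r. if i * m = k then 1 else 0)"
    by (simp add: geom_poly_def coeff_sum)
  also have "\<dots> = (\<Sum>i\<in>{i. i < r \<and> i * m = k}. 1)"
    by (subst sum.inter_filter[symmetric]) auto
  also have "\<dots> = of_nat (card {i. i < r \<and> i * m = k})" by simp
  also have "{i. i < r \<and> i * m = k} = (if k \<in> (\<lambda>i. i * m) ` {..<r} then {k div m} else {})"
    using assms by auto
  finally show ?thesis by simp
qed

lemma degree_geom_poly:
  assumes "m > 0" "r > 0"
  shows "degree (geom_poly r m) = (r - 1) * m"
proof (rule antisym)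
  show "degree (geom_poly r m) \<le> (r - 1) * m"
  proof (rule degree_le, intro allI impI)
    fix k assume "(r - 1) * m < k"
    then have "k \<notin> (\<lambda>i. i * m) ` {..<r}" using assms by (auto simp: Suc_le_eq dest!: Suc_leI)
    then show "Polynomial.coeff (geom_poly r m) k = 0" using assms by (simp add: coeff_geom_poly)
  qed
  show "(r - 1) * m \<le> degree (geom_poly r m)"
    by (rule le_degree) (use assms in \<open>simp add: coeff_geom_poly\<close>)
qed

section \<open>The class bound\<close>

abbreviation cyc_prod :: "('a, 'b) monoid_scheme \<Rightarrow> nat \<Rightarrow> ('a \<Rightarrow> 'a) \<Rightarrow> 'a \<Rightarrow> 'a" where
  "cyc_prod G n \<alpha> x \<equiv> ordered_prod G (\<lambda>i. (\<alpha> ^^ i) (x [^]\<^bsub>G\<^esub> Polynomial.coeff (cyclotomic_poly n) i))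
     (degree (cyclotomic_poly n))"

context group
begin

lemma ordered_prod_closed:
  "(\<And>i. f i \<in> carrier G) \<Longrightarrow> ordered_prod G f n \<in> carrier G"
  by (induction n) auto

lemma ordered_prod_shift:
  "(\<And>i. f i \<in> carrier G) \<Longrightarrow> ordered_prod G f (Suc n) = f 0 \<otimes> ordered_prod G (\<lambda>i. f (Suc i)) n"
  by (induction n) (auto simp: m_assoc ordered_prod_closed)

lemma ordered_prod_sparse:
  assumes f: "\<And>i. f i \<in> carrier G" "\<And>j. \<not> m dvd j \<Longrightarrow> f j = \<one>" and m: "m > 0"
  shows "ordered_prod G f (k * m) = ordered_prod G (\<lambda>i. f (i * m)) k"
proof (induction k)
  case (Suc k)
  have "ordered_prod G f (k * m + j) = ordered_prod G f (k * m)" if "j < m" for j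
    using that
  proof (induction j)
    case (Suc j)
    have "\<not> m dvd k * m + Suc j" using Suc.prems by (metis dvd_add_right_iff dvd_triv_right nat_dvd_not_less zero_less_Suc)
    then show ?case using Suc f(2) by (simp add: ordered_prod_closed f)
  qed simp
  from this[of "m - 1"] have "ordered_prod G f (k * m + (m - 1)) = ordered_prod G f (k * m)" using m by simp
  moreover have e: "Suc k * m = Suc (k * m + (m - 1))" using m by simp
  have "ordered_prod G f (Suc k * m) = ordered_prod G f (k * m + (m - 1)) \<otimes> f (Suc k * m)"
    by (simp only: e ordered_prod.simps)
  ultimately show ?case using Suc by simp
qed simp

text \<open>An abelian factor forgets the order of the product; here the noncommutative cyclotomic
  relation becomes a polynomial one.\<close>

lemma gcl_ordered_prod:
  assumes "\<And>k. f k \<in> lcs G i"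
  shows "ordered_prod G f n \<in> lcs G i \<and> gcl i (ordered_prod G f n) = finprod (gr i) (\<lambda>k. gcl i (f k)) {..n}"
proof (induction n)
  interpret A: comm_group "gr i" by (rule comm_group_gr)
  case 0
  show ?case using assms by simp
next
  interpret A: comm_group "gr i" by (rule comm_group_gr)
  case (Suc n)
  have "finprod (gr i) (\<lambda>k. gcl i (f k)) {..Suc n} = gcl i (f (Suc n)) \<otimes>\<^bsub>gr i\<^esub> finprod (gr i) (\<lambda>k. gcl i (f k)) {..n}"
    using assms by (intro A.finprod_Suc) auto
  moreover have "finprod (gr i) (\<lambda>k. gcl i (f k)) {..n} \<in> carrier (gr i)" using assms by auto
  ultimately show ?case
    using Suc assms[of "Suc n"] by (simp add: gcl_mult lcs_mult A.m_comm)
qed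

end

section \<open>Integer polynomials in an endomorphism, acting on the factors\<close>

context group_endo
begin

text \<open>Says that f(\<beta>) kills the class of \<open>x\<close>. All upper limits beyond the
  degree are demanded, so that polynomials of different degrees can be brought to a common
  range.\<close>

definition annihilates :: "nat \<Rightarrow> 'a \<Rightarrow> int poly \<Rightarrow> bool" where
  "annihilates i x f \<longleftrightarrow> (\<forall>n \<ge> degree f.
     finprod (gr i) (\<lambda>k. gcl i ((\<beta> ^^ k) (x [^] Polynomial.coeff f k))) {..n} = \<one>\<^bsub>gr i\<^esub>)"

lemma lcs_int_pow: "x \<in> lcs G i \<Longrightarrow> x [^] (c::int) \<in> lcs G i"
  by (rule subgroup_int_pow_closed[OF lcs_subgroup])

lemma gcl_int_pow: "x \<in> lcs G i \<Longrightarrow> gcl i (x [^] (c::int)) = gcl i x [^]\<^bsub>gr i\<^esub> c"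
proof -
  assume x: "x \<in> lcs G i"
  interpret A: comm_group "gr i" by (rule comm_group_gr)
  show ?thesis
  proof (cases c rule: int_cases2)
    case (nonneg n)
    then show ?thesis using gcl_pow[OF x] by (simp add: int_pow_int)
  next
    case (nonpos n)
    then show ?thesis using gcl_pow[OF x, of n] gcl_inv[OF lcs_pow[OF x]] x lcs_carrier[OF x]
      by (simp add: int_pow_neg int_pow_int A.int_pow_neg)
  qed
qed

context
  fixes i :: nat and x :: 'a
  assumes x: "x \<in> lcs G i"
begin

lemma term_lcs: "(\<beta> ^^ k) (x [^] (c::int)) \<in> lcs G i"
  by (intro beta_pow_lcs lcs_int_pow x)

lemma gcl_term: "gcl i ((\<beta> ^^ k) (x [^] (c::int))) = gcl i ((\<beta> ^^ k) x) [^]\<^bsub>gr i\<^esub> c"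
  using beta_pow_int_pow[OF lcs_carrier[OF x]] gcl_int_pow[OF beta_pow_lcs[OF x]] by simp

lemma gcl_beta_closed: "gcl i ((\<beta> ^^ k) x) \<in> carrier (gr i)"
  by (intro gcl_closed beta_pow_lcs x)

lemma annihilates_iff: "annihilates i x f \<longleftrightarrow> (\<forall>n \<ge> degree f.
     finprod (gr i) (\<lambda>k. gcl i ((\<beta> ^^ k) x) [^]\<^bsub>gr i\<^esub> Polynomial.coeff f k) {..n} = \<one>\<^bsub>gr i\<^esub>)"
  unfolding annihilates_def gcl_term ..

lemma annihilates_0: "annihilates i x 0"
  unfolding annihilates_iff
proof (intro allI impI)
  interpret A: comm_group "gr i" by (rule comm_group_gr)
  fix n
  show "finprod (gr i) (\<lambda>k. gcl i ((\<beta> ^^ k) x) [^]\<^bsub>gr i\<^esub> Polynomial.coeff (0 :: int poly) k) {..n} = \<one>\<^bsub>gr i\<^esub>" by simp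
qed

lemma annihilates_smult:
  assumes "annihilates i x f"
  shows "annihilates i x (Polynomial.smult c f)"
  unfolding annihilates_iff
proof (intro allI impI)
  interpret A: comm_group "gr i" by (rule comm_group_gr)
  fix n assume n: "degree (Polynomial.smult c f) \<le> n"
  let ?F = "\<lambda>f. finprod (gr i) (\<lambda>k. gcl i ((\<beta> ^^ k) x) [^]\<^bsub>gr i\<^esub> Polynomial.coeff f k) {..n}"
  show "?F (Polynomial.smult c f) = \<one>\<^bsub>gr i\<^esub>"
  proof (cases "c = 0")
    case False
    then have n: "degree f \<le> n" using n by simp
    have "?F (Polynomial.smult c f) = finprod (gr i) (\<lambda>k. (gcl i ((\<beta> ^^ k) x) [^]\<^bsub>gr i\<^esub> Polynomial.coeff f k) [^]\<^bsub>gr i\<^esub> c) {..n}"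
      using gcl_beta_closed by (simp add: A.int_pow_pow mult.commute)
    also have "\<dots> = ?F f [^]\<^bsub>gr i\<^esub> c"
    proof (induction n)
      case (Suc n)
      then show ?case using gcl_beta_closed by (simp add: A.int_pow_distrib del: funpow.simps)
    qed (use gcl_closed[OF x] in simp)
    finally show ?thesis using assms n by (simp add: annihilates_iff)
  qed simp
qed

lemma annihilates_add:
  assumes f: "annihilates i x f" and g: "annihilates i x g"
  shows "annihilates i x (f + g)"
proof -
  interpret A: comm_group "gr i" by (rule comm_group_gr)
  let ?F = "\<lambda>(f::int poly) n. finprod (gr i) (\<lambda>k. gcl i ((\<beta> ^^ k) x) [^]\<^bsub>gr i\<^esub> Polynomial.coeff f k) {..n}"
  have add: "?F (f + g) n = ?F f n \<otimes>\<^bsub>gr i\<^esub> ?F g n" for n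
    using gcl_beta_closed by (simp add: A.int_pow_mult)
  have ext: "?F f n = ?F f m" if "degree f \<le> n" "n \<le> m" for f :: "int poly" and n m
    by (rule A.finprod_mono_neutral_cong_left)
      (use that gcl_beta_closed in \<open>auto simp: coeff_eq_0\<close>)
  show ?thesis unfolding annihilates_iff
  proof (intro allI impI)
    fix n assume n: "degree (f + g) \<le> n"
    let ?m = "max n (max (degree f) (degree g))"
    have "?F (f + g) n = ?F (f + g) ?m" by (rule ext) (use n in auto)
    also have "\<dots> = \<one>\<^bsub>gr i\<^esub>"
      unfolding add using f g unfolding annihilates_iff by simp
    finally show "?F (f + g) n = \<one>\<^bsub>gr i\<^esub>" .
  qed
qed

lemma annihilates_pCons0:
  assumes "annihilates i x f"
  shows "annihilates i x (pCons 0 f)"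
  unfolding annihilates_def
proof (intro allI impI)
  interpret A: comm_group "gr i" by (rule comm_group_gr)
  fix n assume n: "degree (pCons 0 f) \<le> n"
  let ?t = "\<lambda>f k. gcl i ((\<beta> ^^ k) (x [^] Polynomial.coeff f k))"
  show "finprod (gr i) (?t (pCons 0 f)) {..n} = \<one>\<^bsub>gr i\<^esub>"
  proof (cases "f = 0")
    case True
    have b1: "(\<beta> ^^ k) \<one> = \<one>" for k using hom_one[OF beta_pow_hom is_group is_group] .
    have "Polynomial.coeff (pCons 0 f) k = 0" for k using True by simp
    then show ?thesis using b1 by simp
  next
    case False
    then have "Suc (degree f) \<le> n" using n by simp
    then obtain m where m: "n = Suc m" "degree f \<le> m" by (cases n) auto
    have "finprod (gr i) (?t (pCons 0 f)) {..Suc m} =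
        finprod (gr i) (\<lambda>k. ?t (pCons 0 f) (Suc k)) {..m} \<otimes>\<^bsub>gr i\<^esub> ?t (pCons 0 f) 0"
      using term_lcs by (intro A.finprod_Suc2) auto
    also have "?t (pCons 0 f) 0 = \<one>\<^bsub>gr i\<^esub>" by simp
    also have "finprod (gr i) (\<lambda>k. ?t (pCons 0 f) (Suc k)) {..m} =
        finprod (gr i) (\<lambda>k. gcl i (\<beta> ((\<beta> ^^ k) (x [^] Polynomial.coeff f k)))) {..m}" by simp
    also have "\<dots> = \<one>\<^bsub>gr i\<^esub>"
      by (rule lin_finprod[OF lin_beta]) (use term_lcs assms m in \<open>auto simp: annihilates_def\<close>)
    finally show ?thesis using m by simp
  qed
qed

text \<open>The polynomials killing a class form an ideal; this is how the relation passes from the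
  cyclotomic polynomial to its multiple \<open>geom_poly\<close>.\<close>

lemma annihilates_mult: "annihilates i x f \<Longrightarrow> annihilates i x (q * f)"
proof (induction q)
  case (pCons c q)
  then show ?case unfolding mult_pCons_left
    by (intro annihilates_add annihilates_smult annihilates_pCons0)
qed (simp add: annihilates_0)

lemma annihilates_ordered_prod:
  assumes "ordered_prod G (\<lambda>k. (\<beta> ^^ k) (x [^] Polynomial.coeff f k)) (degree f) = \<one>"
  shows "annihilates i x f"
  unfolding annihilates_def
proof (intro allI impI)
  interpret A: comm_group "gr i" by (rule comm_group_gr)
  fix n assume n: "degree f \<le> n"
  let ?t = "\<lambda>k. gcl i ((\<beta> ^^ k) (x [^] Polynomial.coeff f k))"
  have "finprod (gr i) ?t {..degree f} = \<one>\<^bsub>gr i\<^esub>"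
    using gcl_ordered_prod[of "\<lambda>k. (\<beta> ^^ k) (x [^] Polynomial.coeff f k)" i "degree f"] term_lcs assms by simp
  moreover have "finprod (gr i) ?t {..degree f} = finprod (gr i) ?t {..n}"
    by (rule A.finprod_mono_neutral_cong_left)
      (use n term_lcs hom_one[OF beta_pow_hom is_group is_group] in \<open>auto simp: coeff_eq_0\<close>)
  ultimately show "finprod (gr i) ?t {..n} = \<one>\<^bsub>gr i\<^esub>" by simp
qed

lemma annihilates_geom_poly:
  assumes "annihilates i x (geom_poly r m)" and r: "r > 0" and m: "m > 0"
  shows "finprod (gr i) (\<lambda>k. gcl i (((\<beta> ^^ m) ^^ k) x)) {..<r} = \<one>\<^bsub>gr i\<^esub>"
proof -
  interpret A: comm_group "gr i" by (rule comm_group_gr)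
  let ?t = "\<lambda>k. gcl i ((\<beta> ^^ k) x) [^]\<^bsub>gr i\<^esub> Polynomial.coeff (geom_poly r m) k"
  let ?I = "(\<lambda>k. k * m) ` {..<r}"
  have sub: "?I \<subseteq> {..(r - 1) * m}" using r by auto
  have "\<one>\<^bsub>gr i\<^esub> = finprod (gr i) ?t {..(r - 1) * m}"
    using assms degree_geom_poly[OF m r] by (simp add: annihilates_iff)
  also have "\<dots> = finprod (gr i) (\<lambda>k. gcl i ((\<beta> ^^ k) x)) ?I"
    by (rule A.finprod_mono_neutral_cong_right)
      (use sub gcl_beta_closed in \<open>auto simp: coeff_geom_poly[OF m] A.int_pow_1\<close>)
  also have "\<dots> = finprod (gr i) (\<lambda>k. gcl i ((\<beta> ^^ (k * m)) x)) {..<r}"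
    by (rule A.finprod_reindex) (use gcl_beta_closed m in \<open>auto intro: inj_onI\<close>)
  finally show ?thesis by (simp add: funpow_mult mult.commute)
qed

end

end

text \<open>The geometric sum in X^(n div r) kills every class; read in powers of
  \<open>\<alpha> ^^ (n div r)\<close> it is the norm condition for the prime
  \<open>r\<close>.\<close>

lemma (in group) sectional_endo_cyclotomic:
  assumes hom: "\<alpha> \<in> hom G G" and n: "n > 1" and r: "prime r" "r dvd n"
    and cyc: "\<And>x. x \<in> carrier G \<Longrightarrow> cyc_prod G n \<alpha> x = \<one>"
  shows "sectional_endo G (\<alpha> ^^ (n div r)) r"
proof -
  interpret E: group_endo G \<alpha> using hom by unfold_locales
  have m: "n div r > 0" using n r by (auto simp: div_greater_zero_iff dvd_imp_le prime_gt_0_nat)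
  obtain q where q: "geom_poly r (n div r) = cyclotomic_poly n * q"
    using cyclotomic_dvd_geom_poly[OF n r] by blast
  show ?thesis
  proof unfold_locales
    show "\<alpha> ^^ (n div r) \<in> hom G G" by (rule E.beta_pow_hom)
    show "prime r" by fact
    fix x i assume x: "x \<in> lcs G i"
    have "E.annihilates i x (cyclotomic_poly n)"
      by (rule E.annihilates_ordered_prod[OF x cyc[OF lcs_carrier[OF x]]])
    then have "E.annihilates i x (geom_poly r (n div r))"
      unfolding q using E.annihilates_mult[OF x] by (metis mult.commute)
    then show "finprod (gr i) (\<lambda>k. gcl i (((\<alpha> ^^ (n div r)) ^^ k) x)) {..<r} = \<one>\<^bsub>gr i\<^esub>"
      by (rule E.annihilates_geom_poly[OF x _ prime_gt_0_nat[OF r(1)] m])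
  qed
qed

text \<open>With ratio at least 2, a geometric sum of s terms is at most the s-th power of the
  ratio; for p = 2 there is a single term, equal to 1.\<close>

lemma sum_powers_le:
  assumes "p \<ge> (2::nat)"
  shows "(\<Sum>i<2 ^ (p - 1) - 1. (p - 1) ^ i) \<le> (p - 1) ^ (2 ^ (p - 1))"
proof (cases "p = 2")
  case False
  then have q: "p - 1 \<ge> 2" using assms by simp
  have "(\<Sum>i<s. (p - 1) ^ i) \<le> (p - 1) ^ s" for s
  proof (induction s)
    case (Suc s)
    have "(\<Sum>i<Suc s. (p - 1) ^ i) \<le> 2 * (p - 1) ^ s" using Suc by simp
    also have "\<dots> \<le> (p - 1) * (p - 1) ^ s" using q by (rule mult_right_mono) simp
    finally show ?case by simp
  qed simp
  then have "(\<Sum>i<2 ^ (p - 1) - 1. (p - 1) ^ i) \<le> (p - 1) ^ (2 ^ (p - 1) - 1)" .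
  also have "\<dots> \<le> (p - 1) ^ (2 ^ (p - 1))" using q by (intro power_increasing) auto
  finally show ?thesis .
qed simp

text \<open>Lets the smaller prime divisors of \<open>n\<close> share the bound of the largest
  one.\<close>

lemma class_bound_mono:
  assumes "r \<ge> (2::nat)" "r \<le> p"
  shows "(r - 1) ^ (2 ^ (r - 1)) \<le> (p - 1) ^ (2 ^ (p - 1))"
proof -
  have "(r - 1) ^ (2 ^ (r - 1)) \<le> (p - 1) ^ (2 ^ (r - 1))" using assms by (intro power_mono) auto
  also have "\<dots> \<le> (p - 1) ^ (2 ^ (p - 1))" using assms by (intro power_increasing) auto
  finally show ?thesis .
qed

section \<open>Invariant subgroups and the two cases of the class bound\<close>

lemma (in group) lcs_subgroup_mono:
  assumes "subgroup N G" "subgroup M G" "N \<subseteq> M"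
  shows "lcs (G\<lparr>carrier := N\<rparr>) i \<subseteq> lcs (G\<lparr>carrier := M\<rparr>) i"
proof (induction i)
  case 0
  then show ?case using assms by simp
next
  case (Suc i)
  have step: "lcs (G\<lparr>carrier := K\<rparr>) (Suc i) = generate G (comm_set G (lcs (G\<lparr>carrier := K\<rparr>) i) K) \<and>
      comm_set G (lcs (G\<lparr>carrier := K\<rparr>) i) K \<subseteq> K" if K: "subgroup K G" for K
  proof -
    interpret K: group "G\<lparr>carrier := K\<rparr>" using subgroup_imp_group[OF K] .
    have sub: "lcs (G\<lparr>carrier := K\<rparr>) i \<subseteq> K" using K.lcs_carrier[of _ i] by auto
    have "comm_set (G\<lparr>carrier := K\<rparr>) (lcs (G\<lparr>carrier := K\<rparr>) i) K = comm_set G (lcs (G\<lparr>carrier := K\<rparr>) i) K"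
    proof -
      have "(x = a \<otimes> b \<otimes> inv\<^bsub>G\<lparr>carrier := K\<rparr>\<^esub> a \<otimes> inv\<^bsub>G\<lparr>carrier := K\<rparr>\<^esub> b \<and> a \<in> lcs (G\<lparr>carrier := K\<rparr>) i \<and> b \<in> K) \<longleftrightarrow>
          (x = a \<otimes> b \<otimes> inv a \<otimes> inv b \<and> a \<in> lcs (G\<lparr>carrier := K\<rparr>) i \<and> b \<in> K)" for x a b
        using sub m_inv_consistent[OF K] by auto
      then show ?thesis unfolding comm_set_def by simp
    qed
    moreover have "comm_set G (lcs (G\<lparr>carrier := K\<rparr>) i) K \<subseteq> K"
      unfolding comm_set_def using sub K
      by (auto simp: subset_iff intro!: subgroup.m_closed[OF K] subgroup.m_inv_closed[OF K])
    ultimately show ?thesis unfolding lcs.simps(2) using generate_consistent[OF _ K] by simp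
  qed
  have "comm_set G (lcs (G\<lparr>carrier := N\<rparr>) i) N \<subseteq> comm_set G (lcs (G\<lparr>carrier := M\<rparr>) i) M"
    using Suc assms(3) by (rule comm_set_mono)
  then show ?case using step[OF assms(1)] step[OF assms(2)] mono_generate by simp
qed

text \<open>Since cyclotomic polynomials are monic, finitely many conjugates of \<open>S\<close> generate an
\<open>\<alpha>\<close>-invariant subgroup.\<close>

lemma (in group) cyclotomic_invariant_subgroup:
  assumes hom: "\<alpha> \<in> hom G G" and n: "n > 1" and S: "S \<subseteq> carrier G"
    and cyc: "\<And>x. x \<in> carrier G \<Longrightarrow> cyc_prod G n \<alpha> x = \<one>"
    and T: "T = (\<Union>i<degree (cyclotomic_poly n). (\<alpha> ^^ i) ` S)"
  shows "T \<subseteq> carrier G" "S \<subseteq> T" "\<alpha> ` generate G T \<subseteq> generate G T"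
proof -
  interpret E: group_endo G \<alpha> using hom by unfold_locales
  let ?e = "degree (cyclotomic_poly n)"
  have e: "?e > 0" using degree_cyclotomic_pos[OF n] .
  show Tc: "T \<subseteq> carrier G" unfolding T using S by auto
  show "S \<subseteq> T" unfolding T using e by (force intro: bexI[of _ 0])
  interpret h: group_hom G G \<alpha> using hom by unfold_locales
  have Tg: "subgroup (generate G T) G" by (rule generate_is_subgroup[OF Tc])
  have "\<alpha> y \<in> generate G T" if yT: "y \<in> T" for y
  proof -
    obtain i s where y: "y = (\<alpha> ^^ i) s" "s \<in> S" "i < ?e" using yT unfolding T by blast
    have s: "s \<in> carrier G" using y S by blast
    show ?thesis
    proof (cases "Suc i < ?e")
      case True
      have "\<alpha> y = (\<alpha> ^^ Suc i) s" using y by simp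
      then have "\<alpha> y \<in> T" unfolding T using True y(2) by blast
      then show ?thesis by (rule generate.incl)
    next
      case False
      then have ei: "?e = Suc i" using y(3) by simp
      let ?f = "\<lambda>k. (\<alpha> ^^ k) (s [^] Polynomial.coeff (cyclotomic_poly n) k)"
      have fc: "?f k \<in> carrier G" for k using s by simp
      have "ordered_prod G ?f k \<in> generate G T" if "k \<le> i" for k
        using that
      proof (induction k)
        case 0
        have "s \<in> T" unfolding T using e y(2) by (force intro: bexI[of _ 0])
        then have "s \<in> generate G T" by (rule generate.incl)
        then show ?case using subgroup_int_pow_closed[OF Tg] by simp
      next
        case (Suc k)
        have "(\<alpha> ^^ Suc k) s \<in> T" unfolding T using Suc.prems ei y(2) by (auto intro!: bexI[of _ "Suc k"])
        then have "(\<alpha> ^^ Suc k) s \<in> generate G T" by (rule generate.incl)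
        then have "?f (Suc k) \<in> generate G T"
          unfolding E.beta_pow_int_pow[OF s] by (rule subgroup_int_pow_closed[OF Tg])
        then show ?case using Suc subgroup.m_closed[OF Tg] by simp
      qed
      then have P: "ordered_prod G ?f i \<in> generate G T" by simp
      have "ordered_prod G ?f i \<otimes> ?f (Suc i) = \<one>" using cyc[OF s] unfolding ei by simp
      \<comment> \<open>The leading coefficient is 1, so the last factor is \<alpha> y itself, and
        the relation expresses its inverse through earlier factors, which lie in the
        subgroup.\<close>
      moreover have "?f (Suc i) = \<alpha> y"
        using lead_coeff_cyclotomic[OF n] s y(1) unfolding ei by (simp add: int_pow_1)
      ultimately have "inv (\<alpha> y) = ordered_prod G ?f i"
        using fc[of "Suc i"] ordered_prod_closed[of ?f, OF fc] by (intro inv_equality) auto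
      then have "\<alpha> y = inv (ordered_prod G ?f i)" using y(1) s inv_inv[of "\<alpha> y"] by simp
      then show ?thesis using subgroup.m_inv_closed[OF Tg P] by simp
    qed
  qed
  then have "\<alpha> ` T \<subseteq> generate G T" by blast
  then have "generate G (\<alpha> ` T) \<subseteq> generate G T" by (rule generate_subgroup_incl[OF _ Tg])
  then show "\<alpha> ` generate G T \<subseteq> generate G T" unfolding h.generate_img[OF Tc] .
qed

lemma (in group) cyclotomic_restrict:
  assumes M: "subgroup M G"
    and cyc: "\<And>x. x \<in> carrier G \<Longrightarrow> ordered_prod G (\<lambda>i. (\<alpha> ^^ i) (x [^] c i)) e = \<one>"
    and x: "x \<in> M"
  shows "ordered_prod (G\<lparr>carrier := M\<rparr>) (\<lambda>i. (\<alpha> ^^ i) (x [^]\<^bsub>G\<lparr>carrier := M\<rparr>\<^esub> (c i :: int))) e = \<one>\<^bsub>G\<lparr>carrier := M\<rparr>\<^esub>"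
proof -
  have "ordered_prod (G\<lparr>carrier := M\<rparr>) f k = ordered_prod G f k" for f k
    by (induction k) auto
  then show ?thesis using cyc[of x] int_pow_consistent[OF M x] subgroup.mem_carrier[OF M x] by simp
qed

text \<open>The invariant subgroup is still finitely generated, so local nilpotency applies to it;
  the number of its generators is recorded for Khukhro's bound.\<close>

lemma (in group) cyclotomic_invariant_extension:
  assumes hom: "\<alpha> \<in> hom G G" and n: "n > 1" and S: "finite S" "S \<subseteq> carrier G"
    and nil: "locally_nilpotent G" and cyc: "\<forall>x \<in> carrier G. cyc_prod G n \<alpha> x = \<one>"
  obtains T c where "subgroup (generate G T) G" "generate G S \<subseteq> generate G T"
    "\<alpha> \<in> hom (G\<lparr>carrier := generate G T\<rparr>) (G\<lparr>carrier := generate G T\<rparr>)"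
    "\<forall>x \<in> generate G T. cyc_prod (G\<lparr>carrier := generate G T\<rparr>) n \<alpha> x = \<one>"
    "lcs (G\<lparr>carrier := generate G T\<rparr>) c = {\<one>}"
    "finite T" "card T \<le> degree (cyclotomic_poly n) * card S"
proof -
  let ?e = "degree (cyclotomic_poly n)"
  define T where "T = (\<Union>i<?e. (\<alpha> ^^ i) ` S)"
  note T = cyclotomic_invariant_subgroup[OF hom n S(2) cyc[rule_format] T_def]
  let ?H = "G\<lparr>carrier := generate G T\<rparr>"
  have M: "subgroup (generate G T) G" by (rule generate_is_subgroup[OF T(1)])
  have finT: "finite T" using S(1) by (simp add: T_def)
  obtain c where c: "lcs ?H c = {\<one>}"
    using nil finT T(1) unfolding locally_nilpotent_def nilpotent_class_le_def by fastforce
  have "\<alpha> \<in> hom ?H ?H"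
    using hom T(3) subgroup.mem_carrier[OF M] by (auto simp: hom_def Pi_def)
  moreover have "\<forall>x \<in> generate G T. cyc_prod ?H n \<alpha> x = \<one>"
    using cyclotomic_restrict[OF M cyc[rule_format]] by simp
  moreover have "card T \<le> ?e * card S"
  proof -
    have "card T \<le> (\<Sum>i<?e. card ((\<alpha> ^^ i) ` S))"
      unfolding T_def by (rule card_UN_le) simp
    also have "\<dots> \<le> (\<Sum>i<?e. card S)" by (intro sum_mono card_image_le S(1))
    finally show ?thesis by simp
  qed
  ultimately show ?thesis using finT that[OF M mono_generate[OF T(2)] _ _ c] by simp
qed

lemma (in group) coprime_exponents_trivial:
  assumes "x \<in> carrier G" "x [^] (a::nat) = \<one>" "x [^] (b::nat) = \<one>" "coprime a b"
  shows "x = \<one>"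
proof -
  have "ord x dvd a" "ord x dvd b" using assms pow_eq_id by auto
  then have "ord x = 1" using assms(4) by (metis coprime_common_divisor nat_dvd_1_iff_1)
  then show ?thesis using ord_eq_1[OF assms(1)] by simp
qed

text \<open>The cyclotomic polynomial of p^(a + 1) is that of \<open>p\<close> in X^(p^a), so
  dropping trivial factors turns the relation for \<alpha> into one for its power. That relation at
  an element and at its image gives p-periodicity in the group itself and not merely on
  factors.\<close>

lemma (in group) cyclotomic_prime_power_aut:
  assumes cyc: "cyclotomic_aut G (p ^ Suc a) \<alpha>" and p: "prime p"
  shows "\<alpha> ^^ (p ^ a) \<in> hom G G"
    and "x \<in> carrier G \<Longrightarrow> cyc_prod G p (\<alpha> ^^ (p ^ a)) x = \<one>"
    and "x \<in> carrier G \<Longrightarrow> ((\<alpha> ^^ (p ^ a)) ^^ p) x = x"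
proof -
  have hom: "\<alpha> \<in> hom G G" using cyc by (simp add: cyclotomic_aut_def iso_def)
  interpret E: group_endo G \<alpha> using hom by unfold_locales
  have p1: "p > 1" "p > 0" using prime_gt_1_nat[OF p] by auto
  let ?m = "p ^ a" let ?\<beta> = "\<alpha> ^^ ?m"
  have m: "?m > 0" using p1 by simp
  show "?\<beta> \<in> hom G G" by (rule E.beta_pow_hom)
  have cp: "cyclotomic_poly p = geom_poly p 1" using cyclotomic_prime_power[OF p, of 0] by simp
  have deg: "degree (cyclotomic_poly p) = p - 1" unfolding cp using degree_geom_poly[of 1 p] p1 by simp
  have prod: "ordered_prod G (\<lambda>i. (?\<beta> ^^ i) x) (p - 1) = \<one>" if x: "x \<in> carrier G" for x
  proof -
    let ?f = "\<lambda>k. (\<alpha> ^^ k) (x [^] Polynomial.coeff (geom_poly p ?m) k)"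
    have b1: "(\<alpha> ^^ k) \<one> = \<one>" for k using hom_one[OF E.beta_pow_hom is_group is_group] .
    have "\<one> = ordered_prod G ?f ((p - 1) * ?m)"
      using cyc x cyclotomic_prime_power[OF p, of a] degree_geom_poly[OF m p1(2)]
      unfolding cyclotomic_aut_def by simp
    also have "\<dots> = ordered_prod G (\<lambda>i. ?f (i * ?m)) (p - 1)"
    proof (rule ordered_prod_sparse[OF _ _ m])
      show "?f j = \<one>" if "\<not> ?m dvd j" for j
      proof -
        have "j \<notin> (\<lambda>i. i * ?m) ` {..<p}" using that by auto
        then show ?thesis using b1 by (simp add: coeff_geom_poly[OF m])
      qed
    qed (use x in auto)
    also have "ordered_prod G (\<lambda>i. ?f (i * ?m)) k = ordered_prod G (\<lambda>i. (?\<beta> ^^ i) x) k" if "k < p" for k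
      using that by (induction k) (use m p1 x in \<open>auto simp: coeff_geom_poly[OF m] funpow_mult int_pow_1 image_iff mult.commute\<close>)
    from this[of "p - 1"] have "ordered_prod G (\<lambda>i. ?f (i * ?m)) (p - 1) = ordered_prod G (\<lambda>i. (?\<beta> ^^ i) x) (p - 1)"
      using p1 by simp
    finally show ?thesis by simp
  qed
  show "cyc_prod G p ?\<beta> x = \<one>"
    if x: "x \<in> carrier G"
  proof -
    have "ordered_prod G (\<lambda>i. (?\<beta> ^^ i) (x [^] Polynomial.coeff (cyclotomic_poly p) i)) k = ordered_prod G (\<lambda>i. (?\<beta> ^^ i) x) k"
      if "k < p" for k
    proof -
      have c1: "Polynomial.coeff (cyclotomic_poly p) j = 1" if "j < p" for j
        using coeff_geom_poly[of 1 p j] that unfolding cp by (auto simp: image_iff)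
      show ?thesis using that by (induction k) (use p1 x in \<open>auto simp: c1 int_pow_1\<close>)
    qed
    then show ?thesis using prod[OF x] p1 unfolding deg by simp
  qed
  show "(?\<beta> ^^ p) x = x" if x: "x \<in> carrier G"
  proof -
    interpret F: group_endo G ?\<beta> using E.beta_pow_hom by unfold_locales
    let ?g = "\<lambda>i. (?\<beta> ^^ Suc i) x"
    obtain q where q: "p - 1 = Suc q" "p = Suc (Suc q)" using p1 by (cases p; cases "p - 1") auto
    have g: "?g i \<in> carrier G" for i using F.beta_pow_closed[OF x] .
    let ?P = "ordered_prod G ?g q"
    have P: "?P \<in> carrier G" by (rule ordered_prod_closed[OF g])
    have "\<one> = ordered_prod G (\<lambda>i. (?\<beta> ^^ i) x) (Suc q)" using prod[OF x] q by simp
    also have "\<dots> = (?\<beta> ^^ 0) x \<otimes> ?P" by (rule ordered_prod_shift) (rule F.beta_pow_closed[OF x])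
    finally have 1: "x \<otimes> ?P = \<one>" by simp
    have "(\<lambda>i. (?\<beta> ^^ i) (?\<beta> x)) = ?g" by (simp add: funpow_swap1)
    then have "ordered_prod G ?g (Suc q) = \<one>" using prod[OF F.beta_closed[OF x]] q by simp
    then have "?P \<otimes> ?g (Suc q) = \<one>" by simp
    then have "inv (?g (Suc q)) = ?P" using P g[of "Suc q"] by (intro inv_equality) auto
    then have "?g (Suc q) = inv ?P" using inv_inv[OF g[of "Suc q"]] by simp
    also have "\<dots> = x" using 1 P x by (intro inv_equality) auto
    finally show ?thesis unfolding q(2) .
  qed
qed

theorem theorem7p9:
  fixes G :: "('a, 'b) monoid_scheme" and n p k :: nat and \<alpha> :: "'a \<Rightarrow> 'a"
    and C :: "nat \<Rightarrow> nat \<Rightarrow> nat" and N :: "'a set"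
  assumes "khukhro_bound C"
    and "n > 1"
    and "group G" and "locally_nilpotent G"
    and "cyclotomic_aut G n \<alpha>"
    and "prime p" and "p dvd n" and "\<forall>q. prime q \<and> q dvd n \<longrightarrow> q \<le> p"
    and "k_generated G k N"
  shows "nilpotent_class_le (G\<lparr>carrier := N\<rparr>)
           (max ((p - 1) ^ (2 ^ (p - 1))) (C ((2 * p - 3) * k) p))"
proof -
  interpret G: group G by fact
  let ?c = "(p - 1) ^ (2 ^ (p - 1))" and ?d = "C ((2 * p - 3) * k) p"
  have p2: "p \<ge> 2" using prime_ge_2_nat[OF assms(6)] .
  have hom: "\<alpha> \<in> hom G G" using assms(5) by (simp add: cyclotomic_aut_def iso_def)
  have cyc: "\<forall>x \<in> carrier G. cyc_prod G n \<alpha> x = \<one>\<^bsub>G\<^esub>"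
    using assms(5) by (simp add: cyclotomic_aut_def)
  obtain S where S: "finite S" "card S \<le> k" "S \<subseteq> carrier G" "N = generate G S"
    using assms(9) unfolding k_generated_def by blast
  have Ng: "subgroup N G" unfolding S(4) by (rule G.generate_is_subgroup[OF S(3)])
  interpret N: group "G\<lparr>carrier := N\<rparr>" by (rule G.subgroup_imp_group[OF Ng])
  \<comment> \<open>\<open>N\<close> need not be invariant, so the bound is shown for an invariant
    overgroup and inherited by \<open>N\<close>.\<close>
  have "\<exists>M. subgroup M G \<and> N \<subseteq> M \<and> lcs (G\<lparr>carrier := M\<rparr>) (max ?c ?d) \<subseteq> {\<one>\<^bsub>G\<^esub>}"
  proof (cases "\<exists>r. prime r \<and> r dvd n \<and> r \<noteq> p")
    case True
    then obtain r where r: "prime r" "r dvd n" "r \<noteq> p" by blast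
    have r2: "r \<ge> 2" "r \<le> p" using prime_ge_2_nat[OF r(1)] r assms(8) by auto
    obtain T c where T: "subgroup (generate G T) G" "N \<subseteq> generate G T"
      "\<alpha> \<in> hom (G\<lparr>carrier := generate G T\<rparr>) (G\<lparr>carrier := generate G T\<rparr>)"
      "\<forall>x \<in> generate G T. cyc_prod (G\<lparr>carrier := generate G T\<rparr>) n \<alpha> x = \<one>\<^bsub>G\<^esub>"
      "lcs (G\<lparr>carrier := generate G T\<rparr>) c = {\<one>\<^bsub>G\<^esub>}"
      "finite T" "card T \<le> degree (cyclotomic_poly n) * card S"
      unfolding S(4) by (rule G.cyclotomic_invariant_extension[OF hom assms(2) S(1,3) assms(4) cyc])
    let ?H = "G\<lparr>carrier := generate G T\<rparr>"
    interpret H: group ?H by (rule G.subgroup_imp_group[OF T(1)])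
    have c: "lcs ?H c = {\<one>\<^bsub>?H\<^esub>}" using T(5) by simp
    \<comment> \<open>One invariant subgroup serves both primes, so its term at \<open>?c\<close> is
      killed by a power of \<open>p\<close> and by a power of \<open>r\<close>.\<close>
    have exponent: "\<exists>m. \<forall>x \<in> lcs ?H ?c. x [^]\<^bsub>?H\<^esub> (q ^ m) = \<one>\<^bsub>?H\<^esub>"
      if q: "prime q" "q dvd n" "q \<le> p" for q
    proof -
      interpret E: sectional_endo ?H "\<alpha> ^^ (n div q)" q
        by (rule H.sectional_endo_cyclotomic[OF T(3) assms(2) q(1,2)]) (use T(4) in simp)
      have "(\<Sum>i<2 ^ (q - 1) - 1. (q - 1) ^ i) \<le> ?c"
        using sum_powers_le[OF prime_ge_2_nat[OF q(1)]] class_bound_mono[OF prime_ge_2_nat[OF q(1)] q(3)]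
        by (rule order_trans)
      then show ?thesis by (rule E.lcs_exponent[OF _ c])
    qed
    obtain a where a: "\<forall>x \<in> lcs ?H ?c. x [^]\<^bsub>?H\<^esub> (p ^ a) = \<one>\<^bsub>?H\<^esub>"
      using exponent[OF assms(6,7)] by blast
    obtain b where b: "\<forall>x \<in> lcs ?H ?c. x [^]\<^bsub>?H\<^esub> (r ^ b) = \<one>\<^bsub>?H\<^esub>"
      using exponent[OF r(1,2) r2(2)] by blast
    have cop: "coprime (p ^ a) (r ^ b)" using primes_coprime[OF assms(6) r(1)] r(3) by simp
    have "lcs ?H ?c \<subseteq> {\<one>\<^bsub>?H\<^esub>}"
      using H.coprime_exponents_trivial[OF H.lcs_carrier _ _ cop] a b by blast
    moreover have "lcs ?H (max ?c ?d) \<subseteq> lcs ?H ?c" by (rule H.lcs_antimono) simp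
    ultimately show ?thesis using T(1,2) by (intro exI[of _ "generate G T"]) auto
  next
    case False
    obtain a where a: "n = p ^ Suc a"
    proof -
      obtain i m where im: "n = p ^ i * m" "\<not> p dvd m"
        using prime_power_canonical[OF assms(6), of n] assms(2) by (metis less_trans mult.commute zero_less_one)
      have "m = 1"
      proof (rule ccontr)
        assume "m \<noteq> 1"
        then obtain q where "prime q" "q dvd m" using prime_factor_nat by blast
        then show False using False im by (metis dvd_mult)
      qed
      moreover have "i \<noteq> 0" using im assms(2) calculation by (intro notI) simp
      ultimately show ?thesis using im that by (cases i) auto
    qed
    \<comment> \<open>The overgroup is built from \<beta> and not from \<alpha>: the degree p - 1 of
      its polynomial makes the number of generators independent of \<open>a\<close>.\<close>
    define \<beta> where "\<beta> = \<alpha> ^^ (p ^ a)"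
    note \<beta> = G.cyclotomic_prime_power_aut[OF assms(5)[unfolded a] assms(6), folded \<beta>_def]
    have \<beta>2: "\<forall>x \<in> carrier G. cyc_prod G p \<beta> x = \<one>\<^bsub>G\<^esub>" using \<beta>(2) by blast
    have p1: "p > 1" using p2 by simp
    obtain T c where T: "subgroup (generate G T) G" "N \<subseteq> generate G T"
      "\<beta> \<in> hom (G\<lparr>carrier := generate G T\<rparr>) (G\<lparr>carrier := generate G T\<rparr>)"
      "\<forall>x \<in> generate G T. cyc_prod (G\<lparr>carrier := generate G T\<rparr>) p \<beta> x = \<one>\<^bsub>G\<^esub>"
      "lcs (G\<lparr>carrier := generate G T\<rparr>) c = {\<one>\<^bsub>G\<^esub>}"
      "finite T" "card T \<le> degree (cyclotomic_poly p) * card S"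
      unfolding S(4) by (rule G.cyclotomic_invariant_extension[OF \<beta>(1) p1 S(1,3) assms(4) \<beta>2])
    let ?M = "generate G T" let ?H = "G\<lparr>carrier := ?M\<rparr>"
    interpret H: group ?H by (rule G.subgroup_imp_group[OF T(1)])
    have c: "lcs ?H c = {\<one>\<^bsub>?H\<^esub>}" using T(5) by simp
    have \<beta>M: "\<beta> x \<in> ?M" if "x \<in> ?M" for x using hom_in_carrier[OF T(3)] that by simp
    have powM: "(\<beta> ^^ i) x \<in> ?M" if "x \<in> ?M" for i x
      using that \<beta>M by (induction i) auto
    have per: "(\<beta> ^^ p) x = x" if "x \<in> ?M" for x using \<beta>(3)[OF subgroup.mem_carrier[OF T(1) that]] .
    obtain q where q: "p = Suc q" using p1 by (cases p) auto
    \<comment> \<open>Invariance only maps \<open>?M\<close> into itself; periodicity supplies the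
      inverse \<open>\<beta> ^^ q\<close>.\<close>
    have "bij_betw \<beta> ?M ?M"
    proof (rule bij_betw_byWitness[of _ "\<beta> ^^ q"])
      show "\<forall>x\<in>?M. (\<beta> ^^ q) (\<beta> x) = x" "\<forall>x\<in>?M. \<beta> ((\<beta> ^^ q) x) = x"
        using per unfolding q by (simp_all add: funpow_swap1)
    qed (use \<beta>M powM in auto)
    then have autH: "cyclotomic_aut ?H p \<beta>"
      unfolding cyclotomic_aut_def iso_def using T(3,4) by simp
    have "card T \<le> degree (cyclotomic_poly p) * k"
      using T(7) S(2) by (meson mult_le_mono2 order_trans)
    also have "degree (cyclotomic_poly p) = p - 1"
      using cyclotomic_prime_power[OF assms(6), of 0] degree_geom_poly[of 1 p] p1 by simp
    \<comment> \<open>The count of conjugates is widened to the constant of the claim; p - 1 \<le> 2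
      p - 3 because p \<ge> 2.\<close>
    also have "(p - 1) * k \<le> (2 * p - 3) * k" using p2 by (intro mult_right_mono) auto
    finally have "card T \<le> (2 * p - 3) * k" .
    then have genH: "k_generated ?H ((2 * p - 3) * k) (carrier ?H)"
      unfolding k_generated_def using T(6) G.generate_consistent[OF _ T(1)] generate.incl[of _ T G]
      by (intro exI[of _ T]) auto
    \<comment> \<open>Here p div p = 1, so \<beta> itself is the endomorphism.\<close>
    interpret E: sectional_endo ?H "\<beta> ^^ (p div p)" p
      by (rule H.sectional_endo_cyclotomic[OF T(3) p1 assms(6) dvd_refl]) (use T(4) in simp)
    obtain m where m: "\<forall>x \<in> lcs ?H ?c. x [^]\<^bsub>?H\<^esub> (p ^ m) = \<one>\<^bsub>?H\<^esub>"
      using E.lcs_exponent[OF sum_powers_le[OF p2] c] by blast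
    have "lcs ?H (max ?c ?d) \<subseteq> {\<one>\<^bsub>?H\<^esub>}"
    proof
      fix z assume z: "z \<in> lcs ?H (max ?c ?d)"
      have zc: "z \<in> lcs ?H ?c" and zd: "z \<in> lcs ?H ?d"
        using z H.lcs_antimono[of ?c "max ?c ?d"] H.lcs_antimono[of ?d "max ?c ?d"] by auto
      have "z = \<one>\<^bsub>?H\<^esub>"
        using khukhro_nilpotent[OF assms(1,6) H.is_group genH autH c zd] m zc by blast
      then show "z \<in> {\<one>\<^bsub>?H\<^esub>}" by simp
    qed
    then show ?thesis using T(1,2) by (intro exI[of _ "generate G T"]) auto
  qed
  then obtain M where M: "subgroup M G" "N \<subseteq> M" "lcs (G\<lparr>carrier := M\<rparr>) (max ?c ?d) \<subseteq> {\<one>\<^bsub>G\<^esub>}" by blast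
  have "lcs (G\<lparr>carrier := N\<rparr>) (max ?c ?d) \<subseteq> {\<one>\<^bsub>G\<^esub>}"
    using G.lcs_subgroup_mono[OF Ng M(1,2)] M(3) by (rule order_trans)
  then show ?thesis unfolding nilpotent_class_le_def using N.lcs_one by auto
qed

end
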